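(* Let $\mathcal E\subset J^r\pi$ be a regular system of PDEs, where $\pi:E\to M$ is a fibred manifold with $\dim M=n$. There is a one-to-one correspondence between germs of local classical solutions $\phi:U\subset M\to E$ of $\mathcal E$ and germs of $n$-dimensional polarised Legendrian submanifolds $S\subset\mathcal E$.
   Context: $r\ge1$; $J^r\pi$ is the $r$-th jet bundle ($J^0\pi=E$), $\pi_{r,s}$ the projections, $\mathcal C^r_\pi$ the Cartan distribution (locally the common kernel of $du^\alpha_I-\sum_iu^\alpha_{I+\widehat e_i}dx^i$, $|I|\le r-1$), $\mathcal G^r_\pi=\ker T\pi_{r,r-1}$. A system of PDEs of order $r$ is a regular embedded submanifold $\mathcal E\subset J^r\pi$; it is regular if $T\mathcal E\cap\mathcal C^r_\pi$ has constant rank. A classical solution is a local section $\phi:U\to E$ with $j^r\phi(U)\subset\mathcal E$. For the Levi tensor $\mathcal L(X_x,Y_x)=[X,Y]_x\bmod\mathcal C^r_\pi$ on $\mathcal C^r_\pi$, a subspace is isotropic if $\mathcal L$ vanishes on it. A submanifold $S\subset J^r\pi$ is polarised Legendrian if $T_pS\subset(\mathcal C^r_\pi)_p$ is isotropic and $(\mathcal C^r_\pi)_p=T_pS\oplus(\mathcal G^r_\pi)_p$ for every $p\in S$. The correspondence assigns to $\phi$ the image $j^r\phi(U)$. *)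

theory Defs
  imports "HOL-Analysis.Analysis" "HOL-Library.Multiset"
begin

subsection \<open>Smooth functions on open subsets of Euclidean spaces\<close>

primrec Ck_on ::
    "nat \<Rightarrow> ('a::euclidean_space \<Rightarrow> 'b::euclidean_space) \<Rightarrow> 'a set \<Rightarrow> bool" where
  "Ck_on 0 f S \<longleftrightarrow> continuous_on S f"
| "Ck_on (Suc k) f S \<longleftrightarrow> (\<forall>x\<in>S. f differentiable (at x)) \<and>
     (\<forall>v. Ck_on k (\<lambda>x. frechet_derivative f (at x) v) S)"

definition smooth_on :: "'a set \<Rightarrow> ('a::euclidean_space \<Rightarrow> 'b::euclidean_space) \<Rightarrow> bool" where
  "smooth_on S f \<longleftrightarrow> (\<forall>k. Ck_on k f S)"


subsection \<open>Smooth manifolds\<close>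

text \<open>
  A manifold is given by an atlas \<open>A\<close>, a set of charts \<open>(domain, coordinate map)\<close> with values
  in a Euclidean model space; its underlying set is the union of the domains and its
  topology is the one for which the charts are homeomorphisms onto open sets.
\<close>

type_synonym ('p, 'v) chart = "'p set \<times> ('p \<Rightarrow> 'v)"

definition is_chart :: "('p, 'v::euclidean_space) chart \<Rightarrow> bool" where
  "is_chart c \<longleftrightarrow> inj_on (snd c) (fst c) \<and> open (snd c ` fst c)"

definition chart_inv :: "('p, 'v) chart \<Rightarrow> 'v \<Rightarrow> 'p" where
  "chart_inv c = inv_into (fst c) (snd c)"

definition compatible ::
    "('p, 'v::euclidean_space) chart \<Rightarrow> ('p, 'v) chart \<Rightarrow> bool" where
  "compatible c d \<longleftrightarrow>
     open (snd c ` (fst c \<inter> fst d)) \<and> open (snd d ` (fst c \<inter> fst d)) \<and>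
     smooth_on (snd c ` (fst c \<inter> fst d)) (snd d \<circ> chart_inv c) \<and>
     smooth_on (snd d ` (fst c \<inter> fst d)) (snd c \<circ> chart_inv d)"

definition points :: "('p, 'v) chart set \<Rightarrow> 'p set" where
  "points A = (\<Union>c\<in>A. fst c)"

definition atlas_topology :: "('p, 'v::euclidean_space) chart set \<Rightarrow> 'p topology" where
  "atlas_topology A =
     topology (\<lambda>W. W \<subseteq> points A \<and> (\<forall>c\<in>A. open (snd c ` (W \<inter> fst c))))"

definition smooth_manifold :: "('p, 'v::euclidean_space) chart set \<Rightarrow> bool" where
  "smooth_manifold A \<longleftrightarrow>
     (\<forall>c\<in>A. is_chart c) \<and> (\<forall>c\<in>A. \<forall>d\<in>A. compatible c d) \<and>
     Hausdorff_space (atlas_topology A) \<and> second_countable (atlas_topology A)"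

definition maximal_atlas :: "('p, 'v::euclidean_space) chart set \<Rightarrow> ('p, 'v) chart set" where
  "maximal_atlas A = {c. is_chart c \<and> fst c \<subseteq> points A \<and> (\<forall>d\<in>A. compatible c d)}"

definition smooth_map ::
    "('p, 'v::euclidean_space) chart set \<Rightarrow> ('q, 'w::euclidean_space) chart set \<Rightarrow>
     'p set \<Rightarrow> ('p \<Rightarrow> 'q) \<Rightarrow> bool" where
  "smooth_map A B U f \<longleftrightarrow>
     continuous_map (subtopology (atlas_topology A) U) (atlas_topology B) f \<and>
     (\<forall>c\<in>A. \<forall>d\<in>B. smooth_on (snd c ` (U \<inter> fst c \<inter> f -` fst d)) (snd d \<circ> f \<circ> chart_inv c))"

text \<open>Embedded submanifolds, by means of slice charts.\<close>

definition submanifold ::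
    "('p, 'v::euclidean_space) chart set \<Rightarrow> nat \<Rightarrow> 'p set \<Rightarrow> bool" where
  "submanifold A k S \<longleftrightarrow> S \<subseteq> points A \<and>
     (\<forall>p\<in>S. \<exists>c\<in>maximal_atlas A. p \<in> fst c \<and>
        (\<exists>L. subspace L \<and> dim L = k \<and> snd c ` (S \<inter> fst c) = snd c ` fst c \<inter> L))"

text \<open>
  A tangent vector at \<open>p\<close> is represented by its components in a chart \<open>c\<close> around \<open>p\<close>. The
  tangent space of \<open>S\<close> at \<open>p\<close> consists of the velocities of smooth curves in \<open>S\<close> through \<open>p\<close>.
\<close>

definition tangent_space ::
    "('p, 'v::euclidean_space) chart \<Rightarrow> 'p set \<Rightarrow> 'p \<Rightarrow> 'v set" where
  "tangent_space c S p =
     {v. \<exists>\<gamma> \<epsilon>. \<epsilon> > 0 \<and> smooth_on {-\<epsilon><..<\<epsilon>::real} \<gamma> \<and> \<gamma> ` {-\<epsilon><..<\<epsilon>} \<subseteq> snd c ` (S \<inter> fst c) \<and>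
            \<gamma> 0 = snd c p \<and> (\<gamma> has_vector_derivative v) (at 0)}"


subsection \<open>Distributions, Levi tensor, isotropic subspaces\<close>

definition lie_bracket ::
    "('v::euclidean_space \<Rightarrow> 'v) \<Rightarrow> ('v \<Rightarrow> 'v) \<Rightarrow> 'v \<Rightarrow> 'v" where
  "lie_bracket X Y q = frechet_derivative Y (at q) (X q) - frechet_derivative X (at q) (Y q)"

definition local_extension ::
    "'v set \<Rightarrow> ('v::euclidean_space \<Rightarrow> 'v set) \<Rightarrow> 'v \<Rightarrow> 'v \<Rightarrow> ('v \<Rightarrow> 'v) \<Rightarrow> bool" where
  "local_extension Q D q v X \<longleftrightarrow> X q = v \<and>
     (\<exists>W. open W \<and> q \<in> W \<and> W \<subseteq> Q \<and> smooth_on W X \<and> (\<forall>y\<in>W. X y \<in> D y))"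

text \<open>
  The Levi tensor of a distribution \<open>D\<close> on an open set \<open>Q\<close>, at the point \<open>q\<close>: the class
  \<open>[X,Y]\<^sub>q mod D\<^sub>q\<close>, as a coset of \<open>D q\<close>, where \<open>X\<close>, \<open>Y\<close> are local sections of \<open>D\<close> extending
  \<open>v\<close>, \<open>w\<close>. The class is the same for all choices of \<open>X\<close>, \<open>Y\<close>; it is zero if it equals \<open>D q\<close>.
\<close>

definition levi_tensor ::
    "'v set \<Rightarrow> ('v::euclidean_space \<Rightarrow> 'v set) \<Rightarrow> 'v \<Rightarrow> 'v \<Rightarrow> 'v \<Rightarrow> 'v set" where
  "levi_tensor Q D q v w =
     {lie_bracket X Y q + z | X Y z.
        local_extension Q D q v X \<and> local_extension Q D q w Y \<and> z \<in> D q}"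

definition isotropic ::
    "'v set \<Rightarrow> ('v::euclidean_space \<Rightarrow> 'v set) \<Rightarrow> 'v \<Rightarrow> 'v set \<Rightarrow> bool" where
  "isotropic Q D q T \<longleftrightarrow> subspace T \<and> T \<subseteq> D q \<and>
     (\<forall>v\<in>T. \<forall>w\<in>T. levi_tensor Q D q v w = D q)"

definition direct_sum :: "'v::euclidean_space set \<Rightarrow> 'v set \<Rightarrow> 'v set \<Rightarrow> bool" where
  "direct_sum V T G \<longleftrightarrow> subspace T \<and> subspace G \<and> T \<inter> G = {0} \<and> V = {t + g | t g. t \<in> T \<and> g \<in> G}"


subsection \<open>Fibred manifolds and local sections\<close>

text \<open>
  The base has dimension \<open>n = CARD('n)\<close> and the total space has dimension \<open>n + m\<close> with
  \<open>m = CARD('m)\<close>. A fibred manifold is a surjective submersion.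
\<close>

definition fibred_manifold ::
    "('b, real^'n) chart set \<Rightarrow> ('e, (real^'n) \<times> (real^'m)) chart set \<Rightarrow> ('e \<Rightarrow> 'b) \<Rightarrow> bool" where
  "fibred_manifold M E \<pi> \<longleftrightarrow>
     smooth_manifold M \<and> smooth_manifold E \<and>
     smooth_map E M (points E) \<pi> \<and> \<pi> ` points E = points M \<and>
     (\<forall>c\<in>E. \<forall>d\<in>M. \<forall>p\<in>fst c. \<pi> p \<in> fst d \<longrightarrow>
        surj (frechet_derivative (snd d \<circ> \<pi> \<circ> chart_inv c) (at (snd c p))))"

type_synonym ('b, 'e) sect = "'b set \<times> ('b \<Rightarrow> 'e)"

definition local_section ::
    "('b, real^'n) chart set \<Rightarrow> ('e, (real^'n) \<times> (real^'m)) chart set \<Rightarrow> ('e \<Rightarrow> 'b) \<Rightarrow>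
     ('b, 'e) sect \<Rightarrow> bool" where
  "local_section M E \<pi> \<sigma> \<longleftrightarrow>
     openin (atlas_topology M) (fst \<sigma>) \<and> smooth_map M E (fst \<sigma>) (snd \<sigma>) \<and>
     (\<forall>x\<in>fst \<sigma>. \<pi> (snd \<sigma> x) = x)"

text \<open>
  A pair \<open>(b, e)\<close> of charts of base and total space is adapted if \<open>e\<close> has the form
  \<open>(x \<circ> \<pi>, u)\<close> with \<open>x\<close> the coordinates of \<open>b\<close>.
\<close>

definition adapted ::
    "('b, real^'n) chart set \<Rightarrow> ('e, (real^'n) \<times> (real^'m)) chart set \<Rightarrow> ('e \<Rightarrow> 'b) \<Rightarrow>
     ('b, real^'n) chart \<Rightarrow> ('e, (real^'n) \<times> (real^'m)) chart \<Rightarrow> bool" where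
  "adapted M E \<pi> b e \<longleftrightarrow> b \<in> maximal_atlas M \<and> e \<in> maximal_atlas E \<and>
     \<pi> ` fst e \<subseteq> fst b \<and> (\<forall>p\<in>fst e. fst (snd e p) = snd b (\<pi> p))"

definition local_rep ::
    "('b, real^'n) chart \<Rightarrow> ('e, (real^'n) \<times> (real^'m)) chart \<Rightarrow> ('b \<Rightarrow> 'e) \<Rightarrow> real^'n \<Rightarrow> real^'m"
  where "local_rep b e \<phi> = (\<lambda>y. snd (snd e (\<phi> (chart_inv b y))))"


subsection \<open>Jets\<close>

definition partial :: "'n \<Rightarrow> (real^'n \<Rightarrow> real^'m) \<Rightarrow> real^'n \<Rightarrow> real^'m" where
  "partial i f = (\<lambda>y. frechet_derivative f (at y) (axis i 1))"

text \<open>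
  Multi-indices are multisets of indices; their length \<open>|I|\<close> is \<open>size I\<close>. The order in which
  the partial derivatives are taken is immaterial for smooth functions.
\<close>

definition multi_partial :: "'n multiset \<Rightarrow> (real^'n \<Rightarrow> real^'m) \<Rightarrow> real^'n \<Rightarrow> real^'m" where
  "multi_partial I f = foldr partial (SOME l. mset l = I) f"

definition jet_equiv ::
    "('b, real^'n) chart set \<Rightarrow> ('e, (real^'n) \<times> (real^'m)) chart set \<Rightarrow> ('e \<Rightarrow> 'b) \<Rightarrow>
     nat \<Rightarrow> 'b \<Rightarrow> ('b, 'e) sect \<Rightarrow> ('b, 'e) sect \<Rightarrow> bool" where
  "jet_equiv M E \<pi> s x \<sigma> \<tau> \<longleftrightarrow> snd \<sigma> x = snd \<tau> x \<and>
     (\<forall>b e. adapted M E \<pi> b e \<and> snd \<sigma> x \<in> fst e \<longrightarrow>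
        (\<forall>I. size I \<le> s \<longrightarrow>
           multi_partial I (local_rep b e (snd \<sigma>)) (snd b x) =
           multi_partial I (local_rep b e (snd \<tau>)) (snd b x)))"

type_synonym ('b, 'e) jet = "'b \<times> ('b, 'e) sect set"

definition jet ::
    "('b, real^'n) chart set \<Rightarrow> ('e, (real^'n) \<times> (real^'m)) chart set \<Rightarrow> ('e \<Rightarrow> 'b) \<Rightarrow>
     nat \<Rightarrow> ('b, 'e) sect \<Rightarrow> 'b \<Rightarrow> ('b, 'e) jet" where
  "jet M E \<pi> s \<sigma> x =
     (x, {\<tau>. local_section M E \<pi> \<tau> \<and> x \<in> fst \<tau> \<and> jet_equiv M E \<pi> s x \<sigma> \<tau>})"

definition jet_space ::
    "('b, real^'n) chart set \<Rightarrow> ('e, (real^'n) \<times> (real^'m)) chart set \<Rightarrow> ('e \<Rightarrow> 'b) \<Rightarrow>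
     nat \<Rightarrow> ('b, 'e) jet set" where
  "jet_space M E \<pi> s = {jet M E \<pi> s \<sigma> x | \<sigma> x. local_section M E \<pi> \<sigma> \<and> x \<in> fst \<sigma>}"

definition jet_rep :: "('b, 'e) jet \<Rightarrow> 'b \<Rightarrow> 'e" where
  "jet_rep j = snd (SOME \<sigma>. \<sigma> \<in> snd j)"

text \<open>The projection onto the jets of order \<open>s\<close>, for jets of order at least \<open>s\<close>.\<close>

definition jet_proj ::
    "('b, real^'n) chart set \<Rightarrow> ('e, (real^'n) \<times> (real^'m)) chart set \<Rightarrow> ('e \<Rightarrow> 'b) \<Rightarrow>
     nat \<Rightarrow> ('b, 'e) jet \<Rightarrow> ('b, 'e) jet" where
  "jet_proj M E \<pi> s j = jet M E \<pi> s (SOME \<sigma>. \<sigma> \<in> snd j) (fst j)"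


subsection \<open>The jet bundle as a manifold\<close>

text \<open>
  The order \<open>r\<close> of the jet bundle is \<open>CARD('r)\<close> for a finite type \<open>'r\<close>, so that \<open>r \<ge> 1\<close> is
  arbitrary and the multi-indices of length at most \<open>r\<close> form a finite type. The coordinates
  are \<open>(x\<^sup>i, u\<^sub>I)\<close>, where \<open>u\<^sub>I\<close> is the vector of all \<open>u\<^sup>\<alpha>\<^sub>I\<close>.
\<close>

typedef ('n, 'r) mindex = "{I :: 'n multiset. size I \<le> CARD('r)}"
  by (rule exI[of _ "{#}"]) simp

instance mindex :: (finite, type) finite
proof
  let ?S = "\<lambda>k. {I :: 'a multiset. size I = k}"
  have "?S k \<subseteq> mset ` {l. set l \<subseteq> UNIV \<and> length l = k}" for k
    by (auto simp: image_iff) (metis ex_mset size_mset)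
  then have "finite (?S k)" for k
    by (rule finite_subset) (intro finite_imageI finite_lists_length_eq finite)
  then have "finite (\<Union>k\<le>CARD('b). ?S k)" by blast
  moreover have "{I :: 'a multiset. size I \<le> CARD('b)} \<subseteq> (\<Union>k\<le>CARD('b). ?S k)" by auto
  ultimately have "finite {I :: 'a multiset. size I \<le> CARD('b)}" by (rule rev_finite_subset)
  then show "finite (UNIV :: ('a, 'b) mindex set)"
    by (metis finite_imageI type_definition.Abs_image type_definition_mindex)
qed

type_synonym ('n, 'm, 'r) jet_coord = "(real^'n) \<times> (real^'m^('n, 'r) mindex)"

text \<open>
  Coordinates of jets of order \<open>s \<le> r\<close>; for \<open>s < r\<close> the unused components are set to zero.
\<close>

definition jet_coords ::
    "nat \<Rightarrow> ('b, real^'n) chart \<Rightarrow> ('e, (real^'n) \<times> (real^'m)) chart \<Rightarrow>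
     ('b, 'e) jet \<Rightarrow> ('n, 'm, 'r::finite) jet_coord" where
  "jet_coords s b e j =
     (snd b (fst j),
      \<chi> I. if size (Rep_mindex I) \<le> s
          then multi_partial (Rep_mindex I) (local_rep b e (jet_rep j)) (snd b (fst j)) else 0)"

definition jet_chart ::
    "('b, real^'n) chart set \<Rightarrow> ('e, (real^'n) \<times> (real^'m)) chart set \<Rightarrow> ('e \<Rightarrow> 'b) \<Rightarrow>
     ('b, real^'n) chart \<Rightarrow> ('e, (real^'n) \<times> (real^'m)) chart \<Rightarrow>
     (('b, 'e) jet, ('n, 'm, 'r::finite) jet_coord) chart" where
  "jet_chart M E \<pi> b e =
     ({j \<in> jet_space M E \<pi> CARD('r). jet_rep j (fst j) \<in> fst e}, jet_coords CARD('r) b e)"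

definition jet_bundle ::
    "'r::finite itself \<Rightarrow>
     ('b, real^'n) chart set \<Rightarrow> ('e, (real^'n) \<times> (real^'m)) chart set \<Rightarrow> ('e \<Rightarrow> 'b) \<Rightarrow>
     (('b, 'e) jet, ('n, 'm, 'r) jet_coord) chart set" where
  "jet_bundle _ M E \<pi> = {jet_chart M E \<pi> b e | b e. adapted M E \<pi> b e}"

text \<open>
  The common kernel of the forms \<open>du\<^sub>I - \<Sum>\<^sub>i u\<^bsub>I + e\<^sub>i\<^esub> dx\<^sup>i\<close>, \<open>|I| \<le> r - 1\<close>, at a point \<open>(x, u)\<close>
  of a jet chart.
\<close>

definition cartan :: "('n, 'm, 'r::finite) jet_coord \<Rightarrow> ('n::finite, 'm::finite, 'r) jet_coord set"
  where
  "cartan q = {(\<xi>, w). \<forall>I. size (Rep_mindex I) \<le> CARD('r) - 1 \<longrightarrow>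
     w $ I = (\<Sum>i\<in>UNIV. (\<xi> $ i) *\<^sub>R (snd q $ Abs_mindex (add_mset i (Rep_mindex I))))}"

text \<open>The kernel of \<open>T\<pi>\<^bsub>r,r-1\<^esub>\<close> at the jet \<open>j\<close>, in the jet chart of \<open>(b, e)\<close>.\<close>

definition vertical ::
    "('b, real^'n) chart set \<Rightarrow> ('e, (real^'n) \<times> (real^'m)) chart set \<Rightarrow> ('e \<Rightarrow> 'b) \<Rightarrow>
     ('b, real^'n) chart \<Rightarrow> ('e, (real^'n) \<times> (real^'m)) chart \<Rightarrow>
     ('b, 'e) jet \<Rightarrow> ('n, 'm, 'r::finite) jet_coord set" where
  "vertical M E \<pi> b e j =
     (let c = (jet_chart M E \<pi> b e :: (_, ('n, 'm, 'r) jet_coord) chart);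
          proj = (jet_coords (CARD('r) - 1) b e \<circ> jet_proj M E \<pi> (CARD('r) - 1) \<circ> chart_inv c
                    :: ('n, 'm, 'r) jet_coord \<Rightarrow> ('n, 'm, 'r) jet_coord)
      in {v. frechet_derivative proj (at (snd c j)) v = 0})"


subsection \<open>Systems of PDEs, solutions, polarised Legendrian submanifolds\<close>

definition pde_system ::
    "'r::finite itself \<Rightarrow>
     ('b, real^'n) chart set \<Rightarrow> ('e, (real^'n) \<times> (real^'m)) chart set \<Rightarrow> ('e \<Rightarrow> 'b) \<Rightarrow>
     ('b, 'e) jet set \<Rightarrow> bool" where
  "pde_system r M E \<pi> \<E> \<longleftrightarrow> (\<exists>k. submanifold (jet_bundle r M E \<pi>) k \<E>)"

definition regular_pde ::
    "'r::finite itself \<Rightarrow>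
     ('b, real^'n) chart set \<Rightarrow> ('e, (real^'n) \<times> (real^'m)) chart set \<Rightarrow> ('e \<Rightarrow> 'b) \<Rightarrow>
     ('b, 'e) jet set \<Rightarrow> bool" where
  "regular_pde r M E \<pi> \<E> \<longleftrightarrow> pde_system r M E \<pi> \<E> \<and>
     (\<exists>k. \<forall>c\<in>jet_bundle r M E \<pi>. \<forall>j\<in>\<E> \<inter> fst c.
        dim (tangent_space c \<E> j \<inter> cartan (snd c j)) = k)"

definition classical_solution ::
    "'r::finite itself \<Rightarrow>
     ('b, real^'n) chart set \<Rightarrow> ('e, (real^'n) \<times> (real^'m)) chart set \<Rightarrow> ('e \<Rightarrow> 'b) \<Rightarrow>
     ('b, 'e) jet set \<Rightarrow> ('b, 'e) sect \<Rightarrow> bool" where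
  "classical_solution r M E \<pi> \<E> \<sigma> \<longleftrightarrow>
     local_section M E \<pi> \<sigma> \<and> jet M E \<pi> CARD('r) \<sigma> ` fst \<sigma> \<subseteq> \<E>"

definition polarised_legendrian ::
    "'r::finite itself \<Rightarrow>
     ('b, real^'n) chart set \<Rightarrow> ('e, (real^'n) \<times> (real^'m)) chart set \<Rightarrow> ('e \<Rightarrow> 'b) \<Rightarrow>
     nat \<Rightarrow> ('b, 'e) jet set \<Rightarrow> bool" where
  "polarised_legendrian r M E \<pi> k S \<longleftrightarrow> submanifold (jet_bundle r M E \<pi>) k S \<and>
     (\<forall>b e. adapted M E \<pi> b e \<longrightarrow>
       (let c = (jet_chart M E \<pi> b e :: (_, ('n, 'm, 'r) jet_coord) chart) in
        \<forall>j\<in>S \<inter> fst c.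
          isotropic (snd c ` fst c) cartan (snd c j) (tangent_space c S j) \<and>
          direct_sum (cartan (snd c j)) (tangent_space c S j) (vertical M E \<pi> b e j)))"


subsection \<open>Germs\<close>

definition pointed_solutions ::
    "'r::finite itself \<Rightarrow>
     ('b, real^'n) chart set \<Rightarrow> ('e, (real^'n) \<times> (real^'m)) chart set \<Rightarrow> ('e \<Rightarrow> 'b) \<Rightarrow>
     ('b, 'e) jet set \<Rightarrow> ('b \<times> ('b, 'e) sect) set" where
  "pointed_solutions r M E \<pi> \<E> = {(x, \<sigma>). classical_solution r M E \<pi> \<E> \<sigma> \<and> x \<in> fst \<sigma>}"

definition solution_germ_rel ::
    "'r::finite itself \<Rightarrow>
     ('b, real^'n) chart set \<Rightarrow> ('e, (real^'n) \<times> (real^'m)) chart set \<Rightarrow> ('e \<Rightarrow> 'b) \<Rightarrow>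
     ('b, 'e) jet set \<Rightarrow> (('b \<times> ('b, 'e) sect) \<times> ('b \<times> ('b, 'e) sect)) set" where
  "solution_germ_rel r M E \<pi> \<E> =
     {((x, \<sigma>), (y, \<tau>)). (x, \<sigma>) \<in> pointed_solutions r M E \<pi> \<E> \<and>
        (y, \<tau>) \<in> pointed_solutions r M E \<pi> \<E> \<and> x = y \<and>
        (\<exists>W. openin (atlas_topology M) W \<and> x \<in> W \<and> W \<subseteq> fst \<sigma> \<inter> fst \<tau> \<and>
             (\<forall>z\<in>W. snd \<sigma> z = snd \<tau> z))}"

definition pointed_legendrians ::
    "'r::finite itself \<Rightarrow>
     ('b, real^'n) chart set \<Rightarrow> ('e, (real^'n) \<times> (real^'m)) chart set \<Rightarrow> ('e \<Rightarrow> 'b) \<Rightarrow>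
     ('b, 'e) jet set \<Rightarrow> (('b, 'e) jet \<times> ('b, 'e) jet set) set" where
  "pointed_legendrians r M E \<pi> \<E> =
     {(j, S). polarised_legendrian r M E \<pi> CARD('n) S \<and> S \<subseteq> \<E> \<and> j \<in> S}"

definition legendrian_germ_rel ::
    "'r::finite itself \<Rightarrow>
     ('b, real^'n) chart set \<Rightarrow> ('e, (real^'n) \<times> (real^'m)) chart set \<Rightarrow> ('e \<Rightarrow> 'b) \<Rightarrow>
     ('b, 'e) jet set \<Rightarrow>
     ((('b, 'e) jet \<times> ('b, 'e) jet set) \<times> (('b, 'e) jet \<times> ('b, 'e) jet set)) set" where
  "legendrian_germ_rel r M E \<pi> \<E> =
     {((j, S), (k, T)). (j, S) \<in> pointed_legendrians r M E \<pi> \<E> \<and>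
        (k, T) \<in> pointed_legendrians r M E \<pi> \<E> \<and> j = k \<and>
        (\<exists>W. openin (atlas_topology (jet_bundle r M E \<pi>)) W \<and> j \<in> W \<and> S \<inter> W = T \<inter> W)}"

end

theory Submission
  imports Defs
begin

text \<open>
  In adapted coordinates \<open>(x, u\<^sub>I)\<close> the \<open>r\<close>-jets of a section \<open>u(x)\<close> form the graph
  \<open>x \<mapsto> (x, \<partial>\<^sub>I u(x))\<close>, its prolongation. A tangent vector over \<open>\<xi>\<close> is \<open>(\<xi>, \<Sum>\<^sub>i \<xi>\<^sub>i \<partial>\<^sub>I\<^sub>+\<^sub>i u)\<close>; hence it
  lies in the Cartan distribution. A vector of that distribution with \<open>\<xi> = 0\<close> has vanishing
  components for \<open>|I| < r\<close>, so it is vertical for the projection to jets of order \<open>r - 1\<close>; this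
  gives the splitting into tangent and vertical vectors. The Levi tensor of the tangent vectors
  over \<open>\<xi>\<close> and \<open>\<eta>\<close> has the components
  \<open>\<Sum>\<^sub>i\<^sub>,\<^sub>k \<eta>\<^sub>i \<xi>\<^sub>k (\<partial>\<^sub>k \<partial>\<^sub>i \<partial>\<^sub>I u - \<partial>\<^sub>i \<partial>\<^sub>k \<partial>\<^sub>I u)\<close> modulo the distribution, which vanish by the symmetry of
  second derivatives. So the jets of a solution form a polarised Legendrian submanifold
  (\<open>jet_image_polarised_legendrian\<close>).

  Conversely, let \<open>S\<close> be polarised Legendrian of dimension \<open>n\<close>. A tangent vector of \<open>S\<close> with
  \<open>\<xi> = 0\<close> is vertical, hence zero. So \<open>S\<close> projects locally diffeomorphically onto the base, and the
  inverse function theorem writes it as a smooth graph \<open>x \<mapsto> (x, u\<^sub>I(x))\<close>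
  (\<open>submanifold_local_graph\<close>). Tangency to the Cartan distribution says \<open>\<partial>\<^sub>i u\<^sub>I = u\<^sub>I\<^sub>+\<^sub>i\<close> for
  \<open>|I| < r\<close>, so \<open>u\<^sub>I = \<partial>\<^sub>I u\<^sub>\<emptyset>\<close> by induction on \<open>|I|\<close> (\<open>cartan_section_is_prolongation\<close>), and \<open>S\<close> is
  locally the set of jets of the section \<open>u\<^sub>\<emptyset>\<close> (\<open>polarised_legendrian_is_jet_image\<close>).

  The assignment descends to germs because jets depend only on the germ of the section, and it is
  injective on germs because a jet knows its base point and its value while the prolongation is
  continuous (\<open>solution_germ_iff_legendrian_germ\<close>). The rest is an argument about quotients.

  Two points hold this together. Jet charts are injective, that is, equality of jets may be tested
  in one adapted chart; this is the chain rule for derivatives of all orders, organised below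
  through the relation \<open>same_jet\<close>. And the topology near a jet of the system is read off from the
  slice charts of the system: these are compatible with every jet chart, so near the system
  each jet chart restricts to a chart of the maximal atlas (\<open>chart_restrict_maximal\<close>).
\<close>


section \<open>Calculus of smooth functions on open sets\<close>

abbreviation directional ::
    "'a::euclidean_space \<Rightarrow> ('a \<Rightarrow> 'b::euclidean_space) \<Rightarrow> 'a \<Rightarrow> 'b" where
  "directional v f \<equiv> (\<lambda>x. frechet_derivative f (at x) v)"

lemma directional_eqI: "(f has_derivative D) (at x) \<Longrightarrow> directional v f x = D v"
  by (simp add: frechet_derivative_at[symmetric])

lemma frechet_derivative_cong_open:
  assumes "open S" "x \<in> S" "\<And>y. y \<in> S \<Longrightarrow> f y = g y"
  shows "frechet_derivative f (at x) = frechet_derivative g (at x)"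
proof -
  have "(f has_derivative D) (at x) \<longleftrightarrow> (g has_derivative D) (at x)" for D
    using assms has_derivative_transform_within_open[of f D x UNIV S g]
      has_derivative_transform_within_open[of g D x UNIV S f] by auto
  then show ?thesis by (simp add: frechet_derivative_def)
qed

lemma differentiable_cong_open:
  assumes "open S" "x \<in> S" "\<And>y. y \<in> S \<Longrightarrow> f y = g y" "f differentiable (at x)"
  shows "g differentiable (at x)"
  using assms has_derivative_transform_within_open unfolding differentiable_def by metis

lemma linear_frechet_derivative:
  "f differentiable (at x) \<Longrightarrow> linear (frechet_derivative f (at x))"
  using frechet_derivative_works has_derivative_linear by blast

lemma directional_compose:
  fixes g :: "'b::euclidean_space \<Rightarrow> 'c::euclidean_space"
  assumes "f differentiable (at x)" "g differentiable (at (f x))"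
  shows "directional v (\<lambda>x. g (f x)) x =
    (\<Sum>b\<in>Basis. (directional v f x \<bullet> b) *\<^sub>R directional b g (f x))"
proof -
  interpret L: linear "frechet_derivative g (at (f x))"
    using assms(2) by (rule linear_frechet_derivative)
  have "directional v (\<lambda>x. g (f x)) x = frechet_derivative g (at (f x)) (directional v f x)"
    using frechet_derivative_compose[OF assms] by (simp add: o_def)
  also have "\<dots> = frechet_derivative g (at (f x))
      (\<Sum>b\<in>Basis. (directional v f x \<bullet> b) *\<^sub>R b)"
    by (simp only: euclidean_representation)
  also have "\<dots> = (\<Sum>b\<in>Basis. (directional v f x \<bullet> b) *\<^sub>R directional b g (f x))"
    by (simp add: L.sum L.scale)
  finally show ?thesis .
qed

lemma directional_add:
  "f differentiable (at x) \<Longrightarrow> g differentiable (at x) \<Longrightarrow>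
   directional v (\<lambda>x. f x + g x) x = directional v f x + directional v g x"
  by (rule directional_eqI) (auto intro!: derivative_eq_intros simp: frechet_derivative_works)

lemma directional_scaleR:
  fixes f :: "'a::euclidean_space \<Rightarrow> real"
  shows "f differentiable (at x) \<Longrightarrow> g differentiable (at x) \<Longrightarrow>
   directional v (\<lambda>x. f x *\<^sub>R g x) x = f x *\<^sub>R directional v g x + directional v f x *\<^sub>R g x"
  by (rule directional_eqI[where D = "\<lambda>v. f x *\<^sub>R directional v g x + directional v f x *\<^sub>R g x"])
     (auto intro!: derivative_eq_intros simp: frechet_derivative_works)

lemma differentiable_bounded_linear:
  "bounded_linear L \<Longrightarrow> f differentiable F \<Longrightarrow> (\<lambda>x. L (f x)) differentiable F"
  unfolding differentiable_def using bounded_linear.has_derivative by metis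

lemma directional_linear:
  assumes "bounded_linear L" "f differentiable (at x)"
  shows "directional v (\<lambda>x. L (f x)) x = L (directional v f x)"
  by (rule directional_eqI)
     (intro bounded_linear.has_derivative[OF assms(1)] assms(2)[unfolded frechet_derivative_works])

lemma Ck_on_subset: "Ck_on k f S \<Longrightarrow> T \<subseteq> S \<Longrightarrow> Ck_on k f T"
  by (induction k arbitrary: f) (auto intro: continuous_on_subset)

lemma Ck_on_cong:
  "open S \<Longrightarrow> (\<And>x. x \<in> S \<Longrightarrow> f x = g x) \<Longrightarrow> Ck_on k f S \<Longrightarrow> Ck_on k g S"
proof (induction k arbitrary: f g)
  case 0
  then show ?case using continuous_on_cong[OF refl, of S f g] by simp
next
  case (Suc k)
  show ?case
    unfolding Ck_on.simps
  proof (intro conjI ballI allI)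
    fix x assume "x \<in> S"
    then show "g differentiable (at x)"
      using Suc.prems differentiable_cong_open[of S x f g] by auto
  next
    fix v
    show "Ck_on k (directional v g) S"
    proof (rule Suc.IH[OF Suc.prems(1)])
      show "Ck_on k (directional v f) S" using Suc.prems(3) by simp
      show "directional v f x = directional v g x" if "x \<in> S" for x
        using frechet_derivative_cong_open[OF Suc.prems(1) that, of f g] Suc.prems(2) by simp
    qed
  qed
qed

text \<open>
  With this, smoothness of a map between manifolds may be checked near one point at a time,
  where suitable charts exist.
\<close>

lemma Ck_on_locally:
  "(\<And>x. x \<in> S \<Longrightarrow> \<exists>T. open T \<and> x \<in> T \<and> Ck_on k f T) \<Longrightarrow> Ck_on k f S"
proof (induction k arbitrary: f)
  case 0
  then show ?case
    by (metis Ck_on.simps(1) continuous_at_imp_continuous_on continuous_on_eq_continuous_at)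
next
  case (Suc k)
  show ?case
    unfolding Ck_on.simps
  proof (intro conjI ballI allI)
    fix x assume "x \<in> S"
    then show "f differentiable (at x)" using Suc.prems by fastforce
  next
    fix v
    show "Ck_on k (directional v f) S"
      by (rule Suc.IH) (use Suc.prems in fastforce)
  qed
qed

lemma Ck_on_SucD: "Ck_on (Suc k) f S \<Longrightarrow> Ck_on k f S"
proof (induction k arbitrary: f)
  case 0
  then show ?case
    by (auto intro!: continuous_at_imp_continuous_on differentiable_imp_continuous_within)
next
  case (Suc k)
  show ?case
    unfolding Ck_on.simps
  proof (intro conjI ballI allI)
    show "f differentiable (at x)" if "x \<in> S" for x using Suc.prems that by auto
    show "Ck_on k (directional v f) S" for v
      by (rule Suc.IH) (use Suc.prems in \<open>unfold Ck_on.simps(2)[of "Suc k"], blast\<close>)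
  qed
qed

lemma Ck_on_const: "Ck_on k (\<lambda>x. c) S"
  by (induction k arbitrary: c) auto

lemma Ck_on_bounded_linear:
  assumes "bounded_linear L" "open S"
  shows "Ck_on k f S \<Longrightarrow> Ck_on k (\<lambda>x. L (f x)) S"
proof (induction k arbitrary: f)
  case 0
  then show ?case using bounded_linear.continuous_on[OF assms(1)] by auto
next
  case (Suc k)
  show ?case
    unfolding Ck_on.simps
  proof (intro conjI ballI allI)
    show "(\<lambda>x. L (f x)) differentiable (at x)" if "x \<in> S" for x
      using Suc.prems that by (intro differentiable_bounded_linear[OF assms(1)]) simp
    fix v
    have "Ck_on k (\<lambda>x. L (directional v f x)) S" using Suc by auto
    then show "Ck_on k (directional v (\<lambda>x. L (f x))) S"
      by (rule Ck_on_cong[OF assms(2), rotated])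
         (use Suc.prems in \<open>simp add: directional_linear[OF assms(1)]\<close>)
  qed
qed

lemma Ck_on_ident: "Ck_on k (\<lambda>x. x) S"
  by (cases k) (auto simp: Ck_on_const)

lemma Ck_on_linear: "bounded_linear L \<Longrightarrow> Ck_on k L S"
  by (rule Ck_on_subset[OF Ck_on_bounded_linear[where f = "\<lambda>x. x", OF _ open_UNIV Ck_on_ident]])
    simp_all

lemma Ck_on_add:
  "open S \<Longrightarrow> Ck_on k f S \<Longrightarrow> Ck_on k g S \<Longrightarrow> Ck_on k (\<lambda>x. f x + g x) S"
proof (induction k arbitrary: f g)
  case 0
  then show ?case by (auto intro: continuous_intros)
next
  case (Suc k)
  show ?case
    unfolding Ck_on.simps
  proof (intro conjI ballI allI)
    show "(\<lambda>x. f x + g x) differentiable (at x)" if "x \<in> S" for x using Suc.prems that by auto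
    fix v
    have "Ck_on k (\<lambda>x. directional v f x + directional v g x) S" using Suc by auto
    then show "Ck_on k (directional v (\<lambda>x. f x + g x)) S"
      by (rule Ck_on_cong[OF Suc.prems(1), rotated]) (use Suc.prems in \<open>simp add: directional_add\<close>)
  qed
qed

lemma Ck_on_sum:
  "open S \<Longrightarrow> (\<And>i. i \<in> I \<Longrightarrow> Ck_on k (f i) S) \<Longrightarrow> Ck_on k (\<lambda>x. \<Sum>i\<in>I. f i x) S"
proof (induction I rule: infinite_finite_induct)
  case (insert i I)
  have "Ck_on k (\<lambda>x. f i x + (\<Sum>i\<in>I. f i x)) S"
    by (rule Ck_on_add) (use insert in simp_all)
  then show ?case using insert.hyps by simp
qed (simp_all add: Ck_on_const)

lemma Ck_on_scaleR:
  fixes f :: "'a::euclidean_space \<Rightarrow> real"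
  shows "open S \<Longrightarrow> Ck_on k f S \<Longrightarrow> Ck_on k g S \<Longrightarrow> Ck_on k (\<lambda>x. f x *\<^sub>R g x) S"
proof (induction k arbitrary: f g)
  case 0
  then show ?case by (auto intro: continuous_intros)
next
  case (Suc k)
  show ?case
    unfolding Ck_on.simps
  proof (intro conjI ballI allI)
    show "(\<lambda>x. f x *\<^sub>R g x) differentiable (at x)" if "x \<in> S" for x
      using Suc.prems that by (auto intro!: differentiable_scaleR)
    fix v
    have "Ck_on k (\<lambda>x. f x *\<^sub>R directional v g x + directional v f x *\<^sub>R g x) S"
      using Suc.prems by (intro Ck_on_add Suc.IH) (auto intro: Ck_on_SucD)
    then show "Ck_on k (directional v (\<lambda>x. f x *\<^sub>R g x)) S"
      by (rule Ck_on_cong[OF Suc.prems(1), rotated])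
         (use Suc.prems in \<open>simp add: directional_scaleR\<close>)
  qed
qed

text \<open>
  The derivative of a composite is a sum of products of a derivative of the inner function with
  a derivative of the outer one at the inner function. The latter is again a composite, with one
  derivative less, which drives the induction.
\<close>

lemma Ck_on_compose:
  fixes f :: "'a::euclidean_space \<Rightarrow> 'b::euclidean_space" and g :: "'b \<Rightarrow> 'c::euclidean_space"
  assumes "open S" "open T" "f ` S \<subseteq> T"
  shows "Ck_on k f S \<Longrightarrow> Ck_on k g T \<Longrightarrow> Ck_on k (\<lambda>x. g (f x)) S"
proof (induction k arbitrary: g)
  case 0
  then show ?case using assms(3) continuous_on_compose2[of T g S f] by auto
next
  case (Suc k)
  have df: "f differentiable (at x)" "g differentiable (at (f x))" if "x \<in> S" for x
    using Suc.prems assms(3) that by auto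
  have dg: "Ck_on k (\<lambda>x. directional b g (f x)) S" for b
    by (rule Suc.IH[OF Ck_on_SucD[OF Suc.prems(1)]]) (use Suc.prems(2) in simp)
  show ?case
    unfolding Ck_on.simps
  proof (intro conjI ballI allI)
    show "(\<lambda>x. g (f x)) differentiable (at x)" if "x \<in> S" for x
      using differentiable_chain_at[OF df[OF that]] by (simp add: o_def)
    fix v
    have "Ck_on k (\<lambda>x. \<Sum>b\<in>Basis. (directional v f x \<bullet> b) *\<^sub>R directional b g (f x)) S"
      by (intro Ck_on_sum Ck_on_scaleR assms(1) dg
          Ck_on_bounded_linear[OF bounded_linear_inner_left assms(1)]) (use Suc.prems in auto)
    then show "Ck_on k (directional v (\<lambda>x. g (f x))) S"
      by (rule Ck_on_cong[OF assms(1), rotated]) (simp add: directional_compose df)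
  qed
qed

lemma smooth_on_subset: "smooth_on S f \<Longrightarrow> T \<subseteq> S \<Longrightarrow> smooth_on T f"
  unfolding smooth_on_def using Ck_on_subset by blast

lemma smooth_on_cong:
  "open S \<Longrightarrow> (\<And>x. x \<in> S \<Longrightarrow> f x = g x) \<Longrightarrow> smooth_on S f \<Longrightarrow> smooth_on S g"
  unfolding smooth_on_def using Ck_on_cong by blast

lemma smooth_on_locally:
  assumes "\<And>x. x \<in> S \<Longrightarrow> \<exists>T. open T \<and> x \<in> T \<and> smooth_on T f"
  shows "smooth_on S f"
  unfolding smooth_on_def
proof
  show "Ck_on k f S" for k
    by (rule Ck_on_locally) (use assms in \<open>auto simp: smooth_on_def\<close>)
qed

lemma smooth_on_directional: "smooth_on S f \<Longrightarrow> smooth_on S (directional v f)"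
  unfolding smooth_on_def using Ck_on.simps(2) by blast

lemma smooth_on_differentiable: "smooth_on S f \<Longrightarrow> x \<in> S \<Longrightarrow> f differentiable (at x)"
  unfolding smooth_on_def using Ck_on.simps(2)[of 0 f S] by blast

lemma smooth_on_has_derivative:
  "smooth_on S f \<Longrightarrow> x \<in> S \<Longrightarrow> (f has_derivative (\<lambda>v. directional v f x)) (at x)"
  using smooth_on_differentiable frechet_derivative_works by blast

lemma smooth_on_continuous_on: "smooth_on S f \<Longrightarrow> continuous_on S f"
  unfolding smooth_on_def using Ck_on.simps(1) by blast

lemma smooth_on_const: "smooth_on S (\<lambda>x. c)"
  by (simp add: smooth_on_def Ck_on_const)

lemma smooth_on_ident: "smooth_on S (\<lambda>x. x)"
  by (simp add: smooth_on_def Ck_on_ident)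

lemma smooth_on_linear: "bounded_linear L \<Longrightarrow> smooth_on S L"
  by (simp add: smooth_on_def Ck_on_linear)

lemma smooth_on_bounded_linear:
  "bounded_linear L \<Longrightarrow> open S \<Longrightarrow> smooth_on S f \<Longrightarrow> smooth_on S (\<lambda>x. L (f x))"
  by (simp add: smooth_on_def Ck_on_bounded_linear)

lemma smooth_on_add:
  "open S \<Longrightarrow> smooth_on S f \<Longrightarrow> smooth_on S g \<Longrightarrow> smooth_on S (\<lambda>x. f x + g x)"
  by (simp add: smooth_on_def Ck_on_add)

lemma smooth_on_sum:
  "open S \<Longrightarrow> (\<And>i. i \<in> I \<Longrightarrow> smooth_on S (f i)) \<Longrightarrow> smooth_on S (\<lambda>x. \<Sum>i\<in>I. f i x)"
  by (simp add: smooth_on_def Ck_on_sum)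

lemma smooth_on_scaleR:
  "open S \<Longrightarrow> smooth_on S f \<Longrightarrow> smooth_on S g \<Longrightarrow> smooth_on S (\<lambda>x. (f x :: real) *\<^sub>R g x)"
  by (simp add: smooth_on_def Ck_on_scaleR)

lemma smooth_on_compose:
  "open S \<Longrightarrow> open T \<Longrightarrow> smooth_on S f \<Longrightarrow> smooth_on T g \<Longrightarrow> f ` S \<subseteq> T \<Longrightarrow>
   smooth_on S (\<lambda>x. g (f x))"
  by (simp add: smooth_on_def Ck_on_compose)

lemma smooth_on_diff:
  assumes "open S" "smooth_on S f" "smooth_on S g"
  shows "smooth_on S (\<lambda>x. f x - g x)"
proof -
  have "smooth_on S (\<lambda>x. - g x)"
    by (rule smooth_on_bounded_linear[OF bounded_linear_minus[OF bounded_linear_ident] assms(1,3)])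
  then have "smooth_on S (\<lambda>x. f x + - g x)" by (rule smooth_on_add[OF assms(1,2)])
  then show ?thesis by simp
qed

lemma smooth_on_fst: "open S \<Longrightarrow> smooth_on S f \<Longrightarrow> smooth_on S (\<lambda>x. fst (f x))"
  by (rule smooth_on_bounded_linear[OF bounded_linear_fst])

lemma smooth_on_snd: "open S \<Longrightarrow> smooth_on S f \<Longrightarrow> smooth_on S (\<lambda>x. snd (f x))"
  by (rule smooth_on_bounded_linear[OF bounded_linear_snd])

lemma smooth_on_Pair:
  assumes "open S" "smooth_on S f" "smooth_on S g"
  shows "smooth_on S (\<lambda>x. (f x, g x))"
proof -
  have 1: "bounded_linear (\<lambda>x :: 'b. (x, 0 :: 'c))" "bounded_linear (\<lambda>y :: 'c. (0 :: 'b, y))"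
    by (auto intro!: bounded_linear_intros bounded_linear_Pair bounded_linear_ident bounded_linear_zero)
  have "smooth_on S (\<lambda>x. (f x, 0) + (0, g x))"
    by (intro smooth_on_add smooth_on_bounded_linear[OF 1(1)] smooth_on_bounded_linear[OF 1(2)] assms)
  then show ?thesis by simp
qed

lemma Ck_on_vec:
  assumes "open S" "\<And>i. Ck_on k (\<lambda>x. f x $ i) S"
  shows "Ck_on k f S"
proof -
  have "Ck_on k (\<lambda>x. \<Sum>i\<in>UNIV. axis i (f x $ i)) S"
    by (intro Ck_on_sum assms(1) Ck_on_bounded_linear[OF _ assms(1) assms(2)])
       (auto simp: linear_conv_bounded_linear[symmetric] linear_iff axis_def vec_eq_iff)
  moreover have "(\<lambda>x. \<Sum>i\<in>UNIV. axis i (f x $ i)) = f"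
    by (auto simp: vec_eq_iff axis_def)
  ultimately show ?thesis by simp
qed

lemma smooth_on_vec:
  "open S \<Longrightarrow> (\<And>i. smooth_on S (\<lambda>x. f x $ i)) \<Longrightarrow> smooth_on S f"
  by (simp add: smooth_on_def Ck_on_vec)

lemma smooth_on_vec_nth: "open S \<Longrightarrow> smooth_on S f \<Longrightarrow> smooth_on S (\<lambda>x. f x $ i)"
  by (rule smooth_on_bounded_linear[OF bounded_linear_vec_nth])


section \<open>Symmetry of second derivatives\<close>

text \<open>
  The second difference is an increment in direction \<open>v\<close> of an increment in
  direction \<open>u\<close>; the mean value theorem is applied to each of the two.
\<close>

lemma second_difference_mvt:
  fixes f :: "'a::euclidean_space \<Rightarrow> real"
  assumes "0 < h"
    and d: "\<And>s t. 0 \<le> s \<Longrightarrow> s \<le> h \<Longrightarrow> 0 \<le> t \<Longrightarrow> t \<le> h \<Longrightarrow>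
          f differentiable (at (x + s *\<^sub>R u + t *\<^sub>R v)) \<and>
          directional u f differentiable (at (x + s *\<^sub>R u + t *\<^sub>R v))"
  obtains s t where "0 \<le> s" "s \<le> h" "0 \<le> t" "t \<le> h"
    "f (x + h *\<^sub>R u + h *\<^sub>R v) - f (x + h *\<^sub>R u) - f (x + h *\<^sub>R v) + f x =
       h * h * directional v (directional u f) (x + s *\<^sub>R u + t *\<^sub>R v)"
proof -
  have line: "((\<lambda>s. g (y + s *\<^sub>R w)) has_real_derivative directional w g (y + s *\<^sub>R w)) (at s)"
    if "g differentiable (at (y + s *\<^sub>R w))" for g :: "'a \<Rightarrow> real" and y w s
  proof -
    have "(g has_derivative frechet_derivative g (at (y + s *\<^sub>R w))) (at (y + s *\<^sub>R w))"
      using that frechet_derivative_works by blast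
    moreover have "((\<lambda>s. y + s *\<^sub>R w) has_derivative (\<lambda>s. s *\<^sub>R w)) (at s)"
      by (auto intro!: derivative_eq_intros)
    ultimately have "((\<lambda>s. g (y + s *\<^sub>R w)) has_derivative
        (\<lambda>r. frechet_derivative g (at (y + s *\<^sub>R w)) (r *\<^sub>R w))) (at s)"
      using diff_chain_at[of "\<lambda>s. y + s *\<^sub>R w" "\<lambda>s. s *\<^sub>R w" s g] by (simp add: o_def)
    then show ?thesis
      using linear_cmul[OF linear_frechet_derivative[OF that]]
      by (simp add: has_field_derivative_def mult_commute_abs)
  qed
  define \<phi> where "\<phi> s = f ((x + h *\<^sub>R v) + s *\<^sub>R u) - f (x + s *\<^sub>R u)" for s
  have "(\<phi> has_real_derivative
      directional u f ((x + h *\<^sub>R v) + s *\<^sub>R u) - directional u f (x + s *\<^sub>R u)) (at s)"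
    if "0 \<le> s" "s \<le> h" for s
    unfolding \<phi>_def using d[OF that, of 0] d[OF that, of h] \<open>0 < h\<close>
    by (intro DERIV_diff line) (auto simp: algebra_simps)
  from MVT2[OF \<open>0 < h\<close>, of \<phi>, OF this] obtain s where s: "0 < s" "s < h"
    "\<phi> h - \<phi> 0 = (h - 0) * (directional u f ((x + h *\<^sub>R v) + s *\<^sub>R u) - directional u f (x + s *\<^sub>R u))"
    by blast
  have "((\<lambda>t. directional u f ((x + s *\<^sub>R u) + t *\<^sub>R v)) has_real_derivative
      directional v (directional u f) ((x + s *\<^sub>R u) + t *\<^sub>R v)) (at t)"
    if "0 \<le> t" "t \<le> h" for t
    using d[of s t] s that by (intro line) auto
  from MVT2[OF \<open>0 < h\<close>, of "\<lambda>t. directional u f ((x + s *\<^sub>R u) + t *\<^sub>R v)", OF this]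
  obtain t where t: "0 < t" "t < h"
    "directional u f ((x + s *\<^sub>R u) + h *\<^sub>R v) - directional u f ((x + s *\<^sub>R u) + 0 *\<^sub>R v) =
      (h - 0) * directional v (directional u f) ((x + s *\<^sub>R u) + t *\<^sub>R v)"
    by blast
  show ?thesis
  proof (rule that)
    show "0 \<le> s" "s \<le> h" "0 \<le> t" "t \<le> h" using s t by auto
    show "f (x + h *\<^sub>R u + h *\<^sub>R v) - f (x + h *\<^sub>R u) - f (x + h *\<^sub>R v) + f x =
       h * h * directional v (directional u f) (x + s *\<^sub>R u + t *\<^sub>R v)"
      using s(3) t(3) by (simp add: \<phi>_def algebra_simps)
  qed
qed

text \<open>
  The second difference is symmetric in \<open>u\<close> and \<open>v\<close>, so it is
  \<open>h\<^sup>2\<close> times either mixed derivative, each at some point within distance of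
  order \<open>h\<close>. Continuity gives the equality as \<open>h \<rightarrow> 0\<close>.
\<close>

lemma directional_commute_real:
  fixes f :: "'a::euclidean_space \<Rightarrow> real"
  assumes "open S" "smooth_on S f" "x \<in> S"
  shows "directional v (directional u f) x = directional u (directional v f) x"
proof -
  obtain e where e: "0 < e" "ball x e \<subseteq> S"
    using assms(1,3) openE by blast
  define K where "K = norm u + norm v + 1"
  have K: "0 < K" unfolding K_def by (smt (verit) norm_ge_zero)
  have near: "dist x (x + s *\<^sub>R u + t *\<^sub>R v) \<le> h * K"
    if "0 \<le> s" "s \<le> h" "0 \<le> t" "t \<le> h" for s t h
  proof -
    have "norm (s *\<^sub>R u + t *\<^sub>R v) \<le> s * norm u + t * norm v"
      using that norm_triangle_ineq[of "s *\<^sub>R u" "t *\<^sub>R v"] by simp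
    also have "\<dots> \<le> h * norm u + h * norm v" using that by (intro add_mono mult_right_mono) auto
    also have "\<dots> \<le> h * K" using that by (simp add: K_def algebra_simps)
    finally show ?thesis
      by (metis add.assoc add_diff_cancel_left' dist_commute dist_norm)
  qed
  have near': "dist x (x + s *\<^sub>R v + t *\<^sub>R u) \<le> h * K"
    if "0 \<le> s" "s \<le> h" "0 \<le> t" "t \<le> h" for s t h
    using near[OF that(3,4,1,2)] by (simp add: add_ac)
  have approx: "\<exists>y. dist x y \<le> h * K \<and>
      f (x + h *\<^sub>R u + h *\<^sub>R v) - f (x + h *\<^sub>R u) - f (x + h *\<^sub>R v) + f x =
        h * h * directional v (directional u f) y"
    if h: "0 < h" "h * K < e" and near: "\<And>s t. 0 \<le> s \<Longrightarrow> s \<le> h \<Longrightarrow> 0 \<le> t \<Longrightarrow> t \<le> h \<Longrightarrow>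
        dist x (x + s *\<^sub>R u + t *\<^sub>R v) \<le> h * K" for h u v
  proof -
    have "f differentiable (at (x + s *\<^sub>R u + t *\<^sub>R v)) \<and>
          directional u f differentiable (at (x + s *\<^sub>R u + t *\<^sub>R v))"
      if "0 \<le> s" "s \<le> h" "0 \<le> t" "t \<le> h" for s t
    proof -
      have "x + s *\<^sub>R u + t *\<^sub>R v \<in> S" using near[OF that] h e(2) by (auto simp: subset_iff)
      then show ?thesis
        using smooth_on_differentiable assms(2) smooth_on_directional by blast
    qed
    from second_difference_mvt[OF h(1) this] obtain s t where
      "0 \<le> s" "s \<le> h" "0 \<le> t" "t \<le> h"
      "f (x + h *\<^sub>R u + h *\<^sub>R v) - f (x + h *\<^sub>R u) - f (x + h *\<^sub>R v) + f x =
       h * h * directional v (directional u f) (x + s *\<^sub>R u + t *\<^sub>R v)"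
      by blast
    then show ?thesis using near[of s t] by blast
  qed
  \<comment> \<open>A null sequence with \<open>h n * K < e\<close>, which keeps all points in the ball inside \<open>S\<close>.\<close>
  define h where "h n = e / (2 * K * real (Suc n))" for n
  have h: "0 < h n" "h n * K < e" for n
  proof -
    show "0 < h n" using e K by (simp add: h_def)
    have "h n * K = e / (2 * real (Suc n))" using K by (simp add: h_def)
    also have "\<dots> < e" using e by (simp add: field_simps add_pos_nonneg)
    finally show "h n * K < e" .
  qed
  have "\<exists>y z. dist x y \<le> h n * K \<and> dist x z \<le> h n * K \<and>
      directional v (directional u f) y = directional u (directional v f) z" for n
  proof -
    obtain y where y: "dist x y \<le> h n * K"
      "f (x + h n *\<^sub>R u + h n *\<^sub>R v) - f (x + h n *\<^sub>R u) - f (x + h n *\<^sub>R v) + f x =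
        h n * h n * directional v (directional u f) y"
      using approx[OF h near] by blast
    obtain z where z: "dist x z \<le> h n * K"
      "f (x + h n *\<^sub>R v + h n *\<^sub>R u) - f (x + h n *\<^sub>R v) - f (x + h n *\<^sub>R u) + f x =
        h n * h n * directional u (directional v f) z"
      using approx[OF h, of n v u] near' by blast
    have "f (x + h n *\<^sub>R v + h n *\<^sub>R u) - f (x + h n *\<^sub>R v) - f (x + h n *\<^sub>R u) + f x =
      f (x + h n *\<^sub>R u + h n *\<^sub>R v) - f (x + h n *\<^sub>R u) - f (x + h n *\<^sub>R v) + f x"
      by (simp add: algebra_simps)
    from trans[OF trans[OF y(2)[symmetric] this[symmetric]] z(2)]
    have "h n * h n * directional v (directional u f) y = h n * h n * directional u (directional v f) z" .
    moreover have "h n * h n \<noteq> 0" using h(1)[of n] by simp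
    ultimately have "directional v (directional u f) y = directional u (directional v f) z"
      using mult_left_cancel by blast
    then show ?thesis using y z by blast
  qed
  then obtain y z where yz: "\<And>n. dist x (y n) \<le> h n * K" "\<And>n. dist x (z n) \<le> h n * K"
    "\<And>n. directional v (directional u f) (y n) = directional u (directional v f) (z n)"
    by metis
  have h0: "(\<lambda>n. h n * K) \<longlonglongrightarrow> 0"
  proof -
    have "(\<lambda>n. (e / 2) * inverse (real (Suc n))) \<longlonglongrightarrow> (e / 2) * 0"
      by (intro tendsto_intros LIMSEQ_inverse_real_of_nat)
    moreover have "h n * K = (e / 2) * inverse (real (Suc n))" for n
    proof -
      have "h n * K = e / (2 * real (Suc n))" using K by (simp add: h_def)
      also have "\<dots> = (e / 2) * inverse (real (Suc n))" by (simp only: divide_inverse inverse_mult_distrib mult.assoc)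
      finally show ?thesis .
    qed
    ultimately show ?thesis by (simp only: mult_zero_right)
  qed
  have lim: "w \<longlonglongrightarrow> x" if "\<And>n. dist x (w n) \<le> h n * K" for w
    by (rule metric_tendsto_imp_tendsto[OF h0]) (use that h K in \<open>auto simp: dist_commute less_imp_le\<close>)
  have cont: "isCont (directional a (directional b f)) x" for a b
    using smooth_on_continuous_on[OF smooth_on_directional[OF smooth_on_directional[OF assms(2)]]]
      continuous_on_eq_continuous_at[OF assms(1)] assms(3) by blast
  have "(\<lambda>n. directional v (directional u f) (y n)) \<longlonglongrightarrow> directional v (directional u f) x"
    by (rule isCont_tendsto_compose[OF cont lim[OF yz(1)]])
  moreover have "(\<lambda>n. directional u (directional v f) (z n)) \<longlonglongrightarrow> directional u (directional v f) x"
    by (rule isCont_tendsto_compose[OF cont lim[OF yz(2)]])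
  ultimately show ?thesis using yz(3) LIMSEQ_unique by simp
qed

lemma directional_commute:
  fixes f :: "'a::euclidean_space \<Rightarrow> 'b::euclidean_space"
  assumes "open S" "smooth_on S f" "x \<in> S"
  shows "directional v (directional u f) x = directional u (directional v f) x"
proof (rule euclidean_eqI)
  fix b :: 'b
  have bl: "bounded_linear (\<lambda>y. y \<bullet> b)" by (rule bounded_linear_inner_left)
  have comp: "directional v (directional u (\<lambda>y. f y \<bullet> b)) x = directional v (directional u f) x \<bullet> b" for u v
  proof -
    have "directional v (directional u (\<lambda>y. f y \<bullet> b)) x = directional v (\<lambda>y. directional u f y \<bullet> b) x"
      by (rule fun_cong[OF frechet_derivative_cong_open[OF assms(1,3)]])
         (simp add: directional_linear[OF bl smooth_on_differentiable[OF assms(2)]])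
    also have "\<dots> = directional v (directional u f) x \<bullet> b"
      by (rule directional_linear[OF bl])
         (rule smooth_on_differentiable[OF smooth_on_directional[OF assms(2)] assms(3)])
    finally show ?thesis .
  qed
  show "directional v (directional u f) x \<bullet> b = directional u (directional v f) x \<bullet> b"
    using directional_commute_real[OF assms(1) smooth_on_bounded_linear[OF bl assms(1,2)] assms(3), of v u]
    by (simp add: comp)
qed


section \<open>The smooth inverse function theorem\<close>

lemma Ck_on_mult:
  fixes f g :: "'a::euclidean_space \<Rightarrow> real"
  shows "open S \<Longrightarrow> Ck_on k f S \<Longrightarrow> Ck_on k g S \<Longrightarrow> Ck_on k (\<lambda>x. f x * g x) S"
  using Ck_on_scaleR[of S k f g] by simp

lemma Ck_on_prod:
  fixes f :: "'i \<Rightarrow> 'a::euclidean_space \<Rightarrow> real"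
  assumes "open S" "\<And>i. i \<in> I \<Longrightarrow> Ck_on k (f i) S"
  shows "Ck_on k (\<lambda>x. \<Prod>i\<in>I. f i x) S"
  using assms(2)
proof (induction I rule: infinite_finite_induct)
  case (insert i I)
  have "Ck_on k (\<lambda>x. f i x * (\<Prod>i\<in>I. f i x)) S"
    by (rule Ck_on_mult[OF assms(1)]) (use insert in simp_all)
  then show ?case using insert.hyps by simp
qed (simp_all add: Ck_on_const)

lemma Ck_on_inverse_real: "Ck_on k (inverse :: real \<Rightarrow> real) (- {0})"
proof (induction k)
  case 0
  then show ?case by (auto intro!: continuous_intros)
next
  case (Suc k)
  have o: "open (- {0 :: real})" by auto
  have d: "((inverse :: real \<Rightarrow> real) has_derivative (\<lambda>v. (- v) * (inverse x * inverse x))) (at x)"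
    if "x \<noteq> 0" for x
    using has_derivative_inverse'[OF that, of UNIV] by (simp add: mult.assoc mult.left_commute)
  show ?case
    unfolding Ck_on.simps
  proof (intro conjI ballI allI)
    show "(inverse :: real \<Rightarrow> real) differentiable (at x)" if "x \<in> - {0}" for x
      using d that unfolding differentiable_def by blast
    fix v :: real
    have "Ck_on k (\<lambda>x. (- v) * (inverse x * inverse x)) (- {0})"
      by (intro Ck_on_mult o Suc.IH Ck_on_const)
    then show "Ck_on k (directional v (inverse :: real \<Rightarrow> real)) (- {0})"
      by (rule Ck_on_cong[OF o, rotated]) (simp add: directional_eqI[OF d])
  qed
qed

lemma Ck_on_divide:
  fixes f g :: "'a::euclidean_space \<Rightarrow> real"
  assumes "open S" "Ck_on k f S" "Ck_on k g S" "\<And>x. x \<in> S \<Longrightarrow> g x \<noteq> 0"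
  shows "Ck_on k (\<lambda>x. f x / g x) S"
proof -
  have "Ck_on k (\<lambda>x. inverse (g x)) S"
    by (rule Ck_on_compose[OF assms(1) _ _ assms(3) Ck_on_inverse_real]) (use assms(4) in auto)
  from Ck_on_mult[OF assms(1,2) this] show ?thesis by (simp add: divide_inverse)
qed

lemma Ck_on_det:
  fixes A :: "'a::euclidean_space \<Rightarrow> real^'n^'n"
  assumes "open S" "\<And>i j. Ck_on k (\<lambda>x. A x $ i $ j) S"
  shows "Ck_on k (\<lambda>x. det (A x)) S"
  unfolding det_def by (intro Ck_on_sum Ck_on_mult Ck_on_prod Ck_on_const assms)

text \<open>
  Cramer's rule expresses the solution through determinants of the coefficients.
\<close>

lemma Ck_on_linear_system:
  fixes A :: "'a::euclidean_space \<Rightarrow> real^'n^'n" and b w :: "'a \<Rightarrow> real^'n"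
  assumes "open S" "\<And>i j. Ck_on k (\<lambda>x. A x $ i $ j) S" "Ck_on k b S"
    and "\<And>x. x \<in> S \<Longrightarrow> det (A x) \<noteq> 0" "\<And>x. x \<in> S \<Longrightarrow> A x *v w x = b x"
  shows "Ck_on k w S"
proof (rule Ck_on_vec[OF assms(1)])
  fix l
  have bi: "Ck_on k (\<lambda>x. b x $ i) S" for i
    by (rule Ck_on_bounded_linear[OF bounded_linear_vec_nth assms(1,3)])
  have "Ck_on k (\<lambda>x. det (\<chi> i j. if j = l then b x $ i else A x $ i $ j) / det (A x)) S"
  proof (intro Ck_on_divide Ck_on_det assms(1,2,4))
    show "Ck_on k (\<lambda>x. (\<chi> i j. if j = l then b x $ i else A x $ i $ j) $ i $ j) S" for i j
      by (cases "j = l") (simp_all add: bi assms(2))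
  qed
  moreover have "det (\<chi> i j. if j = l then b x $ i else A x $ i $ j) / det (A x) = w x $ l" if "x \<in> S" for x
  proof -
    have "w x = (\<chi> k. det (\<chi> i j. if j = k then b x $ i else A x $ i $ j) / det (A x))"
      using cramer[OF assms(4)[OF that]] assms(5)[OF that] by blast
    from arg_cong[OF this, of "\<lambda>v. v $ l"] show ?thesis by simp
  qed
  ultimately show "Ck_on k (\<lambda>x. w x $ l) S"
    by (rule Ck_on_cong[OF assms(1), rotated])
qed

text \<open>
  The inverse function theorem provides a differentiable inverse \<open>g\<close>. Its
  derivative in a direction \<open>v\<close> solves the linear system \<open>Df(g y) w =
  v\<close>, whose coefficients are as often differentiable as \<open>g\<close>; so
  \<open>g\<close> gains one order of differentiability at a time.
\<close>

lemma smooth_local_inverse: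
  fixes f :: "real^'n \<Rightarrow> real^'n"
  assumes "open U" "smooth_on U f" "x0 \<in> U" "inj (frechet_derivative f (at x0))"
  obtains U' V g where "open U'" "U' \<subseteq> U" "x0 \<in> U'" "open V" "f x0 \<in> V"
    "\<And>x. x \<in> U' \<Longrightarrow> f x \<in> V \<and> g (f x) = x"
    "\<And>y. y \<in> V \<Longrightarrow> g y \<in> U' \<and> f (g y) = y" "smooth_on V g"
proof -
  \<comment> \<open>Derivatives as bounded linear functions, the form in which the inverse function theorem wants them.\<close>
  define f' where "f' x = Blinfun (frechet_derivative f (at x))" for x
  have bl: "bounded_linear (frechet_derivative f (at x))" if "x \<in> U" for x
    using smooth_on_has_derivative[OF assms(2) that] has_derivative_bounded_linear by blast
  have f': "blinfun_apply (f' x) = frechet_derivative f (at x)" if "x \<in> U" for x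
    unfolding f'_def using bl[OF that] by (rule bounded_linear_Blinfun_apply)
  have der: "(f has_derivative blinfun_apply (f' x)) (at x)" if "x \<in> U" for x
    using smooth_on_has_derivative[OF assms(2) that] f'[OF that] by simp
  have cont: "continuous_on U f'"
  proof (rule continuous_on_blinfun_componentwise)
    fix i :: "real^'n"
    have "continuous_on U (directional i f)"
      by (rule smooth_on_continuous_on[OF smooth_on_directional[OF assms(2)]])
    then show "continuous_on U (\<lambda>x. blinfun_apply (f' x) i)"
      by (rule continuous_on_eq) (simp add: f')
  qed
  have lin0: "linear (frechet_derivative f (at x0))"
    using bl[OF assms(3)] bounded_linear.linear by blast
  obtain k where k: "linear k" "k \<circ> frechet_derivative f (at x0) = id"
    using linear_injective_left_inverse[OF lin0 assms(4)] by blast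
  have inv: "Blinfun k o\<^sub>L f' x0 = id_blinfun"
  proof (rule blinfun_eqI)
    show "blinfun_apply (Blinfun k o\<^sub>L f' x0) i = blinfun_apply id_blinfun i" for i
      using k by (simp add: f'[OF assms(3)] bounded_linear_Blinfun_apply
          linear_conv_bounded_linear[symmetric] fun_eq_iff)
  qed
  obtain U' V g g' where U': "open U'" "U' \<subseteq> U" "x0 \<in> U'" and V: "open V" "f x0 \<in> V"
    and hom: "homeomorphism U' V f g"
    and dg: "\<And>y. y \<in> V \<Longrightarrow> (g has_derivative (g' y)) (at y)"
      "\<And>y. y \<in> V \<Longrightarrow> g' y = inv (blinfun_apply (f' (g y)))"
      "\<And>y. y \<in> V \<Longrightarrow> bij (blinfun_apply (f' (g y)))"
    using inverse_function_theorem[OF assms(1) der cont assms(3) inv] by blast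
  have g: "g y \<in> U'" "f (g y) = y" if "y \<in> V" for y
    using hom that by (auto simp: homeomorphism_def)
  have "Ck_on k g V" for k
  proof (induction k)
    case 0
    then show ?case using hom by (simp add: homeomorphism_def)
  next
    case (Suc k)
    show ?case
      unfolding Ck_on.simps
    proof (intro conjI ballI allI)
      show "g differentiable (at y)" if "y \<in> V" for y
        using dg(1)[OF that] unfolding differentiable_def by blast
      fix v
      define A where "A y = matrix (frechet_derivative f (at (g y)))" for y
      have lin: "linear (frechet_derivative f (at (g y)))" if "y \<in> V" for y
        using bl g(1)[OF that] U'(2) bounded_linear.linear by blast
      show "Ck_on k (directional v g) V"
      proof (rule Ck_on_linear_system[OF V(1), where A = A and b = "\<lambda>y. v"])
        show "Ck_on k (\<lambda>y. A y $ i $ j) V" for i j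
        proof -
          have "smooth_on U (\<lambda>x. directional (axis j 1) f x $ i)"
            by (intro smooth_on_vec_nth smooth_on_directional assms)
          then have c: "Ck_on k (\<lambda>x. directional (axis j 1) f x $ i) U"
            by (simp add: smooth_on_def)
          have "Ck_on k (\<lambda>y. directional (axis j 1) f (g y) $ i) V"
            by (rule Ck_on_compose[OF V(1) assms(1) _ Suc c]) (use g U' in auto)
          then show ?thesis by (simp add: A_def matrix_def)
        qed
        show "det (A y) \<noteq> 0" if "y \<in> V" for y
        proof -
          have "inj (frechet_derivative f (at (g y)))"
            using dg(3)[OF that] f' g(1)[OF that] U'(2) bij_is_inj by (metis in_mono)
          then show ?thesis
            using lin[OF that] by (simp add: A_def det_nz_iff_inj matrix_works)
        qed
        show "A y *v directional v g y = v" if "y \<in> V" for y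
        proof -
          have "directional v g y = inv (frechet_derivative f (at (g y))) v"
            using directional_eqI[OF dg(1)[OF that]] dg(2)[OF that] f' g(1)[OF that] U'(2) by auto
          then show ?thesis
            using lin[OF that] dg(3)[OF that] f' g(1)[OF that] U'(2)
            by (simp add: A_def matrix_works bij_is_surj surj_f_inv_f subset_iff)
        qed
      qed (rule Ck_on_const)
    qed
  qed
  then have "smooth_on V g" by (simp add: smooth_on_def)
  with U' V g hom show ?thesis
    by (intro that[of U' V g]) (auto simp: homeomorphism_def)
qed


section \<open>Agreement of functions up to a given order\<close>

text \<open>
  Agreement of all iterated derivatives up to order \<open>k\<close> at a point. The recursion
  peels off the innermost derivative, which makes invariance under composition a plain induction
  by the chain rule.
\<close>

primrec same_jet :: "nat \<Rightarrow> ('a::euclidean_space \<Rightarrow> 'b::euclidean_space) \<Rightarrow> ('a \<Rightarrow> 'b) \<Rightarrow> 'a \<Rightarrow> bool" where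
  "same_jet 0 f g x \<longleftrightarrow> f x = g x"
| "same_jet (Suc k) f g x \<longleftrightarrow> f x = g x \<and>
     (\<forall>v\<in>Basis. same_jet k (directional v f) (directional v g) x)"

lemma same_jet_refl: "same_jet k f f x"
  by (induction k arbitrary: f) simp_all

lemma same_jet_value: "same_jet k f g x \<Longrightarrow> f x = g x"
  by (cases k) simp_all

lemma same_jet_SucD: "same_jet (Suc k) f g x \<Longrightarrow> same_jet k f g x"
proof (induction k arbitrary: f g)
  case (Suc k)
  have "f x = g x" "\<And>v. v \<in> Basis \<Longrightarrow> same_jet (Suc k) (directional v f) (directional v g) x"
    using iffD1[OF same_jet.simps(2) Suc.prems] by blast+
  then have "f x = g x \<and> (\<forall>v\<in>Basis. same_jet k (directional v f) (directional v g) x)"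
    using Suc.IH by blast
  then show ?case by (rule iffD2[OF same_jet.simps(2)])
qed simp

lemma same_jet_cong:
  "open S \<Longrightarrow> x \<in> S \<Longrightarrow> (\<And>y. y \<in> S \<Longrightarrow> f y = f' y) \<Longrightarrow> (\<And>y. y \<in> S \<Longrightarrow> g y = g' y) \<Longrightarrow>
   same_jet k f g x \<Longrightarrow> same_jet k f' g' x"
proof (induction k arbitrary: f g f' g')
  case (Suc k)
  have "same_jet k (directional v f') (directional v g') x" if v: "v \<in> Basis" for v
  proof (rule Suc.IH[OF Suc.prems(1,2)])
    show "directional v f y = directional v f' y" if "y \<in> S" for y
      using frechet_derivative_cong_open[OF Suc.prems(1) that, of f f'] Suc.prems(3) by metis
    show "directional v g y = directional v g' y" if "y \<in> S" for y
      using frechet_derivative_cong_open[OF Suc.prems(1) that, of g g'] Suc.prems(4) by metis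
    show "same_jet k (directional v f) (directional v g) x" using Suc.prems(5) v by simp
  qed
  then show ?case using Suc.prems by auto
qed auto

lemma same_jet_add:
  "open S \<Longrightarrow> x \<in> S \<Longrightarrow> smooth_on S f \<Longrightarrow> smooth_on S g \<Longrightarrow> smooth_on S f' \<Longrightarrow> smooth_on S g' \<Longrightarrow>
   same_jet k f g x \<Longrightarrow> same_jet k f' g' x \<Longrightarrow>
   same_jet k (\<lambda>y. f y + f' y) (\<lambda>y. g y + g' y) x"
proof (induction k arbitrary: f g f' g')
  case (Suc k)
  note smooth = Suc.prems(3-6)
  have "same_jet k (directional v (\<lambda>y. f y + f' y)) (directional v (\<lambda>y. g y + g' y)) x"
    if v: "v \<in> Basis" for v
  proof (rule same_jet_cong[OF Suc.prems(1,2)])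
    show "same_jet k (\<lambda>y. directional v f y + directional v f' y)
        (\<lambda>y. directional v g y + directional v g' y) x"
      using Suc.prems(7,8) v
      by (intro Suc.IH[OF Suc.prems(1,2)] smooth_on_directional smooth) simp_all
  qed (simp_all add: directional_add smooth_on_differentiable[OF smooth(1)]
        smooth_on_differentiable[OF smooth(2)] smooth_on_differentiable[OF smooth(3)]
        smooth_on_differentiable[OF smooth(4)])
  then show ?case using Suc.prems(7,8) by simp
qed simp

lemma same_jet_sum:
  assumes "open S" "x \<in> S" "\<And>i. i \<in> I \<Longrightarrow> smooth_on S (f i)" "\<And>i. i \<in> I \<Longrightarrow> smooth_on S (g i)"
    and "\<And>i. i \<in> I \<Longrightarrow> same_jet k (f i) (g i) x"
  shows "same_jet k (\<lambda>y. \<Sum>i\<in>I. f i y) (\<lambda>y. \<Sum>i\<in>I. g i y) x"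
  using assms(3-)
proof (induction I rule: infinite_finite_induct)
  case (insert i I)
  have "same_jet k (\<lambda>y. f i y + (\<Sum>i\<in>I. f i y)) (\<lambda>y. g i y + (\<Sum>i\<in>I. g i y)) x"
    by (rule same_jet_add[OF assms(1,2)]) (use insert in \<open>auto intro!: smooth_on_sum assms(1)\<close>)
  then show ?case using insert.hyps by simp
qed (simp_all add: same_jet_refl)

text \<open>
  Each term of the Leibniz rule has one differentiated factor; the other one agrees to order
  \<open>k + 1\<close>, hence to order \<open>k\<close>.
\<close>

lemma same_jet_scaleR:
  fixes f g :: "'a::euclidean_space \<Rightarrow> real"
  shows "open S \<Longrightarrow> x \<in> S \<Longrightarrow> smooth_on S f \<Longrightarrow> smooth_on S g \<Longrightarrow> smooth_on S f' \<Longrightarrow> smooth_on S g' \<Longrightarrow>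
   same_jet k f g x \<Longrightarrow> same_jet k f' g' x \<Longrightarrow>
   same_jet k (\<lambda>y. f y *\<^sub>R f' y) (\<lambda>y. g y *\<^sub>R g' y) x"
proof (induction k arbitrary: f g f' g')
  case (Suc k)
  note smooth = Suc.prems(3-6)
  have "same_jet k (directional v (\<lambda>y. f y *\<^sub>R f' y)) (directional v (\<lambda>y. g y *\<^sub>R g' y)) x"
    if v: "v \<in> Basis" for v
  proof (rule same_jet_cong[OF Suc.prems(1,2)])
    show "same_jet k (\<lambda>y. f y *\<^sub>R directional v f' y + directional v f y *\<^sub>R f' y)
        (\<lambda>y. g y *\<^sub>R directional v g' y + directional v g y *\<^sub>R g' y) x"
    proof (intro same_jet_add[OF Suc.prems(1,2)] smooth_on_scaleR smooth_on_directional smooth Suc.prems(1))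
      show "same_jet k (\<lambda>y. f y *\<^sub>R directional v f' y) (\<lambda>y. g y *\<^sub>R directional v g' y) x"
        using Suc.prems(8) v
        by (intro Suc.IH[OF Suc.prems(1,2)] smooth_on_directional smooth same_jet_SucD[OF Suc.prems(7)])
           simp
      show "same_jet k (\<lambda>y. directional v f y *\<^sub>R f' y) (\<lambda>y. directional v g y *\<^sub>R g' y) x"
        using Suc.prems(7) v
        by (intro Suc.IH[OF Suc.prems(1,2)] smooth_on_directional smooth same_jet_SucD[OF Suc.prems(8)])
           simp
    qed
  qed (simp_all add: directional_scaleR smooth_on_differentiable[OF smooth(1)]
        smooth_on_differentiable[OF smooth(2)] smooth_on_differentiable[OF smooth(3)]
        smooth_on_differentiable[OF smooth(4)])
  then show ?case using Suc.prems(7,8) by simp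
qed simp

lemma same_jet_bounded_linear:
  assumes "bounded_linear L" "open S" "x \<in> S"
  shows "smooth_on S f \<Longrightarrow> smooth_on S g \<Longrightarrow> same_jet k f g x \<Longrightarrow>
    same_jet k (\<lambda>y. L (f y)) (\<lambda>y. L (g y)) x"
proof (induction k arbitrary: f g)
  case (Suc k)
  have "same_jet k (directional v (\<lambda>y. L (f y))) (directional v (\<lambda>y. L (g y))) x"
    if v: "v \<in> Basis" for v
  proof (rule same_jet_cong[OF assms(2,3)])
    show "same_jet k (\<lambda>y. L (directional v f y)) (\<lambda>y. L (directional v g y)) x"
      using Suc.prems v by (intro Suc.IH smooth_on_directional) simp_all
  qed (simp_all add: directional_linear[OF assms(1)] smooth_on_differentiable[OF Suc.prems(1)]
        smooth_on_differentiable[OF Suc.prems(2)])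
  then show ?case using Suc.prems(3) by simp
qed simp

text \<open>
  Invariance under a change of coordinates of the target.
\<close>

lemma same_jet_post_compose:
  fixes f g :: "'a::euclidean_space \<Rightarrow> 'b::euclidean_space" and H :: "'b \<Rightarrow> 'c::euclidean_space"
  assumes "open S" "x \<in> S" "open T" "smooth_on S f" "smooth_on S g" "f ` S \<subseteq> T" "g ` S \<subseteq> T"
  shows "smooth_on T H \<Longrightarrow> same_jet k f g x \<Longrightarrow> same_jet k (\<lambda>y. H (f y)) (\<lambda>y. H (g y)) x"
proof (induction k arbitrary: H)
  case (Suc k)
  have der: "f y \<in> T" "g y \<in> T" "f differentiable (at y)" "g differentiable (at y)" if "y \<in> S" for y
    using that assms smooth_on_differentiable by blast+
  have dH: "H differentiable (at z)" if "z \<in> T" for z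
    using that Suc.prems(1) smooth_on_differentiable by blast
  have "same_jet k (directional v (\<lambda>y. H (f y))) (directional v (\<lambda>y. H (g y))) x"
    if v: "v \<in> Basis" for v
  proof (rule same_jet_cong[OF assms(1,2)])
    show "same_jet k (\<lambda>y. \<Sum>b\<in>Basis. (directional v f y \<bullet> b) *\<^sub>R directional b H (f y))
      (\<lambda>y. \<Sum>b\<in>Basis. (directional v g y \<bullet> b) *\<^sub>R directional b H (g y)) x"
    proof (intro same_jet_sum[OF assms(1,2)] same_jet_scaleR[OF assms(1,2)] smooth_on_scaleR assms(1))
      fix b :: 'b
      have bl: "bounded_linear (\<lambda>z. z \<bullet> b)" by (rule bounded_linear_inner_left)
      show s: "smooth_on S (\<lambda>y. directional v f y \<bullet> b)" "smooth_on S (\<lambda>y. directional v f y \<bullet> b)"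
        "smooth_on S (\<lambda>y. directional v g y \<bullet> b)" "smooth_on S (\<lambda>y. directional v g y \<bullet> b)"
        by (intro smooth_on_bounded_linear[OF bl assms(1)] smooth_on_directional assms)+
      show "smooth_on S (\<lambda>y. directional b H (f y))" "smooth_on S (\<lambda>y. directional b H (f y))"
        by (rule smooth_on_compose[OF assms(1,3,4) smooth_on_directional[OF Suc.prems(1)] assms(6)])+
      show "smooth_on S (\<lambda>y. directional b H (g y))" "smooth_on S (\<lambda>y. directional b H (g y))"
        by (rule smooth_on_compose[OF assms(1,3,5) smooth_on_directional[OF Suc.prems(1)] assms(7)])+
      show "same_jet k (\<lambda>y. directional v f y \<bullet> b) (\<lambda>y. directional v g y \<bullet> b) x"
        using Suc.prems(2) v
        by (intro same_jet_bounded_linear[OF bl assms(1,2)] smooth_on_directional assms) simp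
      show "same_jet k (\<lambda>y. directional b H (f y)) (\<lambda>y. directional b H (g y)) x"
        by (intro Suc.IH smooth_on_directional Suc.prems(1) same_jet_SucD[OF Suc.prems(2)])
    qed
  qed (simp_all add: directional_compose der dH)
  then show ?case using same_jet_value[OF Suc.prems(2)] by simp
qed simp

text \<open>
  Invariance under a change of coordinates of the source.
\<close>

lemma same_jet_pre_compose:
  fixes h :: "'a::euclidean_space \<Rightarrow> 'b::euclidean_space" and f g :: "'b \<Rightarrow> 'c::euclidean_space"
  assumes "open S" "x \<in> S" "open T" "smooth_on S h" "h ` S \<subseteq> T"
  shows "smooth_on T f \<Longrightarrow> smooth_on T g \<Longrightarrow> same_jet k f g (h x) \<Longrightarrow>
    same_jet k (\<lambda>y. f (h y)) (\<lambda>y. g (h y)) x"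
proof (induction k arbitrary: f g)
  case (Suc k)
  have der: "h y \<in> T" "h differentiable (at y)" if "y \<in> S" for y
    using that assms smooth_on_differentiable by blast+
  have dfg: "f differentiable (at z)" "g differentiable (at z)" if "z \<in> T" for z
    using that Suc.prems smooth_on_differentiable by blast+
  have "same_jet k (directional v (\<lambda>y. f (h y))) (directional v (\<lambda>y. g (h y))) x"
    if v: "v \<in> Basis" for v
  proof (rule same_jet_cong[OF assms(1,2)])
    show "same_jet k (\<lambda>y. \<Sum>b\<in>Basis. (directional v h y \<bullet> b) *\<^sub>R directional b f (h y))
      (\<lambda>y. \<Sum>b\<in>Basis. (directional v h y \<bullet> b) *\<^sub>R directional b g (h y)) x"
    proof (intro same_jet_sum[OF assms(1,2)] same_jet_scaleR[OF assms(1,2)] smooth_on_scaleR assms(1)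
        same_jet_refl)
      fix b :: 'b assume b: "b \<in> Basis"
      show "smooth_on S (\<lambda>y. directional v h y \<bullet> b)" "smooth_on S (\<lambda>y. directional v h y \<bullet> b)"
         "smooth_on S (\<lambda>y. directional v h y \<bullet> b)" "smooth_on S (\<lambda>y. directional v h y \<bullet> b)"
        by (intro smooth_on_bounded_linear[OF bounded_linear_inner_left assms(1)] smooth_on_directional assms)+
      show "smooth_on S (\<lambda>y. directional b f (h y))" "smooth_on S (\<lambda>y. directional b f (h y))"
        by (rule smooth_on_compose[OF assms(1,3,4) smooth_on_directional[OF Suc.prems(1)] assms(5)])+
      show "smooth_on S (\<lambda>y. directional b g (h y))" "smooth_on S (\<lambda>y. directional b g (h y))"
        by (rule smooth_on_compose[OF assms(1,3,4) smooth_on_directional[OF Suc.prems(2)] assms(5)])+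
      show "same_jet k (\<lambda>y. directional b f (h y)) (\<lambda>y. directional b g (h y)) x"
        using Suc.prems(3) b by (intro Suc.IH smooth_on_directional Suc.prems(1,2)) simp
    qed
  qed (simp_all add: directional_compose der dfg)
  then show ?case using same_jet_value[OF Suc.prems(3)] by simp
qed simp


section \<open>Iterated partial derivatives\<close>

lemma Basis_vec_real: "(Basis :: (real^'n) set) = range (\<lambda>i. axis i 1)"
  by (auto simp: Basis_vec_def)

text \<open>
  On \<open>real^'n\<close> the basis vectors give exactly the partial derivatives, so both
  sides unfold to the same statement.
\<close>

lemma same_jet_iff_partials:
  fixes f g :: "real^'n \<Rightarrow> real^'m"
  shows "same_jet k f g x \<longleftrightarrow> (\<forall>l. length l \<le> k \<longrightarrow> foldr partial l f x = foldr partial l g x)"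
proof (induction k arbitrary: f g)
  case (Suc k)
  have "(\<forall>l. length l \<le> Suc k \<longrightarrow> foldr partial l f x = foldr partial l g x) \<longleftrightarrow>
    f x = g x \<and> (\<forall>i l. length l \<le> k \<longrightarrow> foldr partial l (partial i f) x = foldr partial l (partial i g) x)"
    (is "?A \<longleftrightarrow> ?B")
  proof
    assume A: ?A
    have "foldr partial l (partial i f) x = foldr partial l (partial i g) x" if "length l \<le> k" for l i
      using A[rule_format, of "l @ [i]"] that by simp
    then show ?B using A[rule_format, of "[]"] by simp
  next
    assume B: ?B
    show ?A
    proof (intro allI impI)
      fix l :: "'n list" assume "length l \<le> Suc k"
      then show "foldr partial l f x = foldr partial l g x"
        using B by (cases l rule: rev_cases) auto
    qed
  qed
  moreover have "same_jet (Suc k) f g x \<longleftrightarrow>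
      f x = g x \<and> (\<forall>i. same_jet k (partial i f) (partial i g) x)"
    by (simp add: Basis_vec_real partial_def)
  ultimately show ?case using Suc.IH by blast
qed simp

lemma partial_cong:
  "open S \<Longrightarrow> (\<And>y. y \<in> S \<Longrightarrow> f y = g y) \<Longrightarrow> y \<in> S \<Longrightarrow> partial i f y = partial i g y"
  unfolding partial_def using frechet_derivative_cong_open[of S y f g] by simp

lemma smooth_on_foldr_partial: "smooth_on S f \<Longrightarrow> smooth_on S (foldr partial l f)"
  by (induction l) (auto simp: partial_def intro: smooth_on_directional)

lemma foldr_partial_cong:
  assumes "open S" "\<And>y. y \<in> S \<Longrightarrow> f y = g y"
  shows "y \<in> S \<Longrightarrow> foldr partial l f y = foldr partial l g y"
proof (induction l arbitrary: y)
  case (Cons i l)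
  then show ?case using partial_cong[OF assms(1), of "foldr partial l f" "foldr partial l g"] by simp
qed (use assms in simp)

text \<open>
  Moving one derivative to the front takes repeated exchanges of neighbours; these generate all
  reorderings.
\<close>

lemma foldr_partial_move:
  assumes "open S" "smooth_on S f"
  shows "y \<in> S \<Longrightarrow> foldr partial (l @ i # l') f y = foldr partial (i # l @ l') f y"
proof (induction l arbitrary: y)
  case (Cons a l)
  have "foldr partial ((a # l) @ i # l') f y = partial a (foldr partial (l @ i # l') f) y" by simp
  also have "\<dots> = partial a (partial i (foldr partial (l @ l') f)) y"
    by (rule partial_cong[OF assms(1) _ Cons.prems]) (use Cons.IH in simp)
  also have "\<dots> = partial i (partial a (foldr partial (l @ l') f)) y"
    unfolding partial_def[of a] partial_def[of i]
    by (rule directional_commute[OF assms(1) smooth_on_foldr_partial[OF assms(2)] Cons.prems])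
  finally show ?case by simp
qed simp

lemma foldr_partial_mset_eq:
  assumes "open S" "smooth_on S f"
  shows "mset l = mset l' \<Longrightarrow> y \<in> S \<Longrightarrow> foldr partial l f y = foldr partial l' f y"
proof (induction l arbitrary: l' y)
  case (Cons i l)
  then have "i \<in> set l'" by (metis list.set_intros(1) set_mset_mset)
  then obtain l1 l2 where l': "l' = l1 @ i # l2" by (meson split_list)
  then have "mset l = mset (l1 @ l2)" using Cons.prems(1) by simp
  then have IH: "foldr partial l f z = foldr partial (l1 @ l2) f z" if "z \<in> S" for z
    using Cons.IH that by blast
  have "foldr partial (i # l) f y = foldr partial (i # l1 @ l2) f y"
    using partial_cong[OF assms(1) IH Cons.prems(2)] by simp
  also have "\<dots> = foldr partial l' f y"
    unfolding l' by (rule foldr_partial_move[OF assms Cons.prems(2), symmetric])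
  finally show ?case .
qed simp

text \<open>
  The order of differentiation chosen in \<open>multi_partial\<close> is unknown but the same
  for all functions.
\<close>

lemma multi_partial_list:
  obtains l where "mset l = I" "\<And>f. multi_partial I f = foldr partial l f"
proof -
  have "mset (SOME l. mset l = I) = I" by (rule someI_ex) (rule ex_mset)
  then show ?thesis by (rule that) (simp add: multi_partial_def)
qed

lemma foldr_partial_eq_multi_partial:
  assumes "open S" "smooth_on S f" "y \<in> S"
  shows "foldr partial l f y = multi_partial (mset l) f y"
proof -
  obtain l' where "mset l' = mset l" "multi_partial (mset l) f = foldr partial l' f"
    using multi_partial_list by metis
  then show ?thesis using foldr_partial_mset_eq[OF assms(1,2) _ assms(3), of l l'] by simp
qed

lemma multi_partial_empty [simp]: "multi_partial {#} f = f"
  using multi_partial_list[of "{#}"] by (metis foldr.simps(1) id_apply mset_zero_iff)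

lemma smooth_on_multi_partial: "smooth_on S f \<Longrightarrow> smooth_on S (multi_partial I f)"
  using multi_partial_list[of I] smooth_on_foldr_partial by metis

lemma multi_partial_cong:
  "open S \<Longrightarrow> (\<And>y. y \<in> S \<Longrightarrow> f y = g y) \<Longrightarrow> y \<in> S \<Longrightarrow> multi_partial I f y = multi_partial I g y"
  using multi_partial_list[of I] foldr_partial_cong by (metis (no_types, lifting))

lemma multi_partial_add_mset:
  assumes "open S" "smooth_on S f" "y \<in> S"
  shows "multi_partial (add_mset i I) f y = partial i (multi_partial I f) y"
proof -
  obtain l where l: "mset l = I" "multi_partial I f = foldr partial l f"
    using multi_partial_list by metis
  have "partial i (multi_partial I f) y = foldr partial (i # l) f y" using l by simp
  also have "\<dots> = multi_partial (add_mset i I) f y"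
    using foldr_partial_eq_multi_partial[OF assms, of "i # l"] l by simp
  finally show ?thesis by simp
qed

lemma directional_multi_partial:
  fixes f :: "real^'n \<Rightarrow> real^'m"
  assumes "open S" "smooth_on S f" "y \<in> S"
  shows "directional \<xi> (multi_partial I f) y =
    (\<Sum>i\<in>UNIV. (\<xi> $ i) *\<^sub>R multi_partial (add_mset i I) f y)"
proof -
  interpret L: linear "frechet_derivative (multi_partial I f) (at y)"
    by (intro linear_frechet_derivative smooth_on_differentiable[OF _ assms(3)]
        smooth_on_multi_partial assms(2))
  have "\<xi> = (\<Sum>i\<in>UNIV. (\<xi> $ i) *\<^sub>R axis i 1)"
    by (simp add: vec_eq_iff axis_def if_distrib cong: if_cong)
  then have "directional \<xi> (multi_partial I f) y =
      (\<Sum>i\<in>UNIV. (\<xi> $ i) *\<^sub>R directional (axis i 1) (multi_partial I f) y)"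
    by (metis (no_types, lifting) L.sum L.scale sum.cong)
  then show ?thesis by (simp add: multi_partial_add_mset[OF assms] partial_def)
qed

lemma same_jet_iff_multi_partials:
  fixes f g :: "real^'n \<Rightarrow> real^'m"
  assumes "open S" "smooth_on S f" "smooth_on S g" "x \<in> S"
  shows "same_jet k f g x \<longleftrightarrow> (\<forall>I. size I \<le> k \<longrightarrow> multi_partial I f x = multi_partial I g x)"
  unfolding same_jet_iff_partials
  using foldr_partial_eq_multi_partial[OF assms(1,2,4)] foldr_partial_eq_multi_partial[OF assms(1,3,4)]
  by (metis ex_mset size_mset)


section \<open>Charts and atlases\<close>

lemma chart_inv_left: "inj_on (snd c) (fst c) \<Longrightarrow> p \<in> fst c \<Longrightarrow> chart_inv c (snd c p) = p"
  by (simp add: chart_inv_def)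

lemma chart_inv_right:
  "y \<in> snd c ` fst c \<Longrightarrow> chart_inv c y \<in> fst c \<and> snd c (chart_inv c y) = y"
  by (simp add: chart_inv_def inv_into_into f_inv_into_f)

text \<open>
  Injectivity alone makes the sets \<open>W\<close> with open chart images a topology, since
  intersections are then respected.
\<close>

definition injective_charts :: "('p, 'v) chart set \<Rightarrow> bool" where
  "injective_charts A \<longleftrightarrow> (\<forall>c\<in>A. inj_on (snd c) (fst c))"

lemma compatible_sym: "compatible c d \<Longrightarrow> compatible d c"
  by (auto simp: compatible_def Int_commute)

lemma compatible_open_preimage:
  assumes "inj_on (snd c) (fst c)" "compatible c d" "open N"
  shows "open (snd c ` {p \<in> fst c \<inter> fst d. snd d p \<in> N})"
proof -
  let ?O = "snd c ` (fst c \<inter> fst d)"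
  have "snd c ` {p \<in> fst c \<inter> fst d. snd d p \<in> N} = ?O \<inter> (snd d \<circ> chart_inv c) -` N"
    using assms(1) by (auto simp: chart_inv_left)
  moreover have "continuous_on ?O (snd d \<circ> chart_inv c)" "open ?O"
    using assms(2) smooth_on_continuous_on unfolding compatible_def by blast+
  ultimately show ?thesis using continuous_open_preimage[OF _ _ assms(3)] by metis
qed

text \<open>
  Transition maps compose through an intermediate chart \<open>e\<close>; chart inverses are
  total functions, so the identity holds only over points lying in both domains.
\<close>

lemma smooth_transition_compose:
  assumes "inj_on (snd c) (fst c)" "inj_on (snd e) (fst e)" "X \<subseteq> fst c \<inter> fst e"
    and "open (snd c ` X)" "smooth_on (snd c ` X) (snd e \<circ> chart_inv c)"
    and "open Y" "snd e ` X \<subseteq> Y" "smooth_on Y (snd d \<circ> chart_inv e)"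
  shows "smooth_on (snd c ` X) (snd d \<circ> chart_inv c)"
proof -
  have "smooth_on (snd c ` X) (\<lambda>y. (snd d \<circ> chart_inv e) ((snd e \<circ> chart_inv c) y))"
  proof (rule smooth_on_compose[OF assms(4,6,5,8)])
    show "(snd e \<circ> chart_inv c) ` snd c ` X \<subseteq> Y"
      using assms(3,7) chart_inv_left[OF assms(1)] by (auto simp: subset_iff image_iff)
  qed
  then show ?thesis
    by (rule smooth_on_cong[OF assms(4), rotated])
       (use assms(3) in \<open>auto simp: chart_inv_left[OF assms(1)] chart_inv_left[OF assms(2)] subset_iff\<close>)
qed

lemma openin_atlas_topology:
  assumes "injective_charts A"
  shows "openin (atlas_topology A) W \<longleftrightarrow> W \<subseteq> points A \<and> (\<forall>c\<in>A. open (snd c ` (W \<inter> fst c)))"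
proof -
  have "istopology (\<lambda>W. W \<subseteq> points A \<and> (\<forall>c\<in>A. open (snd c ` (W \<inter> fst c))))"
    unfolding istopology_def
  proof (intro conjI allI impI ballI)
    fix S T c assume ST: "S \<subseteq> points A \<and> (\<forall>c\<in>A. open (snd c ` (S \<inter> fst c)))"
      "T \<subseteq> points A \<and> (\<forall>c\<in>A. open (snd c ` (T \<inter> fst c)))"
    then show "S \<inter> T \<subseteq> points A" by auto
    assume c: "c \<in> A"
    have "snd c ` (S \<inter> T \<inter> fst c) = snd c ` (S \<inter> fst c) \<inter> snd c ` (T \<inter> fst c)"
      using assms c unfolding injective_charts_def inj_on_def by auto
    then show "open (snd c ` (S \<inter> T \<inter> fst c))" using ST c by auto
  next
    fix K c assume K: "\<forall>S\<in>K. S \<subseteq> points A \<and> (\<forall>c\<in>A. open (snd c ` (S \<inter> fst c)))"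
    then show "\<Union> K \<subseteq> points A" by auto
    assume c: "c \<in> A"
    have "snd c ` (\<Union> K \<inter> fst c) = (\<Union>S\<in>K. snd c ` (S \<inter> fst c))" by auto
    then show "open (snd c ` (\<Union> K \<inter> fst c))" using K c by auto
  qed
  then show ?thesis by (simp add: atlas_topology_def)
qed

lemma maximal_atlasD:
  assumes "c \<in> maximal_atlas A"
  shows "inj_on (snd c) (fst c)" "open (snd c ` fst c)" "fst c \<subseteq> points A"
    "\<And>d. d \<in> A \<Longrightarrow> compatible c d"
  using assms by (auto simp: maximal_atlas_def is_chart_def)

lemma openin_chart_preimage:
  assumes "injective_charts A" "c \<in> maximal_atlas A" "open N"
  shows "openin (atlas_topology A) {p \<in> fst c. snd c p \<in> N}"
  unfolding openin_atlas_topology[OF assms(1)]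
proof (intro conjI ballI)
  show "{p \<in> fst c. snd c p \<in> N} \<subseteq> points A" using maximal_atlasD(3)[OF assms(2)] by auto
  fix d assume d: "d \<in> A"
  have "{p \<in> fst c. snd c p \<in> N} \<inter> fst d = {p \<in> fst d \<inter> fst c. snd c p \<in> N}" by auto
  then show "open (snd d ` ({p \<in> fst c. snd c p \<in> N} \<inter> fst d))"
    using compatible_open_preimage[OF _ compatible_sym[OF maximal_atlasD(4)[OF assms(2) d]] assms(3)]
      assms(1) d unfolding injective_charts_def by auto
qed

lemma openin_chart_domain:
  "injective_charts A \<Longrightarrow> c \<in> maximal_atlas A \<Longrightarrow> openin (atlas_topology A) (fst c)"
  using openin_chart_preimage[of A c UNIV] by simp

text \<open>
  For charts of the atlas this is the definition of the topology; for other compatible charts it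
  is transported through the transition maps.
\<close>

lemma open_chart_image:
  assumes "injective_charts A" "c \<in> maximal_atlas A" "openin (atlas_topology A) W"
  shows "open (snd c ` (W \<inter> fst c))"
proof (subst open_subopen, intro ballI)
  fix y assume "y \<in> snd c ` (W \<inter> fst c)"
  then obtain p where p: "p \<in> W" "p \<in> fst c" "y = snd c p" by auto
  then obtain d where d: "d \<in> A" "p \<in> fst d"
    using maximal_atlasD(3)[OF assms(2)] by (auto simp: points_def)
  have N: "open (snd d ` (W \<inter> fst d))" using assms(1,3) d(1) openin_atlas_topology by blast
  have inj: "inj_on (snd d) (fst d)" using assms(1) d(1) by (auto simp: injective_charts_def)
  let ?T = "snd c ` {p \<in> fst c \<inter> fst d. snd d p \<in> snd d ` (W \<inter> fst d)}"
  have "open ?T"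
    by (rule compatible_open_preimage[OF maximal_atlasD(1)[OF assms(2)] maximal_atlasD(4)[OF assms(2) d(1)] N])
  moreover have "y \<in> ?T" using p d(2) by auto
  moreover have "?T \<subseteq> snd c ` (W \<inter> fst c)" using inj by (auto dest: inj_onD)
  ultimately show "\<exists>T. open T \<and> y \<in> T \<and> T \<subseteq> snd c ` (W \<inter> fst c)" by blast
qed

text \<open>
  Near each point the two charts are compared through a chart of the atlas.
\<close>

lemma maximal_atlas_compatible:
  assumes "injective_charts A" "c \<in> maximal_atlas A" "c' \<in> maximal_atlas A"
  shows "compatible c c'"
proof -
  have op: "open (snd c ` (fst c \<inter> fst c'))"
    if "c \<in> maximal_atlas A" "c' \<in> maximal_atlas A" for c c' :: "('a, 'b) chart"
    using open_chart_image[OF assms(1) that(1) openin_chart_domain[OF assms(1) that(2)]]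
    by (simp add: Int_commute)
  have sm: "smooth_on (snd c ` (fst c \<inter> fst c')) (snd c' \<circ> chart_inv c)"
    if c: "c \<in> maximal_atlas A" and c': "c' \<in> maximal_atlas A" for c c' :: "('a, 'b) chart"
  proof (rule smooth_on_locally)
    fix y assume "y \<in> snd c ` (fst c \<inter> fst c')"
    then obtain p where p: "p \<in> fst c'" "p \<in> fst c" "y = snd c p" by auto
    then obtain d where d: "d \<in> A" "p \<in> fst d"
      using maximal_atlasD(3)[OF c] by (auto simp: points_def)
    have cd: "compatible c d" and c'd: "compatible c' d"
      using maximal_atlasD(4)[OF c d(1)] maximal_atlasD(4)[OF c' d(1)] by auto
    let ?X = "{p \<in> fst c \<inter> fst d. snd d p \<in> snd d ` (fst c' \<inter> fst d)}"
    have opX: "open (snd c ` ?X)"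
      by (rule compatible_open_preimage[OF maximal_atlasD(1)[OF c] cd])
         (use c'd in \<open>auto simp: compatible_def\<close>)
    have "smooth_on (snd c ` ?X) (snd c' \<circ> chart_inv c)"
    proof (rule smooth_transition_compose[where e = d and Y = "snd d ` (fst c' \<inter> fst d)"])
      show "inj_on (snd d) (fst d)" using assms(1) d(1) by (auto simp: injective_charts_def)
      show "smooth_on (snd c ` ?X) (snd d \<circ> chart_inv c)"
        using cd by (auto simp: compatible_def elim!: smooth_on_subset)
    qed (use c'd maximal_atlasD(1)[OF c] opX in \<open>auto simp: compatible_def\<close>)
    moreover have "y \<in> snd c ` ?X" using p d(2) by auto
    ultimately show "\<exists>T. open T \<and> y \<in> T \<and> smooth_on T (snd c' \<circ> chart_inv c)"
      using opX by blast
  qed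
  show ?thesis
    using op[OF assms(2,3)] op[OF assms(3,2)] sm[OF assms(2,3)] sm[OF assms(3,2)]
    by (simp add: compatible_def Int_commute)
qed

text \<open>
  Every transition from \<open>d\<close> to a chart of the atlas factors through the larger
  chart \<open>c\<close>, so compatibility with \<open>c\<close> suffices.
\<close>

lemma compatible_chart_maximal:
  assumes "injective_charts A" "c \<in> maximal_atlas A" "is_chart d" "fst d \<subseteq> fst c" "compatible d c"
  shows "d \<in> maximal_atlas A"
  unfolding maximal_atlas_def
proof (intro CollectI conjI ballI)
  show "fst d \<subseteq> points A" using assms(4) maximal_atlasD(3)[OF assms(2)] by auto
  fix a assume a: "a \<in> A"
  have inj: "inj_on (snd a) (fst a)" "inj_on (snd c) (fst c)" "inj_on (snd d) (fst d)"
    using assms(1,3) a maximal_atlasD(1)[OF assms(2)] by (auto simp: injective_charts_def is_chart_def)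
  have ca: "compatible c a" by (rule maximal_atlasD(4)[OF assms(2) a])
  have o: "open (snd c ` (fst c \<inter> fst a))" "open (snd c ` (fst d \<inter> fst c))"
    using ca assms(5) by (auto simp: compatible_def)
  have e1: "{p \<in> fst d \<inter> fst c. snd c p \<in> snd c ` (fst c \<inter> fst a)} = fst d \<inter> fst a"
    using inj(2) assms(4) by (auto dest: inj_onD)
  have e2: "{p \<in> fst a \<inter> fst c. snd c p \<in> snd c ` (fst d \<inter> fst c)} = fst d \<inter> fst a"
    using inj(2) assms(4) by (auto dest: inj_onD)
  have o1: "open (snd d ` (fst d \<inter> fst a))"
    using compatible_open_preimage[OF inj(3) assms(5) o(1)] by (simp only: e1)
  have o2: "open (snd a ` (fst d \<inter> fst a))"
    using compatible_open_preimage[OF inj(1) compatible_sym[OF ca] o(2)] by (simp only: e2)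
  have s1: "smooth_on (snd d ` (fst d \<inter> fst a)) (snd a \<circ> chart_inv d)"
  proof (rule smooth_transition_compose[OF inj(3,2) _ o1 _ o(1)])
    show "smooth_on (snd d ` (fst d \<inter> fst a)) (snd c \<circ> chart_inv d)"
      using assms(4,5) by (auto simp: compatible_def elim!: smooth_on_subset)
  qed (use ca assms(4) in \<open>auto simp: compatible_def\<close>)
  have s2: "smooth_on (snd a ` (fst d \<inter> fst a)) (snd d \<circ> chart_inv a)"
  proof (rule smooth_transition_compose[OF inj(1,2) _ o2 _ o(2)])
    show "smooth_on (snd a ` (fst d \<inter> fst a)) (snd c \<circ> chart_inv a)"
      using ca assms(4) by (auto simp: compatible_def elim!: smooth_on_subset)
  qed (use assms(4,5) in \<open>auto simp: compatible_def\<close>)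
  show "compatible d a" using o1 o2 s1 s2 by (simp add: compatible_def)
qed (rule assms(3))

lemma smooth_manifold_injective_charts: "smooth_manifold A \<Longrightarrow> injective_charts A"
  by (simp add: smooth_manifold_def injective_charts_def is_chart_def)

lemma smooth_manifold_maximal: "smooth_manifold A \<Longrightarrow> c \<in> A \<Longrightarrow> c \<in> maximal_atlas A"
  by (auto simp: smooth_manifold_def maximal_atlas_def points_def)

lemma topspace_smooth_manifold: "smooth_manifold A \<Longrightarrow> topspace (atlas_topology A) = points A"
proof
  assume A: "smooth_manifold A"
  show "topspace (atlas_topology A) \<subseteq> points A"
    using openin_atlas_topology[OF smooth_manifold_injective_charts[OF A]] by (metis openin_topspace)
  have "fst c \<subseteq> topspace (atlas_topology A)" if "c \<in> A" for c
    using openin_chart_domain[OF smooth_manifold_injective_charts[OF A] smooth_manifold_maximal[OF A that]]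
    by (rule openin_subset)
  then show "points A \<subseteq> topspace (atlas_topology A)" by (auto simp: points_def)
qed


section \<open>Smooth maps in charts\<close>

lemma smooth_map_openin_preimage:
  assumes "smooth_map A B U f" "openin (atlas_topology A) U" "openin (atlas_topology B) V"
  shows "openin (atlas_topology A) {p \<in> U. f p \<in> V}"
proof -
  have "openin (subtopology (atlas_topology A) U) {p \<in> topspace (subtopology (atlas_topology A) U). f p \<in> V}"
    using assms(1,3) openin_continuous_map_preimage unfolding smooth_map_def by blast
  moreover have "topspace (subtopology (atlas_topology A) U) = U"
    using openin_subset[OF assms(2)] by (auto simp: topspace_subtopology)
  ultimately show ?thesis using assms(2) openin_open_subtopology by metis
qed

text \<open>
  Locally the expression of the map is its expression in charts of the two atlases, with a
  transition map on either side.
\<close>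

lemma smooth_map_chart_representation:
  assumes A: "smooth_manifold A" and B: "smooth_manifold B" and U: "openin (atlas_topology A) U"
    and f: "smooth_map A B U f" and b: "b \<in> maximal_atlas A" and e: "e \<in> maximal_atlas B"
  shows "open (snd b ` {p \<in> fst b \<inter> U. f p \<in> fst e})"
    and "smooth_on (snd b ` {p \<in> fst b \<inter> U. f p \<in> fst e}) (\<lambda>y. snd e (f (chart_inv b y)))"
proof -
  note iA = smooth_manifold_injective_charts[OF A] and iB = smooth_manifold_injective_charts[OF B]
  note ib = maximal_atlasD(1)[OF b]
  have "open (snd b ` ({p \<in> U. f p \<in> V} \<inter> fst b))" if "openin (atlas_topology B) V" for V
    by (rule open_chart_image[OF iA b smooth_map_openin_preimage[OF f U that]])
  then have ob: "open (snd b ` {p \<in> fst b \<inter> U. f p \<in> V})" if "openin (atlas_topology B) V" for V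
    using that by (simp add: Int_def conj_ac)
  show "open (snd b ` {p \<in> fst b \<inter> U. f p \<in> fst e})"
    by (rule ob[OF openin_chart_domain[OF iB e]])
  show "smooth_on (snd b ` {p \<in> fst b \<inter> U. f p \<in> fst e}) (\<lambda>y. snd e (f (chart_inv b y)))"
  proof (rule smooth_on_locally)
    fix y assume "y \<in> snd b ` {p \<in> fst b \<inter> U. f p \<in> fst e}"
    then obtain p where p: "p \<in> fst b" "p \<in> U" "f p \<in> fst e" "y = snd b p" by auto
    obtain c where c: "c \<in> A" "p \<in> fst c" using p(1) maximal_atlasD(3)[OF b] by (auto simp: points_def)
    obtain d where d: "d \<in> B" "f p \<in> fst d" using p(3) maximal_atlasD(3)[OF e] by (auto simp: points_def)
    note mc = smooth_manifold_maximal[OF A c(1)] and md = smooth_manifold_maximal[OF B d(1)]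
    note ic = maximal_atlasD(1)[OF mc] and id = maximal_atlasD(1)[OF md]
    have bc: "compatible b c" and de: "compatible d e"
      using maximal_atlas_compatible[OF iA b mc] maximal_atlas_compatible[OF iB md e] by auto
    let ?X = "{p \<in> U. f p \<in> fst e \<inter> fst d} \<inter> fst c \<inter> fst b"
    let ?T = "snd c ` (U \<inter> fst c \<inter> f -` fst d)"
    have oX: "open (snd b ` ?X)"
      by (intro open_chart_image[OF iA b] openin_Int smooth_map_openin_preimage[OF f U]
          openin_chart_domain[OF iB e] openin_chart_domain[OF iB md] openin_chart_domain[OF iA mc])
    have "open (snd c ` ({p \<in> U. f p \<in> fst d} \<inter> fst c))"
      by (intro open_chart_image[OF iA mc] smooth_map_openin_preimage[OF f U] openin_chart_domain[OF iB md])
    moreover have "{p \<in> U. f p \<in> fst d} \<inter> fst c = U \<inter> fst c \<inter> f -` fst d" by auto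
    ultimately have oT: "open ?T" by simp
    have 1: "smooth_on (snd b ` ?X) (snd c \<circ> chart_inv b)"
      using bc by (auto simp: compatible_def elim!: smooth_on_subset)
    have 2: "smooth_on ?T (snd d \<circ> f \<circ> chart_inv c)"
      using f c(1) d(1) by (simp add: smooth_map_def)
    have 3: "smooth_on (snd b ` ?X) (\<lambda>y. (snd d \<circ> f \<circ> chart_inv c) ((snd c \<circ> chart_inv b) y))"
      by (rule smooth_on_compose[OF oX oT 1 2]) (auto simp: chart_inv_left[OF ib])
    have "smooth_on (snd b ` ?X)
        (\<lambda>y. (snd e \<circ> chart_inv d) ((snd d \<circ> f \<circ> chart_inv c) ((snd c \<circ> chart_inv b) y)))"
      by (rule smooth_on_compose[OF oX _ 3, of "snd d ` (fst d \<inter> fst e)"])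
         (use de in \<open>auto simp: compatible_def o_def chart_inv_left[OF ib] chart_inv_left[OF ic]\<close>)
    then have "smooth_on (snd b ` ?X) (\<lambda>y. snd e (f (chart_inv b y)))"
      by (rule smooth_on_cong[OF oX, rotated])
         (auto simp: chart_inv_left[OF ib] chart_inv_left[OF ic] chart_inv_left[OF id])
    moreover have "y \<in> snd b ` ?X" using p c d by auto
    ultimately show "\<exists>T. open T \<and> y \<in> T \<and> smooth_on T (\<lambda>y. snd e (f (chart_inv b y)))"
      using oX by blast
  qed
qed

lemma smooth_map_from_chart_representation:
  assumes A: "smooth_manifold A" and B: "smooth_manifold B" and U: "openin (atlas_topology A) U"
    and b: "b \<in> maximal_atlas A" and e: "e \<in> maximal_atlas B" and "U \<subseteq> fst b" "f ` U \<subseteq> fst e"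
    and g: "smooth_on (snd b ` U) (\<lambda>y. snd e (f (chart_inv b y)))"
  shows "smooth_map A B U f"
proof -
  note iA = smooth_manifold_injective_charts[OF A] and iB = smooth_manifold_injective_charts[OF B]
  note ib = maximal_atlasD(1)[OF b] and ie = maximal_atlasD(1)[OF e]
  have oU: "open (snd b ` U)"
    using open_chart_image[OF iA b U] assms(6) by (simp add: Int_absorb2)
  have tU: "topspace (subtopology (atlas_topology A) U) = U"
    using openin_subset[OF U] by (auto simp: topspace_subtopology)
  have pre: "openin (atlas_topology A) {p \<in> U. f p \<in> V}" if V: "openin (atlas_topology B) V" for V
  proof -
    let ?N = "snd b ` U \<inter> (\<lambda>y. snd e (f (chart_inv b y))) -` (snd e ` (V \<inter> fst e))"
    have "open ?N"
      by (rule continuous_open_preimage[OF smooth_on_continuous_on[OF g] oU open_chart_image[OF iB e V]])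
    then have "openin (atlas_topology A) {p \<in> fst b. snd b p \<in> ?N}"
      by (rule openin_chart_preimage[OF iA b])
    moreover have "{p \<in> fst b. snd b p \<in> ?N} = {p \<in> U. f p \<in> V}" (is "?L = ?R")
    proof (intro subset_antisym subsetI)
      fix p assume p: "p \<in> ?L"
      then have "p \<in> U" using ib assms(6) by (auto dest: inj_onD)
      moreover obtain q where "q \<in> V" "q \<in> fst e" "snd e (f p) = snd e q"
        using p chart_inv_left[OF ib, of p] by auto
      ultimately show "p \<in> ?R" using ie assms(7) by (auto dest: inj_onD)
    next
      fix p assume "p \<in> ?R"
      then show "p \<in> ?L" using assms(6,7) by (auto simp: chart_inv_left[OF ib] subset_iff)
    qed
    ultimately show ?thesis by simp
  qed
  show ?thesis
    unfolding smooth_map_def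
  proof (intro conjI ballI)
    show "continuous_map (subtopology (atlas_topology A) U) (atlas_topology B) f"
      unfolding continuous_map_def tU
    proof (intro conjI allI impI)
      show "f \<in> U \<rightarrow> topspace (atlas_topology B)"
        using assms(7) maximal_atlasD(3)[OF e] topspace_smooth_manifold[OF B] by auto
      fix V assume "openin (atlas_topology B) V"
      then show "openin (subtopology (atlas_topology A) U) {x \<in> U. f x \<in> V}"
        using pre U by (simp add: openin_open_subtopology)
    qed
    fix c d assume c: "c \<in> A" and d: "d \<in> B"
    note mc = smooth_manifold_maximal[OF A c] and md = smooth_manifold_maximal[OF B d]
    note ic = maximal_atlasD(1)[OF mc] and id = maximal_atlasD(1)[OF md]
    have cb: "compatible c b" and ed: "compatible e d"
      using maximal_atlas_compatible[OF iA mc b] maximal_atlas_compatible[OF iB e md] by auto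
    let ?X = "U \<inter> fst c \<inter> f -` fst d"
    have "open (snd c ` ({p \<in> U. f p \<in> fst d} \<inter> fst c))"
      by (intro open_chart_image[OF iA mc] pre openin_chart_domain[OF iB md])
    moreover have "{p \<in> U. f p \<in> fst d} \<inter> fst c = ?X" by auto
    ultimately have oX: "open (snd c ` ?X)" by simp
    have 1: "smooth_on (snd c ` ?X) (snd b \<circ> chart_inv c)"
      by (rule smooth_on_subset[of "snd c ` (fst c \<inter> fst b)"])
         (use cb assms(6) in \<open>auto simp: compatible_def\<close>)
    have 2: "smooth_on (snd c ` ?X) (\<lambda>y. snd e (f (chart_inv b ((snd b \<circ> chart_inv c) y))))"
      by (rule smooth_on_compose[OF oX oU 1 g]) (auto simp: chart_inv_left[OF ic])
    have "smooth_on (snd c ` ?X)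
        (\<lambda>y. (snd d \<circ> chart_inv e) (snd e (f (chart_inv b ((snd b \<circ> chart_inv c) y)))))"
      by (rule smooth_on_compose[OF oX _ 2, of "snd e ` (fst e \<inter> fst d)"])
         (use ed assms(6,7) in \<open>auto simp: compatible_def o_def chart_inv_left[OF ib] chart_inv_left[OF ic] subset_iff\<close>)
    then show "smooth_on (snd c ` ?X) (snd d \<circ> f \<circ> chart_inv c)"
      by (rule smooth_on_cong[OF oX, rotated])
         (use assms(6,7) in \<open>auto simp: chart_inv_left[OF ib] chart_inv_left[OF ic] chart_inv_left[OF ie] subset_iff\<close>)
  qed
qed


section \<open>Jets of local sections in adapted charts\<close>

text \<open>
  The graph of all derivatives of order at most \<open>r\<close>, that is, the
  \<open>r\<close>-jets of \<open>f\<close> in jet coordinates.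
\<close>

definition prolongation ::
    "(real^'n \<Rightarrow> real^'m) \<Rightarrow> real^'n \<Rightarrow> ('n::finite, 'm::finite, 'r::finite) jet_coord" where
  "prolongation f y = (y, \<chi> I. multi_partial (Rep_mindex I) f y)"

lemma size_Rep_mindex: "size (Rep_mindex (I :: ('n, 'r::finite) mindex)) \<le> CARD('r)"
  using Rep_mindex[of I] by simp

lemma Rep_Abs_mindex: "size J \<le> CARD('r) \<Longrightarrow> Rep_mindex (Abs_mindex J :: ('n, 'r::finite) mindex) = J"
  by (simp add: Abs_mindex_inverse)

lemma smooth_on_prolongation:
  "open S \<Longrightarrow> smooth_on S f \<Longrightarrow> smooth_on S (prolongation f)"
  unfolding prolongation_def[abs_def]
  by (intro smooth_on_Pair smooth_on_ident smooth_on_vec[where f = "\<lambda>y. \<chi> I. multi_partial (Rep_mindex I) f y"])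
     (simp_all add: smooth_on_multi_partial)

text \<open>
  That the derivatives of \<open>\<partial>\<^sub>I f\<close> are the
  \<open>\<partial>\<^sub>I\<^sub>+\<^sub>i f\<close> rests on the symmetry of partial
  derivatives, as each \<open>\<partial>\<^sub>I\<close> is taken in some chosen order.
\<close>

lemma prolongation_derivative:
  fixes f :: "real^'n \<Rightarrow> real^'m"
  assumes "open S" "smooth_on S f" "y \<in> S"
  shows "((prolongation f :: _ \<Rightarrow> ('n, 'm, 'r::finite) jet_coord) has_derivative
    (\<lambda>\<xi>. (\<xi>, \<chi> I. \<Sum>i\<in>UNIV. (\<xi> $ i) *\<^sub>R multi_partial (add_mset i (Rep_mindex I)) f y))) (at y)"
proof -
  let ?P = "prolongation f :: _ \<Rightarrow> ('n, 'm, 'r) jet_coord"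
  have d: "?P differentiable (at y)"
    by (rule smooth_on_differentiable[OF smooth_on_prolongation[OF assms(1,2)] assms(3)])
  have bl: "bounded_linear (\<lambda>q :: ('n, 'm, 'r) jet_coord. snd q $ I)" for I
    by (rule bounded_linear_compose[OF bounded_linear_vec_nth bounded_linear_snd])
  have 1: "fst (directional \<xi> ?P y) = \<xi>" for \<xi>
    using directional_linear[OF bounded_linear_fst d, of \<xi>] by (simp add: prolongation_def)
  have 2: "snd (directional \<xi> ?P y) $ I =
      (\<Sum>i\<in>UNIV. (\<xi> $ i) *\<^sub>R multi_partial (add_mset i (Rep_mindex I)) f y)" for \<xi> I
    using directional_linear[OF bl[of I] d, of \<xi>]
    by (simp add: prolongation_def directional_multi_partial[OF assms])
  have "frechet_derivative ?P (at y) =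
      (\<lambda>\<xi>. (\<xi>, \<chi> I. \<Sum>i\<in>UNIV. (\<xi> $ i) *\<^sub>R multi_partial (add_mset i (Rep_mindex I)) f y))"
    using 1 2 by (intro ext) (simp add: prod_eq_iff vec_eq_iff)
  with iffD1[OF frechet_derivative_works d] show ?thesis by (simp only:)
qed

lemma jet_equiv_refl: "jet_equiv M E \<pi> s x \<sigma> \<sigma>"
  by (simp add: jet_equiv_def)

lemma jet_equiv_sym: "jet_equiv M E \<pi> s x \<sigma> \<tau> \<Longrightarrow> jet_equiv M E \<pi> s x \<tau> \<sigma>"
  by (auto simp: jet_equiv_def)

lemma jet_equiv_trans:
  "jet_equiv M E \<pi> s x \<sigma> \<tau> \<Longrightarrow> jet_equiv M E \<pi> s x \<tau> \<rho> \<Longrightarrow> jet_equiv M E \<pi> s x \<sigma> \<rho>"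
  by (auto simp: jet_equiv_def)

lemma fst_jet [simp]: "fst (jet M E \<pi> s \<sigma> x) = x"
  by (simp add: jet_def)

lemma jet_eqI: "jet_equiv M E \<pi> s x \<sigma> \<tau> \<Longrightarrow> jet M E \<pi> s \<sigma> x = jet M E \<pi> s \<tau> x"
  unfolding jet_def using jet_equiv_trans jet_equiv_sym by fast

lemma jet_eqD:
  assumes "jet M E \<pi> s \<sigma> x = jet M E \<pi> s \<tau> x" "local_section M E \<pi> \<tau>" "x \<in> fst \<tau>"
  shows "jet_equiv M E \<pi> s x \<sigma> \<tau>"
proof -
  have "\<tau> \<in> snd (jet M E \<pi> s \<tau> x)" using assms(2,3) by (simp add: jet_def jet_equiv_refl)
  then show ?thesis unfolding assms(1)[symmetric] by (simp add: jet_def)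
qed

text \<open>
  The coordinates of a jet are computed from some chosen representative, which agrees with any
  given one to order \<open>s\<close> in all adapted charts.
\<close>

lemma jet_representative:
  assumes "local_section M E \<pi> \<sigma>" "x \<in> fst \<sigma>"
  obtains \<tau> where "local_section M E \<pi> \<tau>" "x \<in> fst \<tau>" "jet_equiv M E \<pi> s x \<sigma> \<tau>"
    "(SOME \<tau>. \<tau> \<in> snd (jet M E \<pi> s \<sigma> x)) = \<tau>" "jet_rep (jet M E \<pi> s \<sigma> x) = snd \<tau>"
proof -
  have "\<sigma> \<in> snd (jet M E \<pi> s \<sigma> x)" using assms by (simp add: jet_def jet_equiv_refl)
  then have "(SOME \<tau>. \<tau> \<in> snd (jet M E \<pi> s \<sigma> x)) \<in> snd (jet M E \<pi> s \<sigma> x)" by (rule someI)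
  then show ?thesis by (intro that) (auto simp: jet_rep_def jet_def)
qed

lemma jet_coords_jet:
  fixes M :: "('b, real^'n) chart set" and E :: "('e, (real^'n) \<times> (real^'m)) chart set"
  assumes "local_section M E \<pi> \<sigma>" "x \<in> fst \<sigma>" "adapted M E \<pi> b e" "snd \<sigma> x \<in> fst e"
  shows "(jet_coords s b e (jet M E \<pi> s \<sigma> x) :: ('n, 'm, 'r::finite) jet_coord) = (snd b x, \<chi> I.
    if size (Rep_mindex I) \<le> s then multi_partial (Rep_mindex I) (local_rep b e (snd \<sigma>)) (snd b x) else 0)"
proof -
  obtain \<tau> where \<tau>: "jet_equiv M E \<pi> s x \<sigma> \<tau>" "jet_rep (jet M E \<pi> s \<sigma> x) = snd \<tau>"
    using jet_representative[OF assms(1,2)] by metis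
  have "multi_partial I (local_rep b e (snd \<sigma>)) (snd b x) =
      multi_partial I (local_rep b e (snd \<tau>)) (snd b x)" if "size I \<le> s" for I
    using \<tau>(1) assms(3,4) that unfolding jet_equiv_def by blast
  then show ?thesis by (simp add: jet_coords_def \<tau>(2) vec_eq_iff)
qed

lemma jet_coords_eq_prolongation:
  fixes M :: "('b, real^'n) chart set" and E :: "('e, (real^'n) \<times> (real^'m)) chart set"
  assumes "local_section M E \<pi> \<sigma>" "x \<in> fst \<sigma>" "adapted M E \<pi> b e" "snd \<sigma> x \<in> fst e"
  shows "(jet_coords CARD('r) b e (jet M E \<pi> CARD('r) \<sigma> x) :: ('n, 'm, 'r::finite) jet_coord) =
    prolongation (local_rep b e (snd \<sigma>)) (snd b x)"
  unfolding jet_coords_jet[OF assms] by (simp add: prolongation_def size_Rep_mindex)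

lemma jet_in_chart_iff:
  fixes M :: "('b, real^'n) chart set" and E :: "('e, (real^'n) \<times> (real^'m)) chart set"
  assumes "local_section M E \<pi> \<sigma>" "x \<in> fst \<sigma>"
  shows "jet M E \<pi> CARD('r) \<sigma> x \<in>
      fst (jet_chart M E \<pi> b e :: (_, ('n, 'm, 'r::finite) jet_coord) chart) \<longleftrightarrow> snd \<sigma> x \<in> fst e"
proof -
  obtain \<tau> where \<tau>: "jet_equiv M E \<pi> CARD('r) x \<sigma> \<tau>" "jet_rep (jet M E \<pi> CARD('r) \<sigma> x) = snd \<tau>"
    using jet_representative[OF assms] by metis
  have "jet M E \<pi> CARD('r) \<sigma> x \<in> jet_space M E \<pi> CARD('r)"
    using assms unfolding jet_space_def by blast
  then show ?thesis using \<tau> by (simp add: jet_chart_def jet_equiv_def)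
qed

lemma adapted_point:
  assumes "adapted M E \<pi> b e" "local_section M E \<pi> \<sigma>" "x \<in> fst \<sigma>" "snd \<sigma> x \<in> fst e"
  shows "x \<in> fst b" "snd e (snd \<sigma> x) = (snd b x, snd (snd e (snd \<sigma> x)))"
  using assms by (force simp: adapted_def local_section_def prod_eq_iff)+

lemma jet_chart_cases:
  fixes M :: "('b, real^'n) chart set" and E :: "('e, (real^'n) \<times> (real^'m)) chart set"
  assumes "j \<in> fst (jet_chart M E \<pi> b e :: (_, ('n, 'm, 'r::finite) jet_coord) chart)" "adapted M E \<pi> b e"
  obtains \<sigma> x where "j = jet M E \<pi> CARD('r) \<sigma> x" "local_section M E \<pi> \<sigma>" "x \<in> fst \<sigma>"
    "snd \<sigma> x \<in> fst e" "x \<in> fst b"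
proof -
  obtain \<sigma> x where j: "j = jet M E \<pi> CARD('r) \<sigma> x" "local_section M E \<pi> \<sigma>" "x \<in> fst \<sigma>"
    using assms(1) by (auto simp: jet_chart_def jet_space_def)
  have "snd \<sigma> x \<in> fst e"
    using assms(1) unfolding j(1) using jet_in_chart_iff[OF j(2,3), where 'r = 'r] by blast
  with j show ?thesis using that adapted_point(1)[OF assms(2) j(2,3)] by blast
qed

lemma snd_jet_chart [simp]:
  "snd (jet_chart M E \<pi> b e :: (_, ('n::finite, 'm::finite, 'r::finite) jet_coord) chart) = jet_coords CARD('r) b e"
  by (simp add: jet_chart_def)

text \<open>
  The open set on which \<open>local_rep\<close> really describes the section; elsewhere it
  takes the arbitrary values of the chart inverses.
\<close>

definition section_domain :: "('b, real^'n) chart \<Rightarrow> ('e, (real^'n) \<times> (real^'m)) chart \<Rightarrow> ('b, 'e) sect \<Rightarrow> (real^'n) set"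
  where "section_domain b e \<sigma> = snd b ` {z \<in> fst b \<inter> fst \<sigma>. snd \<sigma> z \<in> fst e}"

locale jets_of_sections =
  fixes M :: "('b, real^'n) chart set"
    and E :: "('e, (real^'n) \<times> (real^'m)) chart set"
    and \<pi> :: "'e \<Rightarrow> 'b"
  assumes smooth_manifold_base: "smooth_manifold M"
    and smooth_manifold_total: "smooth_manifold E"
begin

lemmas injective_charts_base = smooth_manifold_injective_charts[OF smooth_manifold_base]
lemmas injective_charts_total = smooth_manifold_injective_charts[OF smooth_manifold_total]

lemma adapted_maximal:
  assumes "adapted M E \<pi> b e"
  shows "b \<in> maximal_atlas M" "e \<in> maximal_atlas E" "inj_on (snd b) (fst b)" "inj_on (snd e) (fst e)"
  using assms maximal_atlasD(1)[of b M] maximal_atlasD(1)[of e E] by (simp_all add: adapted_def)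

lemma section_in_chart:
  assumes "local_section M E \<pi> \<sigma>" "adapted M E \<pi> b e"
  shows "open (section_domain b e \<sigma>)" "smooth_on (section_domain b e \<sigma>) (local_rep b e (snd \<sigma>))"
    "smooth_on (section_domain b e \<sigma>) (\<lambda>y. snd e (snd \<sigma> (chart_inv b y)))"
    "\<And>y. y \<in> section_domain b e \<sigma> \<Longrightarrow> snd e (snd \<sigma> (chart_inv b y)) = (y, local_rep b e (snd \<sigma>) y)"
    "\<And>y. y \<in> section_domain b e \<sigma> \<Longrightarrow> chart_inv b y \<in> fst b \<inter> fst \<sigma> \<and>
       snd \<sigma> (chart_inv b y) \<in> fst e \<and> snd b (chart_inv b y) = y"
proof -
  have \<sigma>: "openin (atlas_topology M) (fst \<sigma>)" "smooth_map M E (fst \<sigma>) (snd \<sigma>)"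
    using assms(1) by (auto simp: local_section_def)
  note rep = smooth_map_chart_representation[OF smooth_manifold_base smooth_manifold_total \<sigma>
      adapted_maximal(1,2)[OF assms(2)]]
  show o: "open (section_domain b e \<sigma>)" using rep(1) by (simp add: section_domain_def)
  show s: "smooth_on (section_domain b e \<sigma>) (\<lambda>y. snd e (snd \<sigma> (chart_inv b y)))"
    using rep(2) by (simp add: section_domain_def)
  show "smooth_on (section_domain b e \<sigma>) (local_rep b e (snd \<sigma>))"
    unfolding local_rep_def by (rule smooth_on_snd[OF o s])
  fix y assume y: "y \<in> section_domain b e \<sigma>"
  then obtain z where z: "z \<in> fst b" "z \<in> fst \<sigma>" "snd \<sigma> z \<in> fst e" "y = snd b z"
    by (auto simp: section_domain_def)
  then have "chart_inv b y = z" using adapted_maximal(3)[OF assms(2)] by (simp add: chart_inv_left)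
  then show "chart_inv b y \<in> fst b \<inter> fst \<sigma> \<and> snd \<sigma> (chart_inv b y) \<in> fst e \<and> snd b (chart_inv b y) = y"
    "snd e (snd \<sigma> (chart_inv b y)) = (y, local_rep b e (snd \<sigma>) y)"
    using z adapted_point(2)[OF assms(2,1) z(2,3)] by (auto simp: local_rep_def)
qed

lemma section_domainI:
  "z \<in> fst b \<Longrightarrow> z \<in> fst \<sigma> \<Longrightarrow> snd \<sigma> z \<in> fst e \<Longrightarrow> snd b z \<in> section_domain b e \<sigma>"
  by (auto simp: section_domain_def)

lemma openin_section_preimage:
  assumes "local_section M E \<pi> \<sigma>" "e \<in> maximal_atlas E"
  shows "openin (atlas_topology M) {z \<in> fst \<sigma>. snd \<sigma> z \<in> fst e}"
  using assms(1) openin_chart_domain[OF injective_charts_total assms(2)]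
  unfolding local_section_def by (intro smooth_map_openin_preimage) auto

text \<open>
  Independence of the chart. The expression of a section in the second chart is obtained from
  \<open>y \<mapsto> (y, f y)\<close>, its expression in the first, by composing with a
  transition map of the total space after it and one of the base before it.
\<close>

lemma jet_equivI:
  assumes \<sigma>: "local_section M E \<pi> \<sigma>" "x \<in> fst \<sigma>" and \<tau>: "local_section M E \<pi> \<tau>" "x \<in> fst \<tau>"
    and be: "adapted M E \<pi> b e" and "snd \<sigma> x \<in> fst e" "snd \<sigma> x = snd \<tau> x"
    and mp: "\<And>I. size I \<le> s \<Longrightarrow> multi_partial I (local_rep b e (snd \<sigma>)) (snd b x) =
        multi_partial I (local_rep b e (snd \<tau>)) (snd b x)"
  shows "jet_equiv M E \<pi> s x \<sigma> \<tau>"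
  unfolding jet_equiv_def
proof (intro conjI allI impI assms(7))
  fix b' e' and I :: "'n multiset"
  assume *: "adapted M E \<pi> b' e' \<and> snd \<sigma> x \<in> fst e'" and I: "size I \<le> s"
  note be' = conjunct1[OF *]
  note mb = adapted_maximal[OF be] and mb' = adapted_maximal[OF be']
  have x: "x \<in> fst b" "x \<in> fst b'"
    using adapted_point(1)[OF be \<sigma>] adapted_point(1)[OF be' \<sigma>] * assms(6) by auto
  \<comment> \<open>A neighbourhood of the base point on which both sections are seen by both charts.\<close>
  define X where "X = {z \<in> fst \<sigma>. snd \<sigma> z \<in> fst e} \<inter> {z \<in> fst \<sigma>. snd \<sigma> z \<in> fst e'} \<inter>
    ({z \<in> fst \<tau>. snd \<tau> z \<in> fst e} \<inter> {z \<in> fst \<tau>. snd \<tau> z \<in> fst e'}) \<inter> (fst b \<inter> fst b')"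
  have xX: "x \<in> X" using \<sigma> \<tau> x * assms(6,7) by (auto simp: X_def)
  have oX: "openin (atlas_topology M) X"
    unfolding X_def
    by (intro openin_Int openin_section_preimage \<sigma> \<tau> mb mb'
        openin_chart_domain[OF injective_charts_base])
  let ?S = "snd b ` X" and ?S' = "snd b' ` X"
  have Xb: "X \<inter> fst b = X" "X \<inter> fst b' = X" by (auto simp: X_def)
  have oS: "open ?S" "open ?S'"
    using open_chart_image[OF injective_charts_base mb(1) oX]
      open_chart_image[OF injective_charts_base mb'(1) oX] by (simp_all add: Xb)
  have yS: "snd b x \<in> ?S" "snd b' x \<in> ?S'" using xX by auto
  define F where "F \<rho> y = snd e (snd \<rho> (chart_inv b y))" for \<rho> :: "('b, 'e) sect" and y
  define H where "H p = snd ((snd e' \<circ> chart_inv e) p)" for p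
  have SX: "?S \<subseteq> section_domain b e \<rho>" "?S' \<subseteq> section_domain b' e' \<rho>" if "\<rho> \<in> {\<sigma>, \<tau>}" for \<rho>
    using that by (auto simp: X_def section_domain_def)
  have sec: "local_section M E \<pi> \<rho>" if "\<rho> \<in> {\<sigma>, \<tau>}" for \<rho> using that \<sigma> \<tau> by auto
  have sl: "smooth_on ?S (local_rep b e (snd \<rho>))" "smooth_on ?S' (local_rep b' e' (snd \<rho>))"
    "smooth_on ?S (F \<rho>)" if "\<rho> \<in> {\<sigma>, \<tau>}" for \<rho>
    unfolding F_def
    using smooth_on_subset[OF section_in_chart(2)[OF sec[OF that] be] SX(1)[OF that]]
      smooth_on_subset[OF section_in_chart(2)[OF sec[OF that] be'] SX(2)[OF that]]
      smooth_on_subset[OF section_in_chart(3)[OF sec[OF that] be] SX(1)[OF that]] by auto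
  have "same_jet s (local_rep b e (snd \<sigma>)) (local_rep b e (snd \<tau>)) (snd b x)"
    using same_jet_iff_multi_partials[OF oS(1) sl(1) sl(1) yS(1)] mp by simp
  \<comment> \<open>Pass from \<open>f\<close> to \<open>y \<mapsto> (y, f y)\<close>, on which the transition map of the total space acts.\<close>
  then have "same_jet s (\<lambda>y. (0, local_rep b e (snd \<sigma>) y)) (\<lambda>y. (0, local_rep b e (snd \<tau>) y)) (snd b x)"
    by (rule same_jet_bounded_linear[OF bounded_linear_Pair[OF bounded_linear_zero bounded_linear_ident]
          oS(1) yS(1) sl(1) sl(1), rotated 2]) simp_all
  then have "same_jet s (\<lambda>y. (y, 0) + (0, local_rep b e (snd \<sigma>) y))
      (\<lambda>y. (y, 0) + (0, local_rep b e (snd \<tau>) y)) (snd b x)"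
    by (intro same_jet_add[OF oS(1) yS(1)] same_jet_refl smooth_on_Pair oS smooth_on_ident
        smooth_on_const sl) auto
  then have 1: "same_jet s (F \<sigma>) (F \<tau>) (snd b x)"
    by (rule same_jet_cong[OF oS(1) yS(1), rotated 2])
       (use SX(1) section_in_chart(4)[OF sec be] in \<open>auto simp: F_def subset_iff\<close>)
  have ee': "compatible e e'" and b'b: "compatible b' b"
    using maximal_atlas_compatible[OF injective_charts_total mb(2) mb'(2)]
      maximal_atlas_compatible[OF injective_charts_base mb'(1) mb(1)] by auto
  have oT: "open (snd e ` (fst e \<inter> fst e'))" using ee' by (auto simp: compatible_def)
  have sH: "smooth_on (snd e ` (fst e \<inter> fst e')) H"
    unfolding H_def using ee' unfolding compatible_def by (intro smooth_on_snd) blast+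
  have FT: "F \<rho> ` ?S \<subseteq> snd e ` (fst e \<inter> fst e')" if "\<rho> \<in> {\<sigma>, \<tau>}" for \<rho>
    using that by (auto simp: F_def X_def chart_inv_left[OF mb(3)])
  have 2: "same_jet s (\<lambda>y. H (F \<sigma> y)) (\<lambda>y. H (F \<tau> y)) (snd b x)"
    by (rule same_jet_post_compose[OF oS(1) yS(1) oT sl(3) sl(3) FT FT sH 1]) auto
  have sh: "smooth_on ?S' (snd b \<circ> chart_inv b')"
    by (rule smooth_on_subset[of "snd b' ` (fst b' \<inter> fst b)"])
       (use b'b in \<open>auto simp: compatible_def X_def\<close>)
  have hx: "(snd b \<circ> chart_inv b') (snd b' x) = snd b x" by (simp add: chart_inv_left[OF mb'(3) x(2)])
  have "same_jet s (\<lambda>y. H (F \<sigma> ((snd b \<circ> chart_inv b') y))) (\<lambda>y. H (F \<tau> ((snd b \<circ> chart_inv b') y)))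
      (snd b' x)"
  proof (rule same_jet_pre_compose[OF oS(2) yS(2) oS(1) sh])
    show "(snd b \<circ> chart_inv b') ` ?S' \<subseteq> ?S"
      by (auto simp: X_def chart_inv_left[OF mb'(3)])
    show "smooth_on ?S (\<lambda>a. H (F \<sigma> a))" "smooth_on ?S (\<lambda>a. H (F \<tau> a))"
      by (rule smooth_on_compose[OF oS(1) oT sl(3) sH FT]; simp)+
    show "same_jet s (\<lambda>a. H (F \<sigma> a)) (\<lambda>a. H (F \<tau> a)) ((snd b \<circ> chart_inv b') (snd b' x))"
      unfolding hx by (rule 2)
  qed
  then have "same_jet s (local_rep b' e' (snd \<sigma>)) (local_rep b' e' (snd \<tau>)) (snd b' x)"
    by (rule same_jet_cong[OF oS(2) yS(2), rotated 2])
       (auto simp: local_rep_def H_def F_def X_def chart_inv_left[OF mb'(3)] chart_inv_left[OF mb(3)]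
          chart_inv_left[OF mb(4)])
  then show "multi_partial I (local_rep b' e' (snd \<sigma>)) (snd b' x) =
      multi_partial I (local_rep b' e' (snd \<tau>)) (snd b' x)"
    using same_jet_iff_multi_partials[OF oS(2) sl(2) sl(2) yS(2)] I by simp
qed

lemma jet_cong:
  assumes "openin (atlas_topology M) W" "x \<in> W" "\<And>z. z \<in> W \<Longrightarrow> snd \<sigma> z = snd \<tau> z"
    and \<sigma>: "local_section M E \<pi> \<sigma>" "x \<in> fst \<sigma>"
  shows "jet M E \<pi> s \<sigma> x = jet M E \<pi> s \<tau> x"
proof (rule jet_eqI)
  show "jet_equiv M E \<pi> s x \<sigma> \<tau>"
    unfolding jet_equiv_def
  proof (intro conjI allI impI)
    show "snd \<sigma> x = snd \<tau> x" using assms(2,3) by simp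
    fix b e and I :: "'n multiset"
    assume be: "adapted M E \<pi> b e \<and> snd \<sigma> x \<in> fst e"
    note mb = adapted_maximal[OF conjunct1[OF be]]
    let ?f = "local_rep b e (snd \<sigma>)" and ?g = "local_rep b e (snd \<tau>)"
    show "multi_partial I ?f (snd b x) = multi_partial I ?g (snd b x)"
    proof (rule multi_partial_cong)
      show "open (snd b ` (W \<inter> fst b))"
        by (rule open_chart_image[OF injective_charts_base mb(1) assms(1)])
      have "x \<in> fst b" using adapted_point(1)[OF conjunct1[OF be] \<sigma> conjunct2[OF be]] .
      then show "snd b x \<in> snd b ` (W \<inter> fst b)" using assms(2) by auto
      show "?f y = ?g y" if "y \<in> snd b ` (W \<inter> fst b)" for y
        using that assms(3) by (auto simp: local_rep_def chart_inv_left[OF mb(3)])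
    qed
  qed
qed

text \<open>
  The coordinates contain the base point, the value of the section (the component of order zero)
  and all derivatives in one chart, hence the jet.
\<close>

lemma jet_coords_inj:
  assumes be: "adapted M E \<pi> b e"
  shows "inj_on (jet_coords CARD('r) b e :: _ \<Rightarrow> ('n, 'm, 'r::finite) jet_coord)
    (fst (jet_chart M E \<pi> b e :: (_, ('n, 'm, 'r) jet_coord) chart))"
proof (rule inj_onI)
  fix j k
  assume j: "j \<in> fst (jet_chart M E \<pi> b e :: (_, ('n, 'm, 'r) jet_coord) chart)"
    and k: "k \<in> fst (jet_chart M E \<pi> b e :: (_, ('n, 'm, 'r) jet_coord) chart)"
    and eq: "(jet_coords CARD('r) b e j :: ('n, 'm, 'r) jet_coord) = jet_coords CARD('r) b e k"
  obtain \<sigma> x where \<sigma>: "j = jet M E \<pi> CARD('r) \<sigma> x" "local_section M E \<pi> \<sigma>" "x \<in> fst \<sigma>"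
    "snd \<sigma> x \<in> fst e" "x \<in> fst b" using jet_chart_cases[OF j be] by blast
  obtain \<tau> y where \<tau>: "k = jet M E \<pi> CARD('r) \<tau> y" "local_section M E \<pi> \<tau>" "y \<in> fst \<tau>"
    "snd \<tau> y \<in> fst e" "y \<in> fst b" using jet_chart_cases[OF k be] by blast
  have eq': "(prolongation (local_rep b e (snd \<sigma>)) (snd b x) :: ('n, 'm, 'r) jet_coord) =
      prolongation (local_rep b e (snd \<tau>)) (snd b y)"
    using eq unfolding \<sigma>(1) \<tau>(1)
    by (simp only: jet_coords_eq_prolongation[OF \<sigma>(2,3) be \<sigma>(4)] jet_coords_eq_prolongation[OF \<tau>(2,3) be \<tau>(4)])
  then have "snd b x = snd b y" by (simp add: prolongation_def)
  then have xy: "x = y" using \<sigma>(5) \<tau>(5) adapted_maximal(3)[OF be] by (auto dest: inj_onD)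
  have mp: "multi_partial I (local_rep b e (snd \<sigma>)) (snd b x) =
      multi_partial I (local_rep b e (snd \<tau>)) (snd b x)" if "size I \<le> CARD('r)" for I
  proof -
    have "multi_partial (Rep_mindex (J :: ('n, 'r) mindex)) (local_rep b e (snd \<sigma>)) (snd b x) =
      multi_partial (Rep_mindex J) (local_rep b e (snd \<tau>)) (snd b x)" for J
      using eq' xy by (simp add: prolongation_def vec_eq_iff)
    from this[of "Abs_mindex I"] show ?thesis by (simp add: Rep_Abs_mindex that)
  qed
  have "snd (snd e (snd \<sigma> x)) = snd (snd e (snd \<tau> x))"
    using mp[of "{#}"] \<sigma>(5) by (simp add: local_rep_def chart_inv_left[OF adapted_maximal(3)[OF be]])
  then have "snd e (snd \<sigma> x) = snd e (snd \<tau> x)"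
    using adapted_point(2)[OF be \<sigma>(2,3,4)] adapted_point(2)[OF be \<tau>(2,3,4)] xy by simp
  then have "snd \<sigma> x = snd \<tau> x"
    using \<sigma>(4) \<tau>(4) xy adapted_maximal(4)[OF be] by (auto dest: inj_onD)
  then have "jet_equiv M E \<pi> CARD('r) x \<sigma> \<tau>"
    using \<sigma> \<tau> xy mp by (intro jet_equivI[OF \<sigma>(2,3) \<tau>(2) _ be]) auto
  then show "j = k" using \<sigma>(1) \<tau>(1) xy jet_eqI by metis
qed

lemma injective_charts_jet_bundle: "injective_charts (jet_bundle (r :: 'r::finite itself) M E \<pi>)"
  unfolding injective_charts_def jet_bundle_def
  using jet_coords_inj[where 'r = 'r] by (force simp only: snd_jet_chart)

lemma jet_coords_jet_proj:
  assumes j: "j \<in> fst (jet_chart M E \<pi> b e :: (_, ('n, 'm, 'r::finite) jet_coord) chart)"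
    and be: "adapted M E \<pi> b e" and s: "s \<le> CARD('r)"
  shows "(jet_coords s b e (jet_proj M E \<pi> s j) :: ('n, 'm, 'r) jet_coord) =
    (fst (jet_coords CARD('r) b e j :: ('n, 'm, 'r) jet_coord),
     \<chi> I. if size (Rep_mindex I) \<le> s then snd (jet_coords CARD('r) b e j) $ I else 0)"
proof -
  obtain \<sigma> x where \<sigma>: "j = jet M E \<pi> CARD('r) \<sigma> x" "local_section M E \<pi> \<sigma>" "x \<in> fst \<sigma>"
    "snd \<sigma> x \<in> fst e" "x \<in> fst b" using jet_chart_cases[OF j be] by blast
  obtain \<tau> where \<tau>: "local_section M E \<pi> \<tau>" "x \<in> fst \<tau>" "jet_equiv M E \<pi> CARD('r) x \<sigma> \<tau>"
    "(SOME \<tau>. \<tau> \<in> snd j) = \<tau>"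
    using jet_representative[OF \<sigma>(2,3)] unfolding \<sigma>(1) by metis
  have te: "snd \<tau> x \<in> fst e" and jt: "j = jet M E \<pi> CARD('r) \<tau> x"
    using \<tau>(3) \<sigma>(1,4) jet_eqI[OF \<tau>(3)] by (simp_all add: jet_equiv_def)
  have "jet_proj M E \<pi> s j = jet M E \<pi> s \<tau> x"
    using \<tau>(4) by (simp add: jet_proj_def jt)
  then have "(jet_coords s b e (jet_proj M E \<pi> s j) :: ('n, 'm, 'r) jet_coord) = (snd b x, \<chi> I.
    if size (Rep_mindex I) \<le> s then multi_partial (Rep_mindex I) (local_rep b e (snd \<tau>)) (snd b x) else 0)"
    using jet_coords_jet[OF \<tau>(1,2) be te] by simp
  then show ?thesis
    unfolding jt jet_coords_eq_prolongation[OF \<tau>(1,2) be te]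
    by (simp add: prolongation_def vec_eq_iff jt[symmetric])
qed

text \<open>
  In coordinates the projection forgets the components of order \<open>r\<close>. Since it is
  differentiated in the model space, this description is needed on a whole neighbourhood of the
  jet.
\<close>

lemma vertical_eq:
  fixes N :: "('n, 'm, 'r::finite) jet_coord set"
  assumes be: "adapted M E \<pi> b e"
    and j: "j \<in> fst (jet_chart M E \<pi> b e :: (_, ('n, 'm, 'r) jet_coord) chart)"
    and N: "open N" "jet_coords CARD('r) b e j \<in> N"
      "N \<subseteq> jet_coords CARD('r) b e ` fst (jet_chart M E \<pi> b e :: (_, ('n, 'm, 'r) jet_coord) chart)"
  shows "(vertical M E \<pi> b e j :: ('n, 'm, 'r) jet_coord set) =
    {(\<xi>, w). \<xi> = 0 \<and> (\<forall>I. size (Rep_mindex I) \<le> CARD('r) - 1 \<longrightarrow> w $ I = 0)}"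
proof -
  let ?c = "jet_chart M E \<pi> b e :: (_, ('n, 'm, 'r) jet_coord) chart"
  let ?p = "(jet_coords (CARD('r) - 1) b e \<circ> jet_proj M E \<pi> (CARD('r) - 1) \<circ> chart_inv ?c)
              :: ('n, 'm, 'r) jet_coord \<Rightarrow> ('n, 'm, 'r) jet_coord"
  define tr where "tr q = (fst q, \<chi> I. if size (Rep_mindex I) \<le> CARD('r) - 1 then snd q $ I else 0)"
    for q :: "('n, 'm, 'r) jet_coord"
  have "linear tr"
    by (auto simp: linear_iff tr_def vec_eq_iff)
  then have bl: "bounded_linear tr" by (simp add: linear_conv_bounded_linear)
  have "?p q = tr q" if "q \<in> N" for q
  proof -
    have "chart_inv ?c q \<in> fst ?c" "snd ?c (chart_inv ?c q) = q"
      using chart_inv_right[of q ?c] subsetD[OF N(3) that] by simp_all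
    then show ?thesis by (simp add: jet_coords_jet_proj[OF _ be] tr_def cong: if_cong)
  qed
  then have "frechet_derivative ?p (at (jet_coords CARD('r) b e j)) =
      frechet_derivative tr (at (jet_coords CARD('r) b e j))"
    by (rule frechet_derivative_cong_open[OF N(1,2)])
  also have "\<dots> = tr"
    by (rule frechet_derivative_at[symmetric]) (rule bounded_linear_imp_has_derivative[OF bl])
  finally have "(vertical M E \<pi> b e j :: ('n, 'm, 'r) jet_coord set) = {v. tr v = 0}"
    by (simp add: vertical_def Let_def)
  also have "\<dots> = {(\<xi>, w). \<xi> = 0 \<and> (\<forall>I. size (Rep_mindex I) \<le> CARD('r) - 1 \<longrightarrow> w $ I = 0)}"
    by (auto simp: tr_def prod_eq_iff vec_eq_iff)
  finally show ?thesis .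
qed

end


section \<open>The Cartan distribution and its Levi tensor\<close>

abbreviation raise :: "'n \<Rightarrow> ('n, 'r::finite) mindex \<Rightarrow> ('n, 'r) mindex" where
  "raise i I \<equiv> Abs_mindex (add_mset i (Rep_mindex I))"

lemma Rep_raise:
  fixes I :: "('n, 'r::finite) mindex"
  assumes "size (Rep_mindex I) \<le> CARD('r) - 1"
  shows "Rep_mindex (raise i I) = add_mset i (Rep_mindex I)"
proof -
  have "Suc (size (Rep_mindex I)) \<le> CARD('r)"
    using assms zero_less_card_finite[where 'a = 'r] by linarith
  then show ?thesis by (intro Rep_Abs_mindex) simp
qed

lemma cartan_iff:
  "v \<in> cartan (q :: ('n::finite, 'm::finite, 'r::finite) jet_coord) \<longleftrightarrow> (\<forall>I. size (Rep_mindex I) \<le> CARD('r) - 1 \<longrightarrow>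
     snd v $ I = (\<Sum>i\<in>UNIV. (fst v $ i) *\<^sub>R (snd q $ raise i I)))"
  by (cases v) (simp add: cartan_def)

lemma subspace_cartan: "subspace (cartan q)"
  by (rule subspaceI) (simp_all add: cartan_iff scaleR_add_left sum.distrib scaleR_sum_right)

text \<open>
  Differentiate the equation \<open>X\<^sub>I(y) = \<Sum>\<^sub>i X\<^sub>i(y)
  y\<^sub>I\<^sub>+\<^sub>i\<close>, which holds on all of \<open>W\<close>, in direction
  \<open>u\<close> at \<open>q\<close>.
\<close>

lemma cartan_section_derivative:
  fixes X :: "('n::finite, 'm::finite, 'r::finite) jet_coord \<Rightarrow> ('n, 'm, 'r) jet_coord"
  assumes "open W" "q \<in> W" "smooth_on W X" "\<And>y. y \<in> W \<Longrightarrow> X y \<in> cartan y"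
    and I: "size (Rep_mindex I) \<le> CARD('r) - 1"
  shows "snd (directional u X q) $ I =
    (\<Sum>i\<in>UNIV. (fst (directional u X q) $ i) *\<^sub>R (snd q $ raise i I)) +
    (\<Sum>i\<in>UNIV. (fst (X q) $ i) *\<^sub>R (snd u $ raise i I))"
proof -
  have dX: "(X has_derivative (\<lambda>u. directional u X q)) (at q)"
    by (rule smooth_on_has_derivative[OF assms(3,2)])
  have nth: "((\<lambda>y. snd (Z y) $ K) has_derivative (\<lambda>u. snd (Z' u) $ K)) (at q)"
    if "(Z has_derivative Z') (at q)" for Z Z' and K :: "('n, 'r) mindex"
    by (intro bounded_linear.has_derivative[OF bounded_linear_vec_nth] has_derivative_snd that)
  have nth1: "((\<lambda>y. fst (X y) $ i) has_derivative (\<lambda>u. fst (directional u X q) $ i)) (at q)" for i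
    by (intro bounded_linear.has_derivative[OF bounded_linear_vec_nth] has_derivative_fst dX)
  have "((\<lambda>y. \<Sum>i\<in>UNIV. (fst (X y) $ i) *\<^sub>R (snd y $ raise i I)) has_derivative
      (\<lambda>u. \<Sum>i\<in>UNIV. (fst (X q) $ i) *\<^sub>R (snd u $ raise i I) +
         (fst (directional u X q) $ i) *\<^sub>R (snd q $ raise i I))) (at q)"
    by (intro has_derivative_sum has_derivative_scaleR nth1 nth has_derivative_ident)
  moreover have "(\<Sum>i\<in>UNIV. (fst (X y) $ i) *\<^sub>R (snd y $ raise i I)) = snd (X y) $ I" if "y \<in> W" for y
    using assms(4)[OF that] I by (simp add: cartan_iff)
  ultimately have "((\<lambda>y. snd (X y) $ I) has_derivative
      (\<lambda>u. \<Sum>i\<in>UNIV. (fst (X q) $ i) *\<^sub>R (snd u $ raise i I) +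
         (fst (directional u X q) $ i) *\<^sub>R (snd q $ raise i I))) (at q)"
    by (rule has_derivative_transform_within_open[OF _ assms(1,2)])
  from fun_cong[OF has_derivative_unique[OF nth[OF dX] this], of u] show ?thesis
    by (simp add: sum.distrib add.commute)
qed

text \<open>
  The terms containing derivatives of \<open>X\<close> and \<open>Y\<close> combine to the
  defining equation for the bracket. What remains is the Levi form \<open>\<Sum>\<^sub>i
  (w\<^sub>i v\<^sub>I\<^sub>+\<^sub>i - v\<^sub>i w\<^sub>I\<^sub>+\<^sub>i)\<close>, which
  depends only on the values at \<open>q\<close>; the last hypothesis says that it vanishes.
\<close>

lemma lie_bracket_in_cartan:
  fixes q :: "('n::finite, 'm::finite, 'r::finite) jet_coord"
  assumes X: "local_extension Q cartan q v X" and Y: "local_extension Q cartan q w Y"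
    and sym: "\<And>I. size (Rep_mindex I) \<le> CARD('r) - 1 \<Longrightarrow>
      (\<Sum>i\<in>UNIV. (fst w $ i) *\<^sub>R (snd v $ raise i I)) = (\<Sum>i\<in>UNIV. (fst v $ i) *\<^sub>R (snd w $ raise i I))"
  shows "lie_bracket X Y q \<in> cartan q"
  unfolding cartan_iff
proof (intro allI impI)
  fix I :: "('n, 'r) mindex" assume I: "size (Rep_mindex I) \<le> CARD('r) - 1"
  obtain W where W: "open W" "q \<in> W" "smooth_on W X" "\<And>y. y \<in> W \<Longrightarrow> X y \<in> cartan y"
    using X unfolding local_extension_def by blast
  obtain W' where W': "open W'" "q \<in> W'" "smooth_on W' Y" "\<And>y. y \<in> W' \<Longrightarrow> Y y \<in> cartan y"
    using Y unfolding local_extension_def by blast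
  have vw: "X q = v" "Y q = w" using X Y by (auto simp: local_extension_def)
  show "snd (lie_bracket X Y q) $ I = (\<Sum>i\<in>UNIV. (fst (lie_bracket X Y q) $ i) *\<^sub>R (snd q $ raise i I))"
    using cartan_section_derivative[OF W I, of w] cartan_section_derivative[OF W' I, of v] sym[OF I]
    by (simp add: lie_bracket_def vw scaleR_diff_left sum_subtractf)
qed

text \<open>
  Keep the components of \<open>v\<close> along the base and in order \<open>r\<close> constant;
  the other components are then prescribed, and they are linear in the point.
\<close>

lemma cartan_local_extension:
  fixes q :: "('n::finite, 'm::finite, 'r::finite) jet_coord"
  assumes "open W" "q \<in> W" "W \<subseteq> Q" "v \<in> cartan q"
  obtains X where "local_extension Q cartan q v X"
proof
  define X where "X y = (fst v, \<chi> I. if size (Rep_mindex I) \<le> CARD('r) - 1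
      then (\<Sum>i\<in>UNIV. (fst v $ i) *\<^sub>R (snd y $ raise i I)) else snd v $ I)"
    for y :: "('n, 'm, 'r) jet_coord"
  have "smooth_on W X"
    unfolding X_def[abs_def]
  proof (intro smooth_on_Pair smooth_on_const assms(1) smooth_on_vec[where f = "\<lambda>y. \<chi> I. _ y I"])
    fix I :: "('n, 'r) mindex"
    show "smooth_on W (\<lambda>y. (\<chi> I. if size (Rep_mindex I) \<le> CARD('r) - 1
      then (\<Sum>i\<in>UNIV. (fst v $ i) *\<^sub>R (snd y $ raise i I)) else snd v $ I) $ I)"
      by (cases "size (Rep_mindex I) \<le> CARD('r) - 1")
         (simp_all add: smooth_on_const smooth_on_sum smooth_on_scaleR smooth_on_vec_nth
            smooth_on_snd smooth_on_ident assms(1))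
  qed
  moreover have "X y \<in> cartan y" for y by (simp add: cartan_iff X_def)
  moreover have "X q = v"
    using assms(4) by (simp add: cartan_iff X_def prod_eq_iff vec_eq_iff)
  ultimately show "local_extension Q cartan q v X"
    unfolding local_extension_def using assms(1-3) by blast
qed

text \<open>
  The tensor is encoded as a set of cosets over all extensions, so besides the brackets lying in
  the distribution there must be at least one pair of extensions.
\<close>

lemma levi_tensor_vanishes:
  fixes q :: "('n::finite, 'm::finite, 'r::finite) jet_coord"
  assumes "open W" "q \<in> W" "W \<subseteq> Q" "v \<in> cartan q" "w \<in> cartan q"
    and "\<And>I. size (Rep_mindex I) \<le> CARD('r) - 1 \<Longrightarrow>
      (\<Sum>i\<in>UNIV. (fst w $ i) *\<^sub>R (snd v $ raise i I)) = (\<Sum>i\<in>UNIV. (fst v $ i) *\<^sub>R (snd w $ raise i I))"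
  shows "levi_tensor Q cartan q v w = cartan q"
proof
  show "levi_tensor Q cartan q v w \<subseteq> cartan q"
    unfolding levi_tensor_def
    using lie_bracket_in_cartan[OF _ _ assms(6)] subspace_add[OF subspace_cartan] by blast
  obtain X where X: "local_extension Q cartan q v X" using cartan_local_extension[OF assms(1-4)] by blast
  obtain Y where Y: "local_extension Q cartan q w Y" using cartan_local_extension[OF assms(1-3,5)] by blast
  have b: "lie_bracket X Y q \<in> cartan q" by (rule lie_bracket_in_cartan[OF X Y assms(6)])
  show "cartan q \<subseteq> levi_tensor Q cartan q v w"
  proof
    fix z assume "z \<in> cartan q"
    then have "z - lie_bracket X Y q \<in> cartan q" using b subspace_diff[OF subspace_cartan] by blast
    moreover have "z = lie_bracket X Y q + (z - lie_bracket X Y q)" by simp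
    ultimately show "z \<in> levi_tensor Q cartan q v w"
      unfolding levi_tensor_def using X Y by blast
  qed
qed


section \<open>Tangent spaces of graphs\<close>

lemma velocity_in_tangent_space:
  fixes g :: "'a::euclidean_space \<Rightarrow> 'v::euclidean_space"
  assumes "open V" "smooth_on V g" "y \<in> V" "g ` V \<subseteq> snd c ` (S \<inter> fst c)" "g y = snd c p"
  shows "directional \<xi> g y \<in> tangent_space c S p"
proof -
  have bl: "bounded_linear (\<lambda>t :: real. t *\<^sub>R \<xi>)" by (rule bounded_linear_scaleR_left)
  have cont: "continuous_on UNIV (\<lambda>t :: real. y + t *\<^sub>R \<xi>)" by (intro continuous_intros)
  have "open ((\<lambda>t :: real. y + t *\<^sub>R \<xi>) -` V)"
    using open_vimage[OF assms(1) cont] .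
  moreover have "0 \<in> (\<lambda>t :: real. y + t *\<^sub>R \<xi>) -` V" using assms(3) by simp
  ultimately obtain \<epsilon> where \<epsilon>: "0 < \<epsilon>" "ball 0 \<epsilon> \<subseteq> (\<lambda>t :: real. y + t *\<^sub>R \<xi>) -` V"
    using openE by blast
  have ball: "ball 0 \<epsilon> = {-\<epsilon><..<\<epsilon>}" by (auto simp: dist_real_def)
  define \<gamma> where "\<gamma> t = g (y + t *\<^sub>R \<xi>)" for t :: real
  have V: "(\<lambda>t :: real. y + t *\<^sub>R \<xi>) ` {-\<epsilon><..<\<epsilon>} \<subseteq> V" using \<epsilon>(2) ball by auto
  have "smooth_on {-\<epsilon><..<\<epsilon>} \<gamma>"
    unfolding \<gamma>_def
    by (rule smooth_on_compose[OF _ assms(1) _ assms(2) V])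
       (intro smooth_on_add smooth_on_const smooth_on_linear bl open_greaterThanLessThan)+
  moreover have "\<gamma> ` {-\<epsilon><..<\<epsilon>} \<subseteq> snd c ` (S \<inter> fst c)"
    using V assms(4) by (auto simp: \<gamma>_def)
  moreover have "\<gamma> 0 = snd c p" by (simp add: \<gamma>_def assms(5))
  moreover have "(\<gamma> has_vector_derivative directional \<xi> g y) (at 0)"
  proof -
    have 1: "((\<lambda>t :: real. y + t *\<^sub>R \<xi>) has_derivative (\<lambda>t. t *\<^sub>R \<xi>)) (at 0)"
      by (auto intro!: derivative_eq_intros)
    have 2: "(g has_derivative frechet_derivative g (at y)) (at (y + 0 *\<^sub>R \<xi>))"
      using smooth_on_has_derivative[OF assms(2,3)] by simp
    have "(\<gamma> has_derivative (\<lambda>t. directional (t *\<^sub>R \<xi>) g y)) (at 0)"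
      using diff_chain_at[OF 1 2] by (simp add: o_def \<gamma>_def[abs_def])
    then show ?thesis
      using linear_cmul[OF linear_frechet_derivative[OF smooth_on_differentiable[OF assms(2,3)]]]
      by (simp add: has_vector_derivative_def)
  qed
  ultimately show ?thesis using \<epsilon>(1) unfolding tangent_space_def by blast
qed

text \<open>
  A curve in a graph is the image of its projection to the base, so its velocity is determined
  by the projected velocity through the derivative of \<open>g\<close>.
\<close>

lemma tangent_space_graph:
  fixes g :: "'a::euclidean_space \<Rightarrow> 'a \<times> 'w::euclidean_space"
  assumes "open V" "smooth_on V g" "y \<in> V" "snd c ` (S \<inter> fst c) = g ` V" "g y = snd c p"
    and graph: "\<And>y. fst (g y) = y"
  shows "tangent_space c S p = range (\<lambda>\<xi>. directional \<xi> g y)"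
proof
  show "range (\<lambda>\<xi>. directional \<xi> g y) \<subseteq> tangent_space c S p"
    using velocity_in_tangent_space[OF assms(1-3) _ assms(5)] assms(4) by blast
  show "tangent_space c S p \<subseteq> range (\<lambda>\<xi>. directional \<xi> g y)"
  proof
    fix v assume "v \<in> tangent_space c S p"
    then obtain \<gamma> \<epsilon> where \<gamma>: "\<epsilon> > (0::real)" "\<gamma> ` {-\<epsilon><..<\<epsilon>} \<subseteq> g ` V" "\<gamma> 0 = g y"
      "(\<gamma> has_vector_derivative v) (at 0)"
      unfolding tangent_space_def using assms(4,5) by auto
    have d\<gamma>: "(\<gamma> has_derivative (\<lambda>t. t *\<^sub>R v)) (at 0)"
      using \<gamma>(4) by (simp add: has_vector_derivative_def)
    have 1: "((\<lambda>t. fst (\<gamma> t)) has_derivative (\<lambda>t. fst (t *\<^sub>R v))) (at 0)"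
      by (rule has_derivative_fst[OF d\<gamma>])
    have 2: "(g has_derivative frechet_derivative g (at y)) (at (fst (\<gamma> 0)))"
      using smooth_on_has_derivative[OF assms(2,3)] by (simp add: \<gamma>(3) graph)
    have "((\<lambda>t. g (fst (\<gamma> t))) has_derivative (\<lambda>t. directional (fst (t *\<^sub>R v)) g y)) (at 0)"
      using diff_chain_at[OF 1 2] by (simp add: o_def)
    moreover have "g (fst (\<gamma> t)) = \<gamma> t" if "t \<in> {-\<epsilon><..<\<epsilon>}" for t
    proof -
      obtain z where "\<gamma> t = g z" using \<gamma>(2) \<open>t \<in> {-\<epsilon><..<\<epsilon>}\<close> by blast
      then show ?thesis by (simp add: graph)
    qed
    ultimately have "(\<gamma> has_derivative (\<lambda>t. directional (fst (t *\<^sub>R v)) g y)) (at 0)"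
      using has_derivative_transform_within_open[of "\<lambda>t. g (fst (\<gamma> t))" _ 0 UNIV "{-\<epsilon><..<\<epsilon>}" \<gamma>] \<gamma>(1)
      by auto
    from fun_cong[OF has_derivative_unique[OF d\<gamma> this], of 1] show "v \<in> range (\<lambda>\<xi>. directional \<xi> g y)"
      by auto
  qed
qed

text \<open>
  The shear \<open>(x, w) \<mapsto> (x, w - h x)\<close> straightens the graph of
  \<open>h\<close> to the slice \<open>w = 0\<close>.
\<close>

lemma graph_slice_chart:
  fixes d :: "('p, 'x::euclidean_space \<times> 'w::euclidean_space) chart"
  assumes A: "injective_charts A" and d: "d \<in> maximal_atlas A" and V: "open V"
    and h: "smooth_on V h" and p: "p \<in> fst d" "fst (snd d p) \<in> V"
    and S: "\<And>p. p \<in> fst d \<Longrightarrow> fst (snd d p) \<in> V \<Longrightarrow> p \<in> S \<longleftrightarrow> snd (snd d p) = h (fst (snd d p))"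
  shows "\<exists>c\<in>maximal_atlas A. p \<in> fst c \<and>
    (\<exists>L. subspace L \<and> dim L = DIM('x) \<and> snd c ` (S \<inter> fst c) = snd c ` fst c \<inter> L)"
proof -
  define X where "X = {p \<in> fst d. fst (snd d p) \<in> V}"
  \<comment> \<open>The shear and its inverse.\<close>
  define \<Psi> where "\<Psi> q = (fst q, snd q - h (fst q))" for q
  define \<Phi> where "\<Phi> q = (fst q, snd q + h (fst q))" for q
  define e where "e = (X, \<lambda>p. \<Psi> (snd d p))"
  have inv: "\<Phi> (\<Psi> q) = q" "\<Psi> (\<Phi> q) = q" for q by (simp_all add: \<Phi>_def \<Psi>_def)
  have oV: "open (V \<times> (UNIV :: 'w set))" using V by (simp add: open_Times)
  have hs: "smooth_on (V \<times> (UNIV :: 'w set)) (\<lambda>q. h (fst q))"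
    by (rule smooth_on_compose[OF oV V smooth_on_fst[OF oV smooth_on_ident] h]) auto
  have s\<Psi>: "smooth_on (V \<times> UNIV) \<Psi>"
    unfolding \<Psi>_def by (intro smooth_on_Pair smooth_on_diff smooth_on_fst smooth_on_snd smooth_on_ident oV hs)
  have s\<Phi>: "smooth_on (V \<times> UNIV) \<Phi>"
    unfolding \<Phi>_def by (intro smooth_on_Pair smooth_on_add smooth_on_fst smooth_on_snd smooth_on_ident oV hs)
  let ?O = "snd d ` X"
  have mV: "q \<in> V \<times> (UNIV :: 'w set) \<longleftrightarrow> fst q \<in> V" for q
    by (simp add: mem_Times_iff)
  have O: "?O = snd d ` fst d \<inter> (V \<times> UNIV)"
  proof (intro subset_antisym subsetI)
    fix q assume "q \<in> snd d ` fst d \<inter> (V \<times> UNIV)"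
    then show "q \<in> ?O" unfolding X_def mV Int_iff by blast
  next
    fix q assume "q \<in> ?O"
    then show "q \<in> snd d ` fst d \<inter> (V \<times> UNIV)" unfolding X_def mV Int_iff by blast
  qed
  have oO: "open ?O" unfolding O using maximal_atlasD(2)[OF d] oV by auto
  have eX: "snd e ` X = (V \<times> UNIV) \<inter> \<Phi> -` ?O"
  proof (intro subset_antisym subsetI)
    fix q assume "q \<in> snd e ` X"
    then show "q \<in> (V \<times> UNIV) \<inter> \<Phi> -` ?O" by (auto simp: e_def inv) (auto simp: \<Psi>_def X_def)
  next
    fix q assume "q \<in> (V \<times> UNIV) \<inter> \<Phi> -` ?O"
    then obtain p where "p \<in> X" "\<Phi> q = snd d p" by auto
    then show "q \<in> snd e ` X" using inv(2)[of q] by (auto simp: e_def)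
  qed
  have oe: "open (snd e ` X)"
    unfolding eX by (rule continuous_open_preimage[OF smooth_on_continuous_on[OF s\<Phi>] oV oO])
  have id: "inj_on (snd d) (fst d)" by (rule maximal_atlasD(1)[OF d])
  have "inj_on (snd e) X"
  proof (rule inj_onI)
    fix p p' assume *: "p \<in> X" "p' \<in> X" "snd e p = snd e p'"
    then have "snd d p = snd d p'" using inv(1) by (metis e_def snd_conv)
    with * show "p = p'" using id by (auto simp: X_def dest: inj_onD)
  qed
  then have ie: "inj_on (snd e) (fst e)" by (simp add: e_def)
  have Xe: "fst e = X" by (simp add: e_def)
  have Xd: "X \<subseteq> fst d" by (auto simp: X_def)
  have s1: "smooth_on (snd e ` X) (snd d \<circ> chart_inv e)"
  proof (rule smooth_on_cong[OF oe])
    show "smooth_on (snd e ` X) \<Phi>" by (rule smooth_on_subset[OF s\<Phi>]) (simp add: eX)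
    fix q assume "q \<in> snd e ` X"
    then obtain p where p: "p \<in> X" "q = snd e p" by blast
    then have "\<Phi> q = snd d p" by (simp add: e_def inv)
    then show "\<Phi> q = (snd d \<circ> chart_inv e) q" using p Xe by (simp add: chart_inv_left[OF ie])
  qed
  have s2: "smooth_on ?O (snd e \<circ> chart_inv d)"
  proof (rule smooth_on_cong[OF oO])
    show "smooth_on ?O \<Psi>" by (rule smooth_on_subset[OF s\<Psi>]) (simp add: O)
    fix q assume "q \<in> ?O"
    then obtain p where p: "p \<in> X" "q = snd d p" by blast
    then show "\<Psi> q = (snd e \<circ> chart_inv d) q"
      using subsetD[OF Xd p(1)] by (simp add: chart_inv_left[OF id] e_def)
  qed
  have eM: "e \<in> maximal_atlas A"
  proof (rule compatible_chart_maximal[OF A d])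
    show "is_chart e" using ie oe Xe by (simp add: is_chart_def)
    show "fst e \<subseteq> fst d" using Xe Xd by simp
    show "compatible e d" using oe oO s1 s2 Xd by (simp add: compatible_def Xe Int_absorb2)
  qed
  let ?L = "(UNIV :: 'x set) \<times> {0 :: 'w}"
  have slice: "snd e ` (S \<inter> fst e) = snd e ` fst e \<inter> ?L"
  proof -
    have sl: "p \<in> S \<longleftrightarrow> snd e p \<in> ?L" if "p \<in> X" for p
      using S[of p] that by (auto simp: e_def \<Psi>_def X_def)
    have image: "f ` (S \<inter> X) = f ` X \<inter> K" if "\<And>p. p \<in> X \<Longrightarrow> p \<in> S \<longleftrightarrow> f p \<in> K"
      for K and f :: "'p \<Rightarrow> 'x \<times> 'w"
      using that by blast
    show ?thesis unfolding Xe by (rule image[OF sl])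
  qed
  have L: "subspace ?L" by (intro subspace_Times subspace_UNIV subspace_single_0)
  have dL: "dim ?L = DIM('x)" by (subst dim_Times) (simp_all add: subspace_single_0)
  have "p \<in> fst e" using p by (simp add: Xe X_def)
  with eM slice L dL show ?thesis by blast
qed

text \<open>
  A chart of the atlas need not lie in the maximal atlas when nothing is known about its
  overlaps with the other charts. Inside the domain of a compatible chart \<open>c0\<close> it
  does: all overlaps are controlled through \<open>c0\<close>.
\<close>

lemma chart_restrict_maximal:
  assumes A: "injective_charts A" and c0: "c0 \<in> maximal_atlas A" and c: "c \<in> A"
  shows "(fst c0 \<inter> fst c, snd c) \<in> maximal_atlas A"
proof -
  let ?d = "(fst c0 \<inter> fst c, snd c)"
  have cc: "compatible c0 c" by (rule maximal_atlasD(4)[OF c0 c])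
  have ic: "inj_on (snd c) (fst c)" using A c by (auto simp: injective_charts_def)
  then have id: "inj_on (snd c) (fst c0 \<inter> fst c)" by (rule inj_on_subset) auto
  have o: "open (snd c ` (fst c0 \<inter> fst c))" "open (snd c0 ` (fst c0 \<inter> fst c))"
    using cc by (auto simp: compatible_def)
  have inv: "chart_inv ?d (snd c p) = p" "chart_inv c (snd c p) = p" if "p \<in> fst c0" "p \<in> fst c" for p
    using chart_inv_left[of ?d p] chart_inv_left[of c p] id ic that by auto
  have s: "smooth_on (snd c ` (fst c0 \<inter> fst c)) (snd c0 \<circ> chart_inv ?d)"
    by (rule smooth_on_cong[OF o(1), of "snd c0 \<circ> chart_inv c"])
       (use cc in \<open>auto simp: compatible_def inv\<close>)
  show ?thesis
  proof (rule compatible_chart_maximal[OF A c0])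
    show "is_chart ?d" using id o by (simp add: is_chart_def)
    have "fst c0 \<inter> fst c \<inter> fst c0 = fst c0 \<inter> fst c" by auto
    then show "compatible ?d c0" using o s cc by (simp add: compatible_def)
  qed auto
qed


section \<open>Prolongations of solutions are polarised Legendrian\<close>

lemma prolongation_tangent_in_cartan:
  fixes f :: "real^'n \<Rightarrow> real^'m"
  assumes "open V" "smooth_on V f" "y \<in> V"
  shows "directional \<xi> (prolongation f) y \<in> cartan (prolongation f y :: ('n, 'm, 'r::finite) jet_coord)"
  unfolding directional_eqI[OF prolongation_derivative[OF assms]] cartan_iff
  by (simp add: prolongation_def Rep_raise)

text \<open>
  For tangent vectors of a prolongation the two sides of the vanishing condition are double sums
  of \<open>\<eta>\<^sub>i \<xi>\<^sub>k \<partial>\<^sub>i \<partial>\<^sub>k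
  \<partial>\<^sub>I f\<close>, equal because the multi-index is a multiset.
\<close>

lemma prolongation_levi_tensor:
  fixes f :: "real^'n \<Rightarrow> real^'m"
  assumes V: "open V" "smooth_on V f" "y \<in> V"
    and N: "open N" "prolongation f y \<in> N" "N \<subseteq> Q"
  shows "levi_tensor Q cartan (prolongation f y :: ('n, 'm, 'r::finite) jet_coord)
    (directional \<xi> (prolongation f) y) (directional \<eta> (prolongation f) y) = cartan (prolongation f y)"
proof (rule levi_tensor_vanishes[OF N])
  fix I :: "('n, 'r) mindex" assume I: "size (Rep_mindex I) \<le> CARD('r) - 1"
  define a where "a i k = multi_partial (add_mset k (add_mset i (Rep_mindex I))) f y" for i k
  have "(\<Sum>i\<in>UNIV. (\<eta> $ i) *\<^sub>R (\<Sum>k\<in>UNIV. (\<xi> $ k) *\<^sub>R a i k)) =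
      (\<Sum>i\<in>UNIV. \<Sum>k\<in>UNIV. (\<xi> $ k) *\<^sub>R (\<eta> $ i) *\<^sub>R a k i)"
    by (simp add: scaleR_sum_right a_def add_mset_commute mult.commute)
  also have "\<dots> = (\<Sum>k\<in>UNIV. (\<xi> $ k) *\<^sub>R (\<Sum>i\<in>UNIV. (\<eta> $ i) *\<^sub>R a k i))"
    by (subst sum.swap) (simp add: scaleR_sum_right)
  finally show "(\<Sum>i\<in>UNIV. (fst (directional \<eta> (prolongation f) y) $ i) *\<^sub>R
        (snd (directional \<xi> (prolongation f) y :: ('n, 'm, 'r) jet_coord) $ raise i I)) =
      (\<Sum>i\<in>UNIV. (fst (directional \<xi> (prolongation f) y) $ i) *\<^sub>R
        (snd (directional \<eta> (prolongation f) y :: ('n, 'm, 'r) jet_coord) $ raise i I))"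
    unfolding directional_eqI[OF prolongation_derivative[OF V]]
    by (simp add: Rep_raise[OF I] a_def)
qed (rule prolongation_tangent_in_cartan[OF V])+

context jets_of_sections
begin

lemma jet_image_in_chart:
  assumes \<sigma>: "local_section M E \<pi> \<sigma>" and be: "adapted M E \<pi> b e"
  shows "jet_coords CARD('r) b e ` (jet M E \<pi> CARD('r) \<sigma> ` fst \<sigma> \<inter>
      fst (jet_chart M E \<pi> b e :: (_, ('n, 'm, 'r::finite) jet_coord) chart)) =
    (prolongation (local_rep b e (snd \<sigma>)) ` section_domain b e \<sigma> :: ('n, 'm, 'r) jet_coord set)"
    (is "?f ` (?S \<inter> ?D) = ?P ` ?V")
proof (intro subset_antisym subsetI)
  fix q assume "q \<in> ?f ` (?S \<inter> ?D)"
  then obtain x where x: "x \<in> fst \<sigma>" "jet M E \<pi> CARD('r) \<sigma> x \<in> ?D" "q = ?f (jet M E \<pi> CARD('r) \<sigma> x)"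
    by auto
  then have "snd \<sigma> x \<in> fst e" using jet_in_chart_iff[OF \<sigma> x(1), where 'r = 'r] by blast
  then show "q \<in> ?P ` ?V"
    using x jet_coords_eq_prolongation[OF \<sigma> x(1) be] adapted_point(1)[OF be \<sigma> x(1)]
    by (auto intro!: imageI section_domainI)
next
  fix q assume "q \<in> ?P ` ?V"
  then obtain y where y: "y \<in> ?V" "q = ?P y" by auto
  define x where "x = chart_inv b y"
  have x: "x \<in> fst \<sigma>" "snd \<sigma> x \<in> fst e" "snd b x = y"
    using section_in_chart(5)[OF \<sigma> be y(1)] by (auto simp: x_def)
  then have "q = ?f (jet M E \<pi> CARD('r) \<sigma> x)"
    using y(2) jet_coords_eq_prolongation[OF \<sigma> x(1) be x(2), where 'r = 'r] by simp
  moreover have "jet M E \<pi> CARD('r) \<sigma> x \<in> ?S \<inter> ?D"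
    using x jet_in_chart_iff[OF \<sigma> x(1), where 'r = 'r] by blast
  ultimately show "q \<in> ?f ` (?S \<inter> ?D)" by blast
qed

lemma jet_chart_in_bundle:
  "adapted M E \<pi> b e \<Longrightarrow> (jet_chart M E \<pi> b e :: (_, ('n, 'm, 'r::finite) jet_coord) chart) \<in> jet_bundle r M E \<pi>"
  unfolding jet_bundle_def by blast

lemma pde_system_chart:
  assumes "pde_system (r :: 'r::finite itself) M E \<pi> \<E>" "j \<in> \<E>"
  obtains c where "c \<in> maximal_atlas (jet_bundle r M E \<pi>)" "j \<in> fst c"
  using assms unfolding pde_system_def submanifold_def by blast

lemma pde_system_adapted:
  fixes r :: "'r::finite itself"
  assumes "pde_system r M E \<pi> \<E>" "j \<in> \<E>"
  obtains b e where "adapted M E \<pi> b e"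
    "j \<in> fst (jet_chart M E \<pi> b e :: (_, ('n, 'm, 'r) jet_coord) chart)"
  using assms unfolding pde_system_def submanifold_def points_def jet_bundle_def by blast

text \<open>
  In each jet chart the set of jets is the graph of a prolongation, to which the computations
  above apply. The system enters through its slice charts: they give an open neighbourhood in
  each jet chart and a maximal chart to be sheared.
\<close>

lemma jet_image_polarised_legendrian:
  fixes r :: "'r::finite itself"
  assumes \<E>: "pde_system r M E \<pi> \<E>" and \<sigma>: "local_section M E \<pi> \<sigma>"
    and sub: "jet M E \<pi> CARD('r) \<sigma> ` fst \<sigma> \<subseteq> \<E>"
  shows "polarised_legendrian r M E \<pi> CARD('n) (jet M E \<pi> CARD('r) \<sigma> ` fst \<sigma>)"
proof -
  let ?S = "jet M E \<pi> CARD('r) \<sigma> ` fst \<sigma>"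
  let ?A = "jet_bundle r M E \<pi>"
  note iA = injective_charts_jet_bundle[of r]
  have submfd: "submanifold ?A CARD('n) ?S"
    unfolding submanifold_def
  proof (intro conjI ballI)
    show "?S \<subseteq> points ?A" using sub \<E> by (auto simp: pde_system_def submanifold_def)
    fix j assume j: "j \<in> ?S"
    then have jE: "j \<in> \<E>" using sub by blast
    obtain b e where be: "adapted M E \<pi> b e"
      and jc: "j \<in> fst (jet_chart M E \<pi> b e :: (_, ('n, 'm, 'r) jet_coord) chart)"
      using pde_system_adapted[OF \<E> jE] by blast
    let ?c = "jet_chart M E \<pi> b e :: (_, ('n, 'm, 'r) jet_coord) chart"
    obtain c0 where c0: "c0 \<in> maximal_atlas ?A" "j \<in> fst c0" using pde_system_chart[OF \<E> jE] by blast
    let ?d = "(fst c0 \<inter> fst ?c, snd ?c)"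
    let ?f = "local_rep b e (snd \<sigma>)" and ?V = "section_domain b e \<sigma>"
    note V = section_in_chart(1,2)[OF \<sigma> be]
    note im = jet_image_in_chart[OF \<sigma> be, where 'r = 'r]
    have coords: "jet_coords CARD('r) b e j \<in> (prolongation ?f ` ?V :: ('n, 'm, 'r) jet_coord set)"
      unfolding im[symmetric] using j jc by blast
    have "\<exists>c\<in>maximal_atlas ?A. j \<in> fst c \<and>
      (\<exists>L. subspace L \<and> dim L = DIM(real^'n) \<and> snd c ` (?S \<inter> fst c) = snd c ` fst c \<inter> L)"
    proof (rule graph_slice_chart[OF iA chart_restrict_maximal[OF iA c0(1) jet_chart_in_bundle[OF be]] V(1)])
      show "smooth_on ?V (\<lambda>y. snd (prolongation ?f y :: ('n, 'm, 'r) jet_coord))"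
        by (rule smooth_on_snd[OF V(1) smooth_on_prolongation[OF V]])
      show "j \<in> fst ?d" using jc c0(2) by simp
      show "fst (snd ?d j) \<in> ?V" using coords by (auto simp: prolongation_def)
      fix k assume k: "k \<in> fst ?d" "fst (snd ?d k) \<in> ?V"
      then have kc: "k \<in> fst ?c" by simp
      show "k \<in> ?S \<longleftrightarrow> snd (snd ?d k) = snd (prolongation ?f (fst (snd ?d k)) :: ('n, 'm, 'r) jet_coord)"
      proof
        assume "k \<in> ?S"
        then have "jet_coords CARD('r) b e k \<in> (prolongation ?f ` ?V :: ('n, 'm, 'r) jet_coord set)"
          unfolding im[symmetric] using kc by blast
        then show "snd (snd ?d k) = snd (prolongation ?f (fst (snd ?d k)) :: ('n, 'm, 'r) jet_coord)"
          by (auto simp: prolongation_def)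
      next
        assume *: "snd (snd ?d k) = snd (prolongation ?f (fst (snd ?d k)) :: ('n, 'm, 'r) jet_coord)"
        have "(jet_coords CARD('r) b e k :: ('n, 'm, 'r) jet_coord) = prolongation ?f (fst (snd ?d k))"
          using * by (simp add: prod_eq_iff) (simp add: prolongation_def)
        then have "(jet_coords CARD('r) b e k :: ('n, 'm, 'r) jet_coord) \<in> prolongation ?f ` ?V"
          using k(2) by blast
        then obtain k' where k': "k' \<in> ?S" "k' \<in> fst ?c"
          "(jet_coords CARD('r) b e k :: ('n, 'm, 'r) jet_coord) = jet_coords CARD('r) b e k'"
          unfolding im[symmetric] by blast
        then have "k = k'" using inj_onD[OF jet_coords_inj[OF be, where 'r = 'r] _ kc] by blast
        then show "k \<in> ?S" using k'(1) by simp
      qed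
    qed
    then show "\<exists>c\<in>maximal_atlas ?A. j \<in> fst c \<and>
      (\<exists>L. subspace L \<and> dim L = CARD('n) \<and> snd c ` (?S \<inter> fst c) = snd c ` fst c \<inter> L)" by simp
  qed
  have legendrian: "isotropic (snd c ` fst c) cartan (snd c j) (tangent_space c ?S j) \<and>
      direct_sum (cartan (snd c j)) (tangent_space c ?S j) (vertical M E \<pi> b e j)"
    if be: "adapted M E \<pi> b e" and c: "c = (jet_chart M E \<pi> b e :: (_, ('n, 'm, 'r) jet_coord) chart)"
      and j: "j \<in> ?S \<inter> fst c" for b e c j
  proof -
    let ?f = "local_rep b e (snd \<sigma>)" and ?V = "section_domain b e \<sigma>"
    let ?P = "prolongation ?f :: _ \<Rightarrow> ('n, 'm, 'r) jet_coord"
    have sc: "snd c = jet_coords CARD('r) b e" by (simp add: c)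
    note V = section_in_chart(1,2)[OF \<sigma> be]
    have im: "snd c ` (?S \<inter> fst c) = ?P ` ?V"
      unfolding c snd_jet_chart by (rule jet_image_in_chart[OF \<sigma> be])
    obtain y where y: "y \<in> ?V" "snd c j = ?P y" using im j by blast
    have tan: "tangent_space c ?S j = range (\<lambda>\<xi>. directional \<xi> ?P y)"
      by (rule tangent_space_graph[OF V(1) smooth_on_prolongation[OF V] y(1) im y(2)[symmetric]])
         (simp add: prolongation_def)
    note dP = directional_eqI[OF prolongation_derivative[OF V y(1)], where 'r1 = 'r]
    obtain c0 where c0: "c0 \<in> maximal_atlas ?A" "j \<in> fst c0"
      using pde_system_chart[OF \<E>] j sub by blast
    define N where "N = snd c ` (fst c0 \<inter> fst c)"
    have N: "open N" "snd c j \<in> N" "N \<subseteq> snd c ` fst c"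
      using maximal_atlasD(4)[OF c0(1) jet_chart_in_bundle[OF be]] c0(2) j
      unfolding N_def c compatible_def by auto
    have ST: "subspace (tangent_space c ?S j)"
      unfolding tan
      by (rule linear_subspace_image[OF linear_frechet_derivative subspace_UNIV])
         (rule smooth_on_differentiable[OF smooth_on_prolongation[OF V] y(1)])
    have TC: "tangent_space c ?S j \<subseteq> cartan (snd c j)"
      unfolding tan y(2) using prolongation_tangent_in_cartan[OF V y(1)] by blast
    have iso: "isotropic (snd c ` fst c) cartan (snd c j) (tangent_space c ?S j)"
      unfolding isotropic_def
      using ST TC prolongation_levi_tensor[OF V y(1) N(1) _ N(3)] N(2) unfolding tan y(2) by blast
    have vert: "(vertical M E \<pi> b e j :: ('n, 'm, 'r) jet_coord set) =
      {(\<xi>, w). \<xi> = 0 \<and> (\<forall>I. size (Rep_mindex I) \<le> CARD('r) - 1 \<longrightarrow> w $ I = 0)}"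
      by (rule vertical_eq[OF be _ N(1)]) (use j N in \<open>auto simp: c\<close>)
    have vert_iff: "v \<in> (vertical M E \<pi> b e j :: ('n, 'm, 'r) jet_coord set) \<longleftrightarrow>
        fst v = 0 \<and> (\<forall>I. size (Rep_mindex I) \<le> CARD('r) - 1 \<longrightarrow> snd v $ I = 0)" for v
      unfolding vert by (cases v) simp
    have SV: "subspace (vertical M E \<pi> b e j :: ('n, 'm, 'r) jet_coord set)"
      by (intro subspaceI) (simp_all add: vert_iff)
    have "direct_sum (cartan (snd c j)) (tangent_space c ?S j) (vertical M E \<pi> b e j)"
      unfolding direct_sum_def
    proof (intro conjI ST SV)
      show "tangent_space c ?S j \<inter> vertical M E \<pi> b e j = {0}"
      proof -
        have "v = 0" if "v \<in> tangent_space c ?S j" "v \<in> vertical M E \<pi> b e j" for v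
        proof -
          obtain \<xi> where v: "v = directional \<xi> ?P y" using \<open>v \<in> tangent_space c ?S j\<close> tan by auto
          have "\<xi> = 0" using that(2) unfolding vert_iff v dP by simp
          then show ?thesis unfolding v dP by (simp add: prod_eq_iff vec_eq_iff)
        qed
        moreover have "0 \<in> tangent_space c ?S j" using ST subspace_0 by blast
        moreover have "0 \<in> (vertical M E \<pi> b e j :: ('n, 'm, 'r) jet_coord set)"
          by (rule subspace_0[OF SV])
        ultimately show ?thesis by blast
      qed
      have CV: "(vertical M E \<pi> b e j :: ('n, 'm, 'r) jet_coord set) \<subseteq> cartan (snd c j)"
        by (rule subsetI) (simp add: vert_iff cartan_iff)
      show "cartan (snd c j) = {t + g |t g. t \<in> tangent_space c ?S j \<and> g \<in> vertical M E \<pi> b e j}"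
      proof (intro subset_antisym subsetI)
        fix v assume v: "v \<in> cartan (snd c j)"
        let ?t = "directional (fst v) ?P y"
        have t: "?t \<in> tangent_space c ?S j" using tan by blast
        have "v - ?t \<in> cartan (snd c j)" using subspace_diff[OF subspace_cartan v] TC t by blast
        moreover have "fst (v - ?t) = 0" by (simp add: dP)
        ultimately have "v - ?t \<in> vertical M E \<pi> b e j"
          unfolding vert_iff cartan_iff by simp
        then show "v \<in> {t + g |t g. t \<in> tangent_space c ?S j \<and> g \<in> vertical M E \<pi> b e j}"
          using t by (intro CollectI exI[of _ ?t] exI[of _ "v - ?t"]) simp
      next
        fix v assume "v \<in> {t + g |t g. t \<in> tangent_space c ?S j \<and> g \<in> vertical M E \<pi> b e j}"
        then show "v \<in> cartan (snd c j)" using TC CV subspace_add[OF subspace_cartan] by blast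
      qed
    qed
    with iso show ?thesis by blast
  qed
  show ?thesis
    unfolding polarised_legendrian_def Let_def
    by (intro conjI[OF submfd] allI impI ballI) (rule legendrian[OF _ refl])
qed

end


section \<open>Polarised Legendrian submanifolds are prolongations\<close>

text \<open>
  Parametrise \<open>S\<close> by its slice \<open>L\<close> and pass to the chart
  \<open>d\<close>. By transversality the base component of the parametrisation has injective
  derivative, and the dimensions agree, so it can be inverted; composing with the inverse
  reparametrises \<open>S\<close> by the base coordinates.
\<close>

lemma submanifold_local_graph:
  fixes d :: "('p, (real^'n) \<times> 'w::euclidean_space) chart"
  assumes A: "injective_charts A" and S: "submanifold A CARD('n) S" and d: "d \<in> A"
    and p: "p \<in> S" "p \<in> fst d"
    and transversal: "\<And>v. v \<in> tangent_space d S p \<Longrightarrow> fst v = 0 \<Longrightarrow> v = 0"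
  obtains V u W where "open V" "smooth_on V u" "\<And>y. y \<in> V \<Longrightarrow> fst (u y) = y"
    "u ` V \<subseteq> snd d ` (S \<inter> fst d)" "openin (atlas_topology A) W" "p \<in> W"
    "\<And>p'. p' \<in> S \<inter> W \<Longrightarrow> p' \<in> fst d \<and> snd d p' \<in> u ` V"
proof -
  obtain c L where c: "c \<in> maximal_atlas A" "p \<in> fst c" and L: "subspace L" "dim L = CARD('n)"
    and slice: "snd c ` (S \<inter> fst c) = snd c ` fst c \<inter> L"
    using S p(1) unfolding submanifold_def by blast
  have ic: "inj_on (snd c) (fst c)" by (rule maximal_atlasD(1)[OF c(1)])
  have id: "inj_on (snd d) (fst d)" using A d by (auto simp: injective_charts_def)
  have inS: "k \<in> S \<longleftrightarrow> snd c k \<in> L" if "k \<in> fst c" for k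
  proof
    assume "k \<in> S" then show "snd c k \<in> L" using slice that by blast
  next
    assume "snd c k \<in> L"
    then have "snd c k \<in> snd c ` (S \<inter> fst c)" unfolding slice using that by blast
    then show "k \<in> S" using ic that by (auto dest: inj_onD)
  qed
  have cd: "compatible c d" by (rule maximal_atlasD(4)[OF c(1) d])
  define Q where "Q = snd c ` (fst c \<inter> fst d)"
  \<comment> \<open>The transition map from \<open>c\<close> to \<open>d\<close> and its inverse.\<close>
  define \<Theta> where "\<Theta> = snd d \<circ> chart_inv c"
  define \<Xi> where "\<Xi> = snd c \<circ> chart_inv d"
  have oQ: "open Q" and s\<Theta>: "smooth_on Q \<Theta>"
    using cd unfolding Q_def \<Theta>_def compatible_def by blast+
  have oQ': "open (snd d ` (fst c \<inter> fst d))" and s\<Xi>: "smooth_on (snd d ` (fst c \<inter> fst d)) \<Xi>"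
    using cd unfolding \<Xi>_def compatible_def by blast+
  have \<Theta>: "\<Theta> (snd c k) = snd d k" "\<Xi> (snd d k) = snd c k" if "k \<in> fst c" "k \<in> fst d" for k
    using that by (simp_all add: \<Theta>_def \<Xi>_def chart_inv_left[OF ic] chart_inv_left[OF id])
  define q0 where "q0 = snd c p"
  have q0: "q0 \<in> Q" "q0 \<in> L" using p c(2) inS[OF c(2)] by (auto simp: q0_def Q_def)
  have "\<exists>f. linear f \<and> f ` (UNIV :: (real^'n) set) = L \<and> inj_on f UNIV"
    by (rule subspace_isomorphism[OF subspace_UNIV L(1)]) (simp add: L(2))
  then obtain a where a: "linear a" "a ` (UNIV :: (real^'n) set) = L" "inj a" by blast
  obtain a' where a': "linear a'" "a' \<circ> a = id" using linear_injective_left_inverse[OF a(1,3)] by blast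
  have bla: "bounded_linear a" "bounded_linear a'" using a(1) a'(1) linear_conv_bounded_linear by blast+
  have inv: "a' (a z) = z" for z using a'(2) by (metis comp_apply id_apply)
  \<comment> \<open>An affine parametrisation of the slice; as \<open>q0\<close> lies in the subspace \<open>L\<close>, it stays in \<open>L\<close>.\<close>
  define P where "P z = q0 + a z" for z
  have PL: "P z \<in> L" for z unfolding P_def using q0(2) a(2) L(1) by (auto intro: subspace_add)
  have contP: "continuous_on UNIV P"
    unfolding P_def by (intro continuous_intros linear_continuous_on bla)
  define Z where "Z = P -` Q"
  have oZ: "open Z" unfolding Z_def by (rule open_vimage[OF oQ contP])
  have P0: "P 0 = q0" by (simp add: P_def linear_0[OF a(1)])
  have Z0: "0 \<in> Z" using q0(1) by (simp add: Z_def P0)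
  have sP: "smooth_on Z P"
    unfolding P_def by (intro smooth_on_add smooth_on_const smooth_on_linear bla oZ)
  define G where "G z = \<Theta> (P z)" for z
  have sG: "smooth_on Z G"
    unfolding G_def by (rule smooth_on_compose[OF oZ oQ sP s\<Theta>]) (auto simp: Z_def)
  have pt: "\<exists>k \<in> S \<inter> fst c \<inter> fst d. P z = snd c k \<and> G z = snd d k" if "z \<in> Z" for z
  proof -
    have "P z \<in> snd c ` (fst c \<inter> fst d)" using that by (simp add: Z_def Q_def)
    then obtain k where k: "k \<in> fst c" "k \<in> fst d" "P z = snd c k" by blast
    moreover have "k \<in> S" using inS[OF k(1)] PL[of z] k(3) by simp
    ultimately show ?thesis using \<Theta>(1)[of k] by (auto simp: G_def)
  qed
  have GS: "G ` Z \<subseteq> snd d ` (S \<inter> fst d)" using pt by blast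
  have GQ: "G ` Z \<subseteq> snd d ` (fst c \<inter> fst d)" using pt by blast
  have \<Xi>G: "\<Xi> (G z) = P z" if "z \<in> Z" for z using pt[OF that] \<Theta>(2) by auto
  have G0: "G 0 = snd d p" using \<Theta>(1)[OF c(2) p(2)] by (simp add: G_def P0 q0_def)
  have dG: "G differentiable (at 0)" by (rule smooth_on_differentiable[OF sG Z0])
  \<comment> \<open>\<open>G\<close> is an immersion, because \<open>\<Xi>\<close> undoes the change of charts.\<close>
  have DG: "directional \<zeta> G 0 = 0 \<Longrightarrow> \<zeta> = 0" for \<zeta>
  proof -
    assume z: "directional \<zeta> G 0 = 0"
    have d\<Xi>: "\<Xi> differentiable (at (G 0))"
      by (rule smooth_on_differentiable[OF s\<Xi>]) (use Z0 GQ in blast)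
    have "frechet_derivative (\<lambda>z. \<Xi> (G z)) (at 0) = frechet_derivative P (at 0)"
      by (rule frechet_derivative_cong_open[OF oZ Z0 \<Xi>G])
    moreover have "frechet_derivative P (at 0) = a"
    proof (rule frechet_derivative_at[symmetric])
      show "(P has_derivative a) (at 0)"
        unfolding P_def[abs_def]
        using has_derivative_add[OF has_derivative_const bounded_linear_imp_has_derivative[OF bla(1)],
            of q0 "at 0"] by simp
    qed
    ultimately have "a \<zeta> = frechet_derivative (\<Xi> \<circ> G) (at 0) \<zeta>" by (simp add: o_def)
    also have "\<dots> = frechet_derivative \<Xi> (at (G 0)) (directional \<zeta> G 0)"
      by (simp add: frechet_derivative_compose[OF dG d\<Xi>])
    also have "\<dots> = 0" using linear_0[OF linear_frechet_derivative[OF d\<Xi>]] z by simp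
    finally show "\<zeta> = 0" using inv[of \<zeta>] linear_0[OF a'(1)] by simp
  qed
  define X where "X z = fst (G z)" for z
  have sX: "smooth_on Z X" unfolding X_def by (rule smooth_on_fst[OF oZ sG])
  have DX: "directional \<zeta> X 0 = fst (directional \<zeta> G 0)" for \<zeta>
    unfolding X_def by (rule directional_linear[OF bounded_linear_fst dG])
  have "inj (frechet_derivative X (at 0))"
  proof (subst linear_injective_0[OF linear_frechet_derivative[OF smooth_on_differentiable[OF sX Z0]]],
      intro allI impI)
    fix \<zeta> assume "directional \<zeta> X 0 = 0"
    then have "fst (directional \<zeta> G 0) = 0" by (simp add: DX)
    moreover have "directional \<zeta> G 0 \<in> tangent_space d S p"
      by (rule velocity_in_tangent_space[OF oZ sG Z0 GS G0])
    ultimately show "\<zeta> = 0" using transversal DG by blast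
  qed
  from smooth_local_inverse[OF oZ sX Z0 this] obtain U' V g where
    U': "open U'" "U' \<subseteq> Z" "0 \<in> U'" and V: "open V"
    and Xg: "\<And>z. z \<in> U' \<Longrightarrow> X z \<in> V \<and> g (X z) = z"
      "\<And>y. y \<in> V \<Longrightarrow> g y \<in> U' \<and> X (g y) = y" and sg: "smooth_on V g"
    by metis
  define u where "u y = G (g y)" for y
  have gZ: "g ` V \<subseteq> Z" using Xg(2) U'(2) by blast
  have su: "smooth_on V u" unfolding u_def by (rule smooth_on_compose[OF V oZ sg sG gZ])
  \<comment> \<open>Coordinates around \<open>q0\<close> for which the parameter in the slice lies in the domain where the base component is injective.\<close>
  define N where "N = Q \<inter> (\<lambda>q. a' (q - q0)) -` U'"
  have oN: "open N"
    unfolding N_def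
    by (intro open_Int oQ open_vimage U'(1) linear_continuous_on_compose[OF _ a'(1)] continuous_intros)
  define W where "W = {k \<in> fst c. snd c k \<in> N}"
  show ?thesis
  proof (rule that[OF V su])
    show "fst (u y) = y" if "y \<in> V" for y using Xg(2)[OF that] by (simp add: u_def X_def)
    show "u ` V \<subseteq> snd d ` (S \<inter> fst d)" using GS gZ unfolding u_def by blast
    show "openin (atlas_topology A) W" unfolding W_def by (rule openin_chart_preimage[OF A c(1) oN])
    show "p \<in> W" using c(2) q0(1) U'(3) by (simp add: W_def N_def q0_def[symmetric] linear_0[OF a'(1)])
    fix k assume k: "k \<in> S \<inter> W"
    then have kc: "k \<in> fst c" "snd c k \<in> Q" "a' (snd c k - q0) \<in> U'" by (auto simp: W_def N_def)
    have kd: "k \<in> fst d" using kc(1,2) ic by (auto simp: Q_def dest: inj_onD)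
    have "snd c k - q0 \<in> L" using inS[OF kc(1)] k q0(2) L(1) by (auto intro: subspace_diff)
    then obtain z where z: "snd c k - q0 = a z" using a(2) by blast
    then have zU: "z \<in> U'" using kc(3) inv by simp
    have Pz: "P z = snd c k" using z by (simp add: P_def algebra_simps)
    have "G z = snd d k" using \<Theta>(1)[OF kc(1) kd] by (simp add: G_def Pz)
    then have "snd d k = u (X z)" "X z \<in> V" using Xg(1)[OF zU] by (auto simp: u_def)
    then show "k \<in> fst d \<and> snd d k \<in> u ` V" using kd by blast
  qed
qed

text \<open>
  Tangency to the distribution is the system \<open>\<partial>\<^sub>i u\<^sub>I =
  u\<^sub>I\<^sub>+\<^sub>i\<close>, so each derivative of \<open>u\<^sub>\<emptyset>\<close> is
  found among the components.
\<close>

lemma cartan_section_is_prolongation: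
  fixes u :: "real^'n \<Rightarrow> ('n, 'm::finite, 'r::finite) jet_coord"
  assumes V: "open V" and u: "smooth_on V u" and graph: "\<And>y. y \<in> V \<Longrightarrow> fst (u y) = y"
    and cartan: "\<And>y \<xi>. y \<in> V \<Longrightarrow> directional \<xi> u y \<in> cartan (u y)" and y: "y \<in> V"
  shows "u y = prolongation (\<lambda>y. snd (u y) $ Abs_mindex {#}) y"
proof -
  define f where "f y = snd (u y) $ Abs_mindex {#}" for y
  have nth: "bounded_linear (\<lambda>q :: ('n, 'm, 'r) jet_coord. snd q $ I)" for I
    by (rule bounded_linear_compose[OF bounded_linear_vec_nth bounded_linear_snd])
  have jet: "foldr partial l f y = snd (u y) $ (Abs_mindex (mset l) :: ('n, 'r) mindex)"
    if "length l \<le> CARD('r)" "y \<in> V" for l y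
    using that
  proof (induction l arbitrary: y)
    case (Cons i l)
    let ?I = "Abs_mindex (mset l) :: ('n, 'r) mindex"
    have I: "Rep_mindex ?I = mset l" using Cons.prems(1) by (intro Rep_Abs_mindex) simp
    have du: "u differentiable (at y)" by (rule smooth_on_differentiable[OF u Cons.prems(2)])
    have "foldr partial (i # l) f y = partial i (foldr partial l f) y" by simp
    also have "\<dots> = partial i (\<lambda>y. snd (u y) $ ?I) y"
      by (rule partial_cong[OF V _ Cons.prems(2)]) (use Cons in simp)
    also have "\<dots> = snd (directional (axis i 1) u y) $ ?I"
      unfolding partial_def by (rule directional_linear[OF nth du])
    also have "\<dots> = (\<Sum>k\<in>UNIV. (fst (directional (axis i 1) u y) $ k) *\<^sub>R (snd (u y) $ raise k ?I))"
      using cartan[OF Cons.prems(2), of "axis i 1"] Cons.prems(1) unfolding cartan_iff by (simp add: I)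
    also have "fst (directional (axis i 1) u y) = axis i 1"
    proof -
      have "fst (directional (axis i 1) u y) = directional (axis i 1) (\<lambda>y. fst (u y)) y"
        by (rule directional_linear[OF bounded_linear_fst du, symmetric])
      also have "\<dots> = directional (axis i 1) (\<lambda>y. y) y"
        using frechet_derivative_cong_open[OF V Cons.prems(2), of "\<lambda>y. fst (u y)" "\<lambda>y. y"] graph
        by metis
      finally show ?thesis by simp
    qed
    also have "(\<Sum>k\<in>UNIV. ((axis i 1 :: real^'n) $ k) *\<^sub>R (snd (u y) $ raise k ?I)) = snd (u y) $ raise i ?I"
    proof -
      have "(\<Sum>k\<in>UNIV. ((axis i 1 :: real^'n) $ k) *\<^sub>R (snd (u y) $ raise k ?I)) =
          (\<Sum>k\<in>UNIV. if k = i then snd (u y) $ raise k ?I else 0)"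
        by (intro sum.cong refl) (simp add: axis_def)
      then show ?thesis by simp
    qed
    finally show ?case by (simp add: I)
  qed (simp add: f_def)
  have "multi_partial (Rep_mindex I) f y = snd (u y) $ I" for I
  proof -
    obtain l where l: "mset l = Rep_mindex I" "multi_partial (Rep_mindex I) f = foldr partial l f"
      using multi_partial_list by metis
    have "length l \<le> CARD('r)" using size_Rep_mindex[of I] l(1) by (metis size_mset)
    from jet[OF this y] show ?thesis by (simp add: l Rep_mindex_inverse)
  qed
  then have "u y = prolongation f y"
    using graph[OF y] by (simp add: prolongation_def prod_eq_iff vec_eq_iff)
  then show ?thesis unfolding f_def .
qed

context jets_of_sections
begin

lemma local_section_of_graph:
  assumes be: "adapted M E \<pi> b e" and V: "open V" and f: "smooth_on V f"
    and dom: "\<And>y. y \<in> V \<Longrightarrow> y \<in> snd b ` fst b \<and> (y, f y) \<in> snd e ` fst e"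
  obtains \<sigma> where "local_section M E \<pi> \<sigma>" "fst \<sigma> = {z \<in> fst b. snd b z \<in> V}"
    "\<forall>z\<in>fst \<sigma>. snd \<sigma> z \<in> fst e" "\<forall>y\<in>V. local_rep b e (snd \<sigma>) y = f y"
proof -
  note mb = adapted_maximal[OF be]
  define U where "U = {z \<in> fst b. snd b z \<in> V}"
  define \<phi> where "\<phi> z = chart_inv e (snd b z, f (snd b z))" for z
  have U: "openin (atlas_topology M) U"
    unfolding U_def by (rule openin_chart_preimage[OF injective_charts_base mb(1) V])
  have bU: "snd b ` U = V" using dom unfolding U_def by blast
  have \<phi>: "\<phi> z \<in> fst e" "snd e (\<phi> z) = (snd b z, f (snd b z))" if "z \<in> U" for z
    using chart_inv_right[of "(snd b z, f (snd b z))" e] dom[of "snd b z"] that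
    by (auto simp: \<phi>_def U_def)
  have inv: "chart_inv b y \<in> U" "snd b (chart_inv b y) = y" if "y \<in> V" for y
    using chart_inv_right[of y b] dom[OF that] that by (auto simp: U_def)
  have "smooth_map M E U \<phi>"
  proof (rule smooth_map_from_chart_representation[OF smooth_manifold_base smooth_manifold_total U mb(1,2)])
    show "U \<subseteq> fst b" by (auto simp: U_def)
    show "\<phi> ` U \<subseteq> fst e" using \<phi>(1) by blast
    have "smooth_on V (\<lambda>y. (y, f y))" by (intro smooth_on_Pair smooth_on_ident V f)
    then show "smooth_on (snd b ` U) (\<lambda>y. snd e (\<phi> (chart_inv b y)))"
      unfolding bU by (rule smooth_on_cong[OF V, rotated]) (simp add: \<phi> inv)
  qed
  moreover have "\<pi> (\<phi> z) = z" if z: "z \<in> U" for z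
  proof -
    have "\<pi> (\<phi> z) \<in> fst b" "snd b (\<pi> (\<phi> z)) = snd b z"
      using be \<phi>[OF z] by (auto simp: adapted_def)
    then show ?thesis using z mb(3) by (auto simp: U_def dest: inj_onD)
  qed
  ultimately have "local_section M E \<pi> (U, \<phi>)" using U by (simp add: local_section_def)
  then show ?thesis
    by (rule that) (auto simp: U_def[symmetric] \<phi> local_rep_def inv)
qed

text \<open>
  The graph description of \<open>S\<close> near \<open>j\<close> is a prolongation, since
  \<open>S\<close> is tangent to the Cartan distribution at all points and not only at
  \<open>j\<close>. Its component of order zero is a section of the total space, because the
  points of the graph are themselves jets over it.
\<close>

lemma polarised_legendrian_is_jet_image:
  fixes r :: "'r::finite itself"
  assumes S: "polarised_legendrian r M E \<pi> CARD('n) S" and j: "j \<in> S"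
  obtains \<sigma> W where "local_section M E \<pi> \<sigma>" "jet M E \<pi> CARD('r) \<sigma> ` fst \<sigma> \<subseteq> S"
    "openin (atlas_topology (jet_bundle r M E \<pi>)) W" "j \<in> W"
    "S \<inter> W \<subseteq> jet M E \<pi> CARD('r) \<sigma> ` fst \<sigma>"
proof -
  let ?A = "jet_bundle r M E \<pi>"
  note iA = injective_charts_jet_bundle[of r]
  have sub: "submanifold ?A CARD('n) S" using S by (simp only: polarised_legendrian_def)
  obtain b e where be: "adapted M E \<pi> b e"
    and jd: "j \<in> fst (jet_chart M E \<pi> b e :: (_, ('n, 'm, 'r) jet_coord) chart)"
    using sub j unfolding submanifold_def points_def jet_bundle_def by blast
  define d where "d = (jet_chart M E \<pi> b e :: (_, ('n, 'm, 'r) jet_coord) chart)"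
  have dA: "d \<in> ?A" unfolding d_def by (rule jet_chart_in_bundle[OF be])
  have sd: "snd d = jet_coords CARD('r) b e" by (simp add: d_def)
  note injd = jet_coords_inj[OF be, where 'r = 'r, folded d_def]
  have leg: "tangent_space d S k \<subseteq> cartan (snd d k)"
    "tangent_space d S k \<inter> vertical M E \<pi> b e k = {0}" if "k \<in> S" "k \<in> fst d" for k
    using S be that unfolding polarised_legendrian_def Let_def isotropic_def direct_sum_def d_def by blast+
  obtain c0 where c0: "c0 \<in> maximal_atlas ?A" "j \<in> fst c0"
    using sub j unfolding submanifold_def by blast
  have "v = 0" if v: "v \<in> tangent_space d S j" "fst v = 0" for v
  proof -
    have N: "open (snd d ` (fst c0 \<inter> fst d))"
      using maximal_atlasD(4)[OF c0(1) dA] by (simp add: compatible_def)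
    have "(vertical M E \<pi> b e j :: ('n, 'm, 'r) jet_coord set) =
      {(\<xi>, w). \<xi> = 0 \<and> (\<forall>I. size (Rep_mindex I) \<le> CARD('r) - 1 \<longrightarrow> w $ I = 0)}"
      by (rule vertical_eq[OF be jd N]) (use c0 jd in \<open>auto simp: d_def\<close>)
    moreover have "v \<in> cartan (snd d j)" using leg(1) v(1) j jd d_def by blast
    ultimately have "v \<in> vertical M E \<pi> b e j"
      using v(2) by (cases v) (simp add: cartan_iff)
    then show "v = 0" using leg(2)[OF j] v(1) jd d_def by blast
  qed
  from submanifold_local_graph[OF iA sub dA j _ this] jd
  obtain V u W where V: "open V" and u: "smooth_on V u" and graph: "\<And>y. y \<in> V \<Longrightarrow> fst (u y) = y"
    and uS: "u ` V \<subseteq> snd d ` (S \<inter> fst d)" and W: "openin (atlas_topology ?A) W" "j \<in> W"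
    and SW: "\<And>k. k \<in> S \<inter> W \<Longrightarrow> k \<in> fst d \<and> snd d k \<in> u ` V"
    unfolding d_def by metis
  define f where "f y = snd (u y) $ (Abs_mindex {#} :: ('n, 'r) mindex)" for y
  have pt: "\<exists>k. k \<in> S \<and> k \<in> fst d \<and> snd d k = u y" if "y \<in> V" for y
  proof -
    have "u y \<in> snd d ` (S \<inter> fst d)" using uS that by blast
    then obtain k where "u y = snd d k" "k \<in> S \<inter> fst d" by (rule imageE)
    then show ?thesis by (intro exI[of _ k]) simp
  qed
  have Cu: "directional \<xi> u y \<in> cartan (u y)" if y: "y \<in> V" for \<xi> y
  proof -
    obtain k where k: "k \<in> S" "k \<in> fst d" "snd d k = u y" using pt[OF y] by blast
    have "directional \<xi> u y \<in> tangent_space d S k"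
      by (rule velocity_in_tangent_space[OF V u y uS k(3)[symmetric]])
    then show ?thesis using leg(1)[OF k(1,2)] k(3) by auto
  qed
  have up: "u y = prolongation f y" if "y \<in> V" for y
    unfolding f_def[abs_def] by (rule cartan_section_is_prolongation[OF V u graph Cu that])
  have sf: "smooth_on V f"
    unfolding f_def by (intro smooth_on_vec_nth smooth_on_snd V u)
  have dom: "y \<in> snd b ` fst b \<and> (y, f y) \<in> snd e ` fst e" if y: "y \<in> V" for y
  proof -
    obtain k where k: "k \<in> S" "k \<in> fst d" "snd d k = u y" using pt[OF y] by blast
    obtain \<tau> x where \<tau>: "k = jet M E \<pi> CARD('r) \<tau> x" "local_section M E \<pi> \<tau>" "x \<in> fst \<tau>"
      "snd \<tau> x \<in> fst e" "x \<in> fst b"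
      using jet_chart_cases[OF k(2)[unfolded d_def] be] by blast
    have eq: "u y = prolongation (local_rep b e (snd \<tau>)) (snd b x)"
      using k(3) jet_coords_eq_prolongation[OF \<tau>(2,3) be \<tau>(4), where 'r = 'r]
      unfolding sd \<tau>(1) by simp
    have yx: "y = snd b x" using eq graph[OF y] by (simp add: prolongation_def)
    have "f y = local_rep b e (snd \<tau>) (snd b x)"
      unfolding f_def eq by (simp add: prolongation_def Rep_Abs_mindex)
    also have "\<dots> = snd (snd e (snd \<tau> x))"
      by (simp add: local_rep_def chart_inv_left[OF adapted_maximal(3)[OF be] \<tau>(5)])
    finally have "(y, f y) = snd e (snd \<tau> x)"
      using adapted_point(2)[OF be \<tau>(2,3,4)] yx by simp
    then show ?thesis using \<tau>(4,5) yx by auto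
  qed
  obtain \<sigma> where \<sigma>: "local_section M E \<pi> \<sigma>" "fst \<sigma> = {z \<in> fst b. snd b z \<in> V}"
    "\<forall>z\<in>fst \<sigma>. snd \<sigma> z \<in> fst e" "\<forall>y\<in>V. local_rep b e (snd \<sigma>) y = f y"
    by (rule local_section_of_graph[OF be V sf dom])
  note \<sigma>e = \<sigma>(3)[rule_format] and \<sigma>f = \<sigma>(4)[rule_format]
  have js: "jet M E \<pi> CARD('r) \<sigma> z \<in> fst d" "snd d (jet M E \<pi> CARD('r) \<sigma> z) = u (snd b z)"
    if z: "z \<in> fst \<sigma>" for z
  proof -
    have zV: "snd b z \<in> V" using z \<sigma>(2) by simp
    show "jet M E \<pi> CARD('r) \<sigma> z \<in> fst d"
      unfolding d_def using jet_in_chart_iff[OF \<sigma>(1) z, where 'r = 'r] \<sigma>e[OF z] by blast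
    have "multi_partial I (local_rep b e (snd \<sigma>)) (snd b z) = multi_partial I f (snd b z)" for I
      by (rule multi_partial_cong[OF V \<sigma>f zV])
    then show "snd d (jet M E \<pi> CARD('r) \<sigma> z) = u (snd b z)"
      unfolding sd jet_coords_eq_prolongation[OF \<sigma>(1) z be \<sigma>e[OF z]] up[OF zV]
      by (simp add: prolongation_def)
  qed
  show ?thesis
  proof (rule that[OF \<sigma>(1) _ W])
    show "jet M E \<pi> CARD('r) \<sigma> ` fst \<sigma> \<subseteq> S"
    proof (rule image_subsetI)
      fix z assume z: "z \<in> fst \<sigma>"
      then obtain k where k: "k \<in> S" "k \<in> fst d" "snd d k = u (snd b z)"
        using pt[of "snd b z"] \<sigma>(2) by auto
      then have "jet M E \<pi> CARD('r) \<sigma> z = k"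
        using inj_onD[OF injd _ js(1)[OF z] k(2)] js(2)[OF z] sd by simp
      then show "jet M E \<pi> CARD('r) \<sigma> z \<in> S" using k(1) by simp
    qed
    show "S \<inter> W \<subseteq> jet M E \<pi> CARD('r) \<sigma> ` fst \<sigma>"
    proof
      fix k assume k: "k \<in> S \<inter> W"
      then obtain y where y: "y \<in> V" "k \<in> fst d" "snd d k = u y" using SW by blast
      obtain z where z: "z \<in> fst b" "snd b z = y" using dom[OF y(1)] by blast
      then have z\<sigma>: "z \<in> fst \<sigma>" using y(1) \<sigma>(2) by simp
      then have "jet M E \<pi> CARD('r) \<sigma> z = k"
        using inj_onD[OF injd _ js(1)[OF z\<sigma>] y(2)] js(2)[OF z\<sigma>] y(3) z(2) sd by simp
      then show "k \<in> jet M E \<pi> CARD('r) \<sigma> ` fst \<sigma>" using z\<sigma> by blast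
    qed
  qed
qed

end


section \<open>The correspondence of germs\<close>

text \<open>
  The induced map sends a class to the saturation of its image, which involves no choice of
  representatives.
\<close>

lemma bij_betw_quotients:
  assumes R: "equiv A R" and R': "equiv B R'"
    and g: "\<And>p. p \<in> A \<Longrightarrow> g p \<in> B"
    and iff: "\<And>p q. p \<in> A \<Longrightarrow> q \<in> A \<Longrightarrow> (p, q) \<in> R \<longleftrightarrow> (g p, g q) \<in> R'"
    and surj: "\<And>l. l \<in> B \<Longrightarrow> \<exists>p\<in>A. (g p, l) \<in> R'"
  shows "\<exists>F. (\<forall>p\<in>A. F (R `` {p}) = R' `` {g p}) \<and> bij_betw F (A // R) (B // R')"
proof -
  define F where "F C = R' `` (g ` C)" for C
  have F: "F (R `` {p}) = R' `` {g p}" if p: "p \<in> A" for p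
  proof
    show "R' `` {g p} \<subseteq> F (R `` {p})"
      unfolding F_def using equiv_class_self[OF R p] by blast
    show "F (R `` {p}) \<subseteq> R' `` {g p}"
    proof
      fix l assume "l \<in> F (R `` {p})"
      then obtain q where q: "(p, q) \<in> R" "(g q, l) \<in> R'" unfolding F_def by blast
      then have "q \<in> A" using R unfolding equiv_def by blast
      then have "(g p, g q) \<in> R'" using iff p q(1) by blast
      then show "l \<in> R' `` {g p}" using q(2) R' unfolding equiv_def trans_def by blast
    qed
  qed
  have "inj_on F (A // R)"
  proof (rule inj_onI)
    fix C D assume "C \<in> A // R" "D \<in> A // R" and eq: "F C = F D"
    then obtain p q where p: "p \<in> A" "C = R `` {p}" and q: "q \<in> A" "D = R `` {q}"
      by (metis quotientE)
    then have "R' `` {g p} = R' `` {g q}" using eq F[OF p(1)] F[OF q(1)] by simp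
    then have "(g p, g q) \<in> R'" by (rule eq_equiv_class[OF _ R' g[OF q(1)]])
    then have "(p, q) \<in> R" using iff[OF p(1) q(1)] by simp
    then show "C = D" using equiv_class_eq[OF R] p(2) q(2) by simp
  qed
  moreover have "F ` (A // R) = B // R'"
  proof
    show "F ` (A // R) \<subseteq> B // R'"
    proof (rule image_subsetI)
      fix C assume "C \<in> A // R"
      then obtain p where "p \<in> A" "C = R `` {p}" by (rule quotientE)
      then show "F C \<in> B // R'" using quotientI[OF g, of p R'] F[of p] by simp
    qed
    show "B // R' \<subseteq> F ` (A // R)"
    proof
      fix D assume "D \<in> B // R'"
      then obtain l where l: "l \<in> B" "D = R' `` {l}" by (rule quotientE)
      then obtain p where p: "p \<in> A" "(g p, l) \<in> R'" using surj by blast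
      then have "D = F (R `` {p})" using F[OF p(1)] equiv_class_eq[OF R' p(2)] l by simp
      then show "D \<in> F ` (A // R)" using quotientI[OF p(1), of R] by simp
    qed
  qed
  ultimately have "bij_betw F (A // R) (B // R')" by (simp add: bij_betw_def)
  then show ?thesis using F by blast
qed

context jets_of_sections
begin

text \<open>
  Continuity of the projection from jets to their base points, near the jets of the system.
\<close>

lemma openin_jet_basepoint:
  fixes r :: "'r::finite itself"
  assumes \<E>: "pde_system r M E \<pi> \<E>" "j \<in> \<E>" and W: "openin (atlas_topology M) W" "fst j \<in> W"
  obtains W' where "openin (atlas_topology (jet_bundle r M E \<pi>)) W'" "j \<in> W'" "\<And>k. k \<in> W' \<Longrightarrow> fst k \<in> W"
proof -
  let ?A = "jet_bundle r M E \<pi>"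
  obtain b e where be: "adapted M E \<pi> b e"
    and jd: "j \<in> fst (jet_chart M E \<pi> b e :: (_, ('n, 'm, 'r) jet_coord) chart)"
    using pde_system_adapted[OF \<E>] by blast
  define d where "d = (jet_chart M E \<pi> b e :: (_, ('n, 'm, 'r) jet_coord) chart)"
  obtain c where c: "c \<in> maximal_atlas ?A" "j \<in> fst c" using pde_system_chart[OF \<E>] by blast
  note iA = injective_charts_jet_bundle[of r] and mb = adapted_maximal[OF be]
  have dM: "(fst c \<inter> fst d, snd d) \<in> maximal_atlas ?A"
    unfolding d_def by (rule chart_restrict_maximal[OF iA c(1) jet_chart_in_bundle[OF be]])
  have base: "fst (snd d k) = snd b (fst k)" for k by (simp add: d_def jet_coords_def)
  have fb: "fst k \<in> fst b" if "k \<in> fst d" for k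
    using jet_chart_cases[OF that[unfolded d_def] be] by (metis fst_jet)
  define N where "N = fst -` (snd b ` (W \<inter> fst b)) \<inter> (UNIV :: ('n, 'm, 'r) jet_coord set)"
  have oN: "open N"
    unfolding N_def Int_UNIV_right
    by (rule open_vimage_fst) (rule open_chart_image[OF injective_charts_base mb(1) W(1)])
  let ?W = "{k \<in> fst (fst c \<inter> fst d, snd d). snd (fst c \<inter> fst d, snd d) k \<in> N}"
  show ?thesis
  proof (rule that[of ?W])
    show "openin (atlas_topology ?A) ?W" by (rule openin_chart_preimage[OF iA dM oN])
    have "j \<in> fst d" using jd by (simp add: d_def)
    then show "j \<in> ?W" using c(2) W(2) fb[of j] by (simp add: N_def base)
    fix k assume k: "k \<in> ?W"
    then have kd: "k \<in> fst d" by simp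
    obtain z where z: "z \<in> W" "z \<in> fst b" "snd b (fst k) = snd b z"
      using k by (auto simp: N_def base)
    then have "fst k = z" using inj_onD[OF mb(3)] fb[OF kd] by blast
    then show "fst k \<in> W" using z(1) by simp
  qed
qed

text \<open>
  In charts the map \<open>x \<mapsto> j\<^sup>r\<sigma>(x)\<close> is a prolongation, hence
  continuous.
\<close>

lemma jet_prolongation_continuous:
  fixes r :: "'r::finite itself"
  assumes \<sigma>: "local_section M E \<pi> \<sigma>" "x \<in> fst \<sigma>"
    and \<E>: "pde_system r M E \<pi> \<E>" "jet M E \<pi> CARD('r) \<sigma> x \<in> \<E>"
    and W: "openin (atlas_topology (jet_bundle r M E \<pi>)) W" "jet M E \<pi> CARD('r) \<sigma> x \<in> W"
  obtains X where "openin (atlas_topology M) X" "x \<in> X" "X \<subseteq> fst \<sigma>"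
    "\<And>z. z \<in> X \<Longrightarrow> jet M E \<pi> CARD('r) \<sigma> z \<in> W"
proof -
  let ?A = "jet_bundle r M E \<pi>"
  obtain b e where be: "adapted M E \<pi> b e"
    and jd: "jet M E \<pi> CARD('r) \<sigma> x \<in> fst (jet_chart M E \<pi> b e :: (_, ('n, 'm, 'r) jet_coord) chart)"
    using pde_system_adapted[OF \<E>] by blast
  define d where "d = (jet_chart M E \<pi> b e :: (_, ('n, 'm, 'r) jet_coord) chart)"
  have sd: "snd d = jet_coords CARD('r) b e" by (simp add: d_def)
  note mb = adapted_maximal[OF be] and injd = jet_coords_inj[OF be, where 'r = 'r, folded d_def]
  let ?P = "prolongation (local_rep b e (snd \<sigma>)) :: _ \<Rightarrow> ('n, 'm, 'r) jet_coord"
  let ?V = "section_domain b e \<sigma>"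
  note V = section_in_chart[OF \<sigma>(1) be]
  have se: "snd \<sigma> x \<in> fst e" using jet_in_chart_iff[OF \<sigma>, where 'r = 'r] jd by blast
  have xb: "x \<in> fst b" by (rule adapted_point(1)[OF be \<sigma> se])
  have oW: "open (snd d ` (W \<inter> fst d))"
    using W(1) jet_chart_in_bundle[OF be] openin_atlas_topology[OF injective_charts_jet_bundle[of r]]
    unfolding d_def by blast
  define V' where "V' = ?V \<inter> ?P -` (snd d ` (W \<inter> fst d))"
  have oV': "open V'"
    unfolding V'_def
    by (rule continuous_open_preimage[OF smooth_on_continuous_on[OF smooth_on_prolongation[OF V(1,2)]] V(1) oW])
  have P: "snd d (jet M E \<pi> CARD('r) \<sigma> z) = ?P (snd b z)" if "z \<in> fst \<sigma>" "snd \<sigma> z \<in> fst e" for z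
    unfolding sd by (rule jet_coords_eq_prolongation[OF \<sigma>(1) that(1) be that(2)])
  let ?X = "{z \<in> fst b. snd b z \<in> V'}"
  have X: "z \<in> fst \<sigma> \<and> snd \<sigma> z \<in> fst e" if "z \<in> ?X" for z
    using V(5)[of "snd b z"] that chart_inv_left[OF mb(3), of z] by (simp add: V'_def)
  show ?thesis
  proof (rule that[of ?X])
    show "openin (atlas_topology M) ?X" by (rule openin_chart_preimage[OF injective_charts_base mb(1) oV'])
    have "snd d (jet M E \<pi> CARD('r) \<sigma> x) \<in> snd d ` (W \<inter> fst d)" using W(2) jd d_def by blast
    then show "x \<in> ?X"
      using xb section_domainI[OF xb \<sigma>(2) se] P[OF \<sigma>(2) se] by (simp add: V'_def)
    show "?X \<subseteq> fst \<sigma>" using X by blast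
    fix z assume z: "z \<in> ?X"
    note zz = conjunct1[OF X[OF z]] conjunct2[OF X[OF z]]
    have zd: "jet M E \<pi> CARD('r) \<sigma> z \<in> fst d"
      unfolding d_def using jet_in_chart_iff[OF \<sigma>(1) zz(1), where 'r = 'r] zz(2) by blast
    have "snd d (jet M E \<pi> CARD('r) \<sigma> z) \<in> snd d ` (W \<inter> fst d)"
      using z P[OF zz] by (simp add: V'_def)
    then obtain k where k: "snd d (jet M E \<pi> CARD('r) \<sigma> z) = snd d k" "k \<in> W \<inter> fst d"
      by (rule imageE)
    then have "jet M E \<pi> CARD('r) \<sigma> z = k" using inj_onD[OF injd _ zd] sd by simp
    then show "jet M E \<pi> CARD('r) \<sigma> z \<in> W" using k(2) by simp
  qed
qed

lemma equiv_solution_germ_rel: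
  "equiv (pointed_solutions r M E \<pi> \<E>) (solution_germ_rel r M E \<pi> \<E>)"
proof (rule equivI)
  let ?R = "solution_germ_rel r M E \<pi> \<E>" and ?P = "pointed_solutions r M E \<pi> \<E>"
  show "?R \<subseteq> ?P \<times> ?P" by (auto simp: solution_germ_rel_def)
  show "refl_on ?P ?R"
  proof (rule refl_onI)
    fix p assume p: "p \<in> ?P"
    obtain x \<sigma> where p': "p = (x, \<sigma>)" by (cases p)
    have "local_section M E \<pi> \<sigma>" "x \<in> fst \<sigma>"
      using p p' by (simp_all add: pointed_solutions_def classical_solution_def)
    then show "(p, p) \<in> ?R"
      using p unfolding p' solution_germ_rel_def local_section_def by blast
  qed
  show "sym ?R"
    unfolding sym_def solution_germ_rel_def by fastforce
  show "trans ?R"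
  proof (rule transI)
    fix p q s assume pq: "(p, q) \<in> ?R" and qs: "(q, s) \<in> ?R"
    obtain x \<sigma> \<tau> W where 1: "p = (x, \<sigma>)" "q = (x, \<tau>)" "p \<in> ?P" "openin (atlas_topology M) W" "x \<in> W"
      "W \<subseteq> fst \<sigma> \<inter> fst \<tau>" "\<And>z. z \<in> W \<Longrightarrow> snd \<sigma> z = snd \<tau> z"
      using pq unfolding solution_germ_rel_def by blast
    obtain \<rho> W' where 2: "s = (x, \<rho>)" "s \<in> ?P" "openin (atlas_topology M) W'" "x \<in> W'"
      "W' \<subseteq> fst \<tau> \<inter> fst \<rho>" "\<And>z. z \<in> W' \<Longrightarrow> snd \<tau> z = snd \<rho> z"
      using qs 1(2) unfolding solution_germ_rel_def by blast
    have "openin (atlas_topology M) (W \<inter> W') \<and> x \<in> W \<inter> W' \<and> W \<inter> W' \<subseteq> fst \<sigma> \<inter> fst \<rho> \<and>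
        (\<forall>z\<in>W \<inter> W'. snd \<sigma> z = snd \<rho> z)"
      using 1 2 by auto
    then show "(p, s) \<in> ?R" using 1(1,3) 2(1,2) unfolding solution_germ_rel_def by blast
  qed
qed

lemma equiv_legendrian_germ_rel:
  assumes \<E>: "pde_system r M E \<pi> \<E>"
  shows "equiv (pointed_legendrians r M E \<pi> \<E>) (legendrian_germ_rel r M E \<pi> \<E>)"
proof (rule equivI)
  let ?R = "legendrian_germ_rel r M E \<pi> \<E>" and ?P = "pointed_legendrians r M E \<pi> \<E>"
  let ?T = "atlas_topology (jet_bundle r M E \<pi>)"
  show "?R \<subseteq> ?P \<times> ?P" by (auto simp: legendrian_germ_rel_def)
  show "refl_on ?P ?R"
  proof (rule refl_onI)
    fix p assume p: "p \<in> ?P"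
    obtain j S where p': "p = (j, S)" by (cases p)
    have "j \<in> \<E>" using p p' by (auto simp: pointed_legendrians_def)
    then obtain c where c: "c \<in> maximal_atlas (jet_bundle r M E \<pi>)" "j \<in> fst c"
      using pde_system_chart[OF \<E>] by blast
    have "openin ?T (fst c)" by (rule openin_chart_domain[OF injective_charts_jet_bundle c(1)])
    then show "(p, p) \<in> ?R" using p c(2) unfolding p' legendrian_germ_rel_def by blast
  qed
  show "sym ?R"
    unfolding sym_def legendrian_germ_rel_def by blast
  show "trans ?R"
  proof (rule transI)
    fix p q s assume pq: "(p, q) \<in> ?R" and qs: "(q, s) \<in> ?R"
    obtain j S T W where 1: "p = (j, S)" "q = (j, T)" "p \<in> ?P" "openin ?T W" "j \<in> W" "S \<inter> W = T \<inter> W"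
      using pq unfolding legendrian_germ_rel_def by blast
    obtain U W' where 2: "s = (j, U)" "s \<in> ?P" "openin ?T W'" "j \<in> W'" "T \<inter> W' = U \<inter> W'"
      using qs 1(2) unfolding legendrian_germ_rel_def by blast
    have "openin ?T (W \<inter> W') \<and> j \<in> W \<inter> W' \<and> S \<inter> (W \<inter> W') = U \<inter> (W \<inter> W')"
      using 1 2 by auto
    then show "(p, s) \<in> ?R" using 1(1,3) 2(1,2) unfolding legendrian_germ_rel_def by blast
  qed
qed

text \<open>
  Sections that agree near \<open>x\<close> have the same jets there, and jets with nearby base
  points form a neighbourhood of the jet at \<open>x\<close>. Conversely, if the sets of jets
  agree in a neighbourhood, the jets over points near \<open>x\<close> lie in it by continuity;
  equal jets have equal base points and values.
\<close>

lemma solution_germ_iff_legendrian_germ: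
  fixes r :: "'r::finite itself"
  assumes \<E>: "pde_system r M E \<pi> \<E>"
    and \<sigma>: "classical_solution r M E \<pi> \<E> \<sigma>" "x \<in> fst \<sigma>"
    and \<tau>: "classical_solution r M E \<pi> \<E> \<tau>" "y \<in> fst \<tau>"
  shows "((x, \<sigma>), (y, \<tau>)) \<in> solution_germ_rel r M E \<pi> \<E> \<longleftrightarrow>
    ((jet M E \<pi> CARD('r) \<sigma> x, jet M E \<pi> CARD('r) \<sigma> ` fst \<sigma>),
     (jet M E \<pi> CARD('r) \<tau> y, jet M E \<pi> CARD('r) \<tau> ` fst \<tau>)) \<in> legendrian_germ_rel r M E \<pi> \<E>"
    (is "?L \<longleftrightarrow> ?R")
proof -
  let ?j = "\<lambda>\<rho>. jet M E \<pi> CARD('r) \<rho>"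
  have ls: "local_section M E \<pi> \<sigma>" "local_section M E \<pi> \<tau>"
    and sub: "?j \<sigma> ` fst \<sigma> \<subseteq> \<E>" "?j \<tau> ` fst \<tau> \<subseteq> \<E>"
    using \<sigma> \<tau> by (simp_all add: classical_solution_def)
  have PS: "(x, \<sigma>) \<in> pointed_solutions r M E \<pi> \<E>" "(y, \<tau>) \<in> pointed_solutions r M E \<pi> \<E>"
    using \<sigma> \<tau> by (simp_all add: pointed_solutions_def)
  have PL: "(?j \<sigma> x, ?j \<sigma> ` fst \<sigma>) \<in> pointed_legendrians r M E \<pi> \<E>"
    "(?j \<tau> y, ?j \<tau> ` fst \<tau>) \<in> pointed_legendrians r M E \<pi> \<E>"
    using jet_image_polarised_legendrian[OF \<E> ls(1) sub(1)] jet_image_polarised_legendrian[OF \<E> ls(2) sub(2)]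
      sub \<sigma>(2) \<tau>(2) by (simp_all add: pointed_legendrians_def)
  show ?thesis
  proof
    assume ?L
    then obtain W where xy: "x = y" and W: "openin (atlas_topology M) W" "x \<in> W"
      "W \<subseteq> fst \<sigma> \<inter> fst \<tau>" "\<And>z. z \<in> W \<Longrightarrow> snd \<sigma> z = snd \<tau> z"
      unfolding solution_germ_rel_def by blast
    have eq: "?j \<sigma> z = ?j \<tau> z" if "z \<in> W" for z
      by (rule jet_cong[OF W(1) that W(4) ls(1)]) (use that W(3) in auto)
    have "?j \<sigma> x \<in> \<E>" using sub(1) \<sigma>(2) by blast
    then obtain W' where W': "openin (atlas_topology (jet_bundle r M E \<pi>)) W'" "?j \<sigma> x \<in> W'"
      "\<And>k. k \<in> W' \<Longrightarrow> fst k \<in> W"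
      using openin_jet_basepoint[OF \<E> _ W(1)] W(2) by (metis fst_jet)
    have "?j \<sigma> ` fst \<sigma> \<inter> W' = ?j \<tau> ` fst \<tau> \<inter> W'"
    proof (intro subset_antisym subsetI)
      fix k assume k: "k \<in> ?j \<sigma> ` fst \<sigma> \<inter> W'"
      then obtain z where z: "k = ?j \<sigma> z" by blast
      then have "z \<in> W" using W'(3)[of k] k by simp
      then show "k \<in> ?j \<tau> ` fst \<tau> \<inter> W'" using eq z k W(3) by blast
    next
      fix k assume k: "k \<in> ?j \<tau> ` fst \<tau> \<inter> W'"
      then obtain z where z: "k = ?j \<tau> z" by blast
      then have "z \<in> W" using W'(3)[of k] k by simp
      then show "k \<in> ?j \<sigma> ` fst \<sigma> \<inter> W'" using eq[symmetric] z k W(3) by blast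
    qed
    moreover have "?j \<sigma> x = ?j \<tau> y" using eq[OF W(2)] xy by simp
    ultimately show ?R using PL W'(1,2) unfolding legendrian_germ_rel_def by blast
  next
    assume ?R
    then obtain W where jj: "?j \<sigma> x = ?j \<tau> y" and W: "openin (atlas_topology (jet_bundle r M E \<pi>)) W"
      "?j \<sigma> x \<in> W" "?j \<sigma> ` fst \<sigma> \<inter> W = ?j \<tau> ` fst \<tau> \<inter> W"
      unfolding legendrian_germ_rel_def by blast
    have xy: "x = y" using arg_cong[OF jj, of fst] by simp
    have "?j \<sigma> x \<in> \<E>" using sub(1) \<sigma>(2) by blast
    then obtain X where X: "openin (atlas_topology M) X" "x \<in> X" "X \<subseteq> fst \<sigma>" "\<And>z. z \<in> X \<Longrightarrow> ?j \<sigma> z \<in> W"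
      using jet_prolongation_continuous[OF ls(1) \<sigma>(2) \<E> _ W(1,2)] by blast
    have "z \<in> fst \<tau> \<and> snd \<sigma> z = snd \<tau> z" if z: "z \<in> X" for z
    proof -
      have "?j \<sigma> z \<in> ?j \<tau> ` fst \<tau>" using W(3) X(3,4) z by blast
      then obtain z' where z': "?j \<sigma> z = ?j \<tau> z'" "z' \<in> fst \<tau>" by blast
      have "z = z'" using arg_cong[OF z'(1), of fst] by simp
      then have "?j \<sigma> z = ?j \<tau> z" "z \<in> fst \<tau>" using z' by simp_all
      with jet_eqD[OF this(1) ls(2) this(2)] show ?thesis by (simp add: jet_equiv_def)
    qed
    then have "openin (atlas_topology M) X \<and> x \<in> X \<and> X \<subseteq> fst \<sigma> \<inter> fst \<tau> \<and> (\<forall>z\<in>X. snd \<sigma> z = snd \<tau> z)"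
      using X by blast
    then show ?L using PS xy unfolding solution_germ_rel_def by blast
  qed
qed

lemma legendrian_germ_has_solution:
  fixes r :: "'r::finite itself"
  assumes jS: "(j, S) \<in> pointed_legendrians r M E \<pi> \<E>" and \<E>: "pde_system r M E \<pi> \<E>"
  shows "\<exists>(x, \<sigma>) \<in> pointed_solutions r M E \<pi> \<E>.
    ((jet M E \<pi> CARD('r) \<sigma> x, jet M E \<pi> CARD('r) \<sigma> ` fst \<sigma>), (j, S)) \<in> legendrian_germ_rel r M E \<pi> \<E>"
proof -
  have S: "polarised_legendrian r M E \<pi> CARD('n) S" "S \<subseteq> \<E>" "j \<in> S"
    using jS by (simp_all add: pointed_legendrians_def)
  obtain \<sigma> W where \<sigma>: "local_section M E \<pi> \<sigma>" "jet M E \<pi> CARD('r) \<sigma> ` fst \<sigma> \<subseteq> S"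
    and W: "openin (atlas_topology (jet_bundle r M E \<pi>)) W" "j \<in> W"
      "S \<inter> W \<subseteq> jet M E \<pi> CARD('r) \<sigma> ` fst \<sigma>"
    using polarised_legendrian_is_jet_image[OF S(1,3)] by blast
  obtain x where x: "x \<in> fst \<sigma>" "j = jet M E \<pi> CARD('r) \<sigma> x" using W(2,3) S(3) by blast
  have sub: "jet M E \<pi> CARD('r) \<sigma> ` fst \<sigma> \<subseteq> \<E>" using \<sigma>(2) S(2) by blast
  have "(x, \<sigma>) \<in> pointed_solutions r M E \<pi> \<E>"
    using \<sigma>(1) sub x(1) by (simp add: pointed_solutions_def classical_solution_def)
  moreover have "(j, jet M E \<pi> CARD('r) \<sigma> ` fst \<sigma>) \<in> pointed_legendrians r M E \<pi> \<E>"
    using jet_image_polarised_legendrian[OF \<E> \<sigma>(1) sub] sub x by (simp add: pointed_legendrians_def)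
  moreover have "jet M E \<pi> CARD('r) \<sigma> ` fst \<sigma> \<inter> W = S \<inter> W" using \<sigma>(2) W(3) by blast
  ultimately have "((jet M E \<pi> CARD('r) \<sigma> x, jet M E \<pi> CARD('r) \<sigma> ` fst \<sigma>), (j, S)) \<in> legendrian_germ_rel r M E \<pi> \<E>"
    using jS W(1,2) unfolding legendrian_germ_rel_def x(2)[symmetric] by blast
  with \<open>(x, \<sigma>) \<in> pointed_solutions r M E \<pi> \<E>\<close> show ?thesis by blast
qed

end

theorem theorem10p4:
  fixes M :: "('b, real^'n) chart set"
    and E :: "('e, (real^'n) \<times> (real^'m)) chart set"
    and \<pi> :: "'e \<Rightarrow> 'b"
    and \<E> :: "('b, 'e) jet set"
    and r :: "'r::finite itself"
  assumes "fibred_manifold M E \<pi>"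
    and "regular_pde r M E \<pi> \<E>"
  shows "\<exists>F.
    (\<forall>(x, \<sigma>) \<in> pointed_solutions r M E \<pi> \<E>.
       F (solution_germ_rel r M E \<pi> \<E> `` {(x, \<sigma>)}) =
       legendrian_germ_rel r M E \<pi> \<E> ``
         {(jet M E \<pi> CARD('r) \<sigma> x, jet M E \<pi> CARD('r) \<sigma> ` fst \<sigma>)}) \<and>
    bij_betw F
      (pointed_solutions r M E \<pi> \<E> // solution_germ_rel r M E \<pi> \<E>)
      (pointed_legendrians r M E \<pi> \<E> // legendrian_germ_rel r M E \<pi> \<E>)"
proof -
  interpret jets_of_sections M E \<pi>
    by unfold_locales (use assms(1) in \<open>simp_all add: fibred_manifold_def\<close>)
  have \<E>: "pde_system r M E \<pi> \<E>" using assms(2) by (simp add: regular_pde_def)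
  define g where "g p = (jet M E \<pi> CARD('r) (snd p) (fst p), jet M E \<pi> CARD('r) (snd p) ` fst (snd p))"
    for p :: "'b \<times> ('b, 'e) sect"
  have "\<exists>F. (\<forall>p\<in>pointed_solutions r M E \<pi> \<E>.
      F (solution_germ_rel r M E \<pi> \<E> `` {p}) = legendrian_germ_rel r M E \<pi> \<E> `` {g p}) \<and>
    bij_betw F (pointed_solutions r M E \<pi> \<E> // solution_germ_rel r M E \<pi> \<E>)
      (pointed_legendrians r M E \<pi> \<E> // legendrian_germ_rel r M E \<pi> \<E>)"
  proof (rule bij_betw_quotients[OF equiv_solution_germ_rel equiv_legendrian_germ_rel[OF \<E>]])
    fix p assume "p \<in> pointed_solutions r M E \<pi> \<E>"
    then have p: "local_section M E \<pi> (snd p)" "jet M E \<pi> CARD('r) (snd p) ` fst (snd p) \<subseteq> \<E>" "fst p \<in> fst (snd p)"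
      by (auto simp: pointed_solutions_def classical_solution_def)
    then show "g p \<in> pointed_legendrians r M E \<pi> \<E>"
      using jet_image_polarised_legendrian[OF \<E> p(1,2)] by (simp add: pointed_legendrians_def g_def)
  next
    fix p q assume "p \<in> pointed_solutions r M E \<pi> \<E>" "q \<in> pointed_solutions r M E \<pi> \<E>"
    then show "(p, q) \<in> solution_germ_rel r M E \<pi> \<E> \<longleftrightarrow> (g p, g q) \<in> legendrian_germ_rel r M E \<pi> \<E>"
      using solution_germ_iff_legendrian_germ[OF \<E>, of "snd p" "fst p" "snd q" "fst q"]
      by (simp add: pointed_solutions_def g_def case_prod_beta)
  next
    fix l assume "l \<in> pointed_legendrians r M E \<pi> \<E>"
    then show "\<exists>p\<in>pointed_solutions r M E \<pi> \<E>. (g p, l) \<in> legendrian_germ_rel r M E \<pi> \<E>"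
      using legendrian_germ_has_solution[OF _ \<E>, of "fst l" "snd l"] by (force simp: g_def)
  qed
  then show ?thesis by (simp add: g_def case_prod_beta)
qed

end
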